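(* Let $d\ge2$, let $(S,\mathcal B(S),\nu)$ be a probability space over a Polish space $S$, and for $s\in S$ let $dm_s(x)=\varrho(s,x)\,dx$ be a probability measure on $\mathbb R^d$ with density $\varrho(s,\cdot)$, such that $s\mapsto m_s(A)$ is measurable for each Borel $A\subseteq\mathbb R^d$. Let $f:S\to\mathbb R$ be bounded measurable, $g\in C_c^1(\mathbb R^d)$ and $\kappa:S\times\mathbb R^d\to[0,1]$ measurable. For every $u\in\mathcal D(\int^\oplus E^{\varrho(s,\cdot)}d\nu)$ with $-1\le u\le1$ and every $r\in(0,\infty)$ there exists $\lambda\in\mathscr L_r$ such that each of the following holds: (i) $|\lambda^\alpha(\cdot)|\le1$, where $\lambda^\alpha$ is the coefficient of $\lambda$ with index $\alpha\in r\mathbb Z^d$. (ii) $\displaystyle\Big|\int_S\int_{\mathbb R^d}f(s)g(x)\big(u(s,x)-\lambda(s,x)\big)\kappa(s,x)\,dm_s(x)\,d\nu(s)\Big|\le\|f\|_{L^\infty(\nu)}\big(\omega_r^g+\|g\|_\infty\,\|\delta_r^{\kappa(s,\cdot)}(m_s)\|_{L^2(\nu)}\big).$ (iii) $\displaystyle\Big|\int_Sf(s)\,E^{\kappa\varrho(s,\cdot)}\big(g,u(s,\cdot)-\lambda(s,\cdot)\big)\,d\nu(s)\Big|\le\sqrt d\,\|f\|_{L^\infty(\nu)}\big(\omega_r^{\nabla g}+D^g\,\|\delta_r^{\kappa(s,\cdot)}(m_s)\|_{L^2(\nu)}\big)\Big(\int_SE^{\varrho(s,\cdot)}(u(s,\cdot),u(s,\cdot))\,d\nu(s)\Big)^{1/2}.$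 (iv) $\displaystyle\int_SE^{\kappa\varrho(s,\cdot)}\big(\lambda(s,\cdot),\lambda(s,\cdot)\big)\,d\nu(s)\le\|C_r^{\kappa(s,\cdot)}(m_s)\|_{L^\infty(\nu)}\int_SE^{\varrho(s,\cdot)}(u(s,\cdot),u(s,\cdot))\,d\nu(s).$
   Context: $\mathscr D$ is the set of $h\in C_b(\mathbb R^d)$ with weak partial derivatives $\partial_ih\in L^\infty(\mathbb R^d,dx)$, $i=1,\dots,d$. For a non-negative integrable $\rho$ on $\mathbb R^d$, $E^\rho(h,k)=\sum_{i=1}^d\int_{\mathbb R^d}\partial_ih\,\partial_ik\,\rho\,dx$ for $h,k\in\mathscr D$; $E^{\kappa\varrho(s,\cdot)}$ uses $\rho=\kappa(s,\cdot)\varrho(s,\cdot)$. $\mathcal D(\int^\oplus E^{\varrho(s,\cdot)}d\nu)$ is the set of bounded measurable $u:S\times\mathbb R^d\to\mathbb R$ with $u(s,\cdot)\in\mathscr D$ for all $s\in S$ and $s\mapsto E^{\varrho(s,\cdot)}(u(s,\cdot),u(s,\cdot))$ measurable and $\nu$-integrable. Tent functions: $\chi_1^0(x)=\max\{0,\min\{1+x_{\min},\,1-x_{\max},\,1+x_{\min}-x_{\max}\}\}$ with $x_{\min}=\min_kx_k$, $x_{\max}=\max_kx_k$ (the piecewise linear hat function at $0$ of the Coxeter–Freudenthal–Kuhn triangulation of $\mathbb R^d$), and $\chi_r^\alpha(x)=\chi_1^0((x-\alpha)/r)$ for $r>0$, $\alpha\in r\mathbb Z^d$. $\mathscr L_r$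 is the set of functions $\lambda(s,x)=\sum_{\alpha\in r\mathbb Z^d}\lambda^\alpha(s)\chi_r^\alpha(x)$ for which there is $M\in(0,\infty)$ such that all $\lambda^\alpha:S\to[-M,M]$ are measurable. For $g\in C_c(\mathbb R^d)$, $\varepsilon>0$: $\omega_\varepsilon^g=\sup\{|g(x)-g(y)|:\max_j|x_j-y_j|\le4\varepsilon\}$; for $g\in C_c^1(\mathbb R^d)$: $\omega_\varepsilon^{\nabla g}=\max_i\omega_\varepsilon^{\partial_ig}$, $D^g=\max_i\|\partial_ig\|_\infty$. A measurable $\varphi:\mathbb R^d\to[0,1]$ is primal if its support is contained in $[-2,2]^d$, $\int\varphi\,dx=1$ and $\sum_{\alpha\in\mathbb Z^d}\varphi(x-\alpha)=1$ for all $x$; $\mathscr C$ is the set of primal functions; $\varphi_r^\alpha(x)=\varphi((x-\alpha)/r)$. For $\varphi,\eta\in\mathscr C$ and non-negative integrable $h$: $R_r^{\varphi,\eta}(h)(y)=\sum_{\alpha\in r\mathbb Z^d}r^{-d}\int|h(y)-h(x)|\eta_r^\alpha(x)\,dx\,\varphi_r^\alpha(y)$, $I_r^{\varphi,\eta}(h)(y)=\sum_{\alpha\in r\mathbb Z^d}r^{-d}\int\eta_r^\alpha(x)h(x)\,dx\,\varphi_r^\alpha(y)$. For a probability $m=\rho\,dx$ and measurable $\tau:\mathbb R^d\to[0,1]$: $\delta_r^\tau(m)=\sup_{\varphi,\eta\in\mathscr C}\sup_h|\int hR_r^{\varphi,\eta}(\tau\rho)\,dx|/\|h\|_{L^2(m)}$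 and $C_r^\tau(m)=\sup_{\varphi,\eta\in\mathscr C}\sup_h|\int hI_r^{\varphi,\eta}(\tau\rho)\,dx|/\|h\|_{L^1(m)}$ in $[0,\infty]$, with $h$ ranging over bounded measurable functions, and $1/0=\infty$, $\infty\cdot0=0$. *)

theory Defs
  imports "HOL-Probability.Probability"
begin

section \<open>Classical and weak partial derivatives\<close>

definition pderiv_at :: "'n \<Rightarrow> (real^'n \<Rightarrow> real) \<Rightarrow> real^'n \<Rightarrow> real" where
  "pderiv_at i g x = frechet_derivative g (at x) (axis i 1)"

fun continuously_diff :: "nat \<Rightarrow> (real^'n \<Rightarrow> real) \<Rightarrow> bool" where
  "continuously_diff 0 g \<longleftrightarrow> continuous_on UNIV g"
| "continuously_diff (Suc k) g \<longleftrightarrow>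
     (\<forall>x. g differentiable (at x)) \<and> (\<forall>i. continuously_diff k (pderiv_at i g))"

definition fun_support :: "(real^'n \<Rightarrow> real) \<Rightarrow> (real^'n) set" where
  "fun_support g = closure {x. g x \<noteq> 0}"

definition Cc1 :: "(real^'n \<Rightarrow> real) set" where
  "Cc1 = {g. continuously_diff 1 g \<and> compact (fun_support g)}"

definition test_functions :: "(real^'n \<Rightarrow> real) set" where
  "test_functions = {\<psi>. (\<forall>k. continuously_diff k \<psi>) \<and> compact (fun_support \<psi>)}"

definition locally_integrable :: "(real^'n \<Rightarrow> real) \<Rightarrow> bool" where
  "locally_integrable w \<longleftrightarrow>
     w \<in> borel_measurable borel \<and> (\<forall>K. compact K \<longrightarrow> set_integrable lborel K w)"

definition is_weak_pderiv :: "'n \<Rightarrow> (real^'n \<Rightarrow> real) \<Rightarrow> (real^'n \<Rightarrow> real) \<Rightarrow> bool" where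
  "is_weak_pderiv i h w \<longleftrightarrow> locally_integrable h \<and> locally_integrable w \<and>
     (\<forall>\<psi>\<in>test_functions.
        (\<integral>x. h x * pderiv_at i \<psi> x \<partial>lborel) = - (\<integral>x. w x * \<psi> x \<partial>lborel))"

text \<open>A weak derivative is unique up to Lebesgue null sets; \<open>weak_pderiv\<close> picks a Borel
  representative. It is only used under integrals against densities, where the choice
  does not matter.\<close>

definition weak_pderiv :: "'n \<Rightarrow> (real^'n \<Rightarrow> real) \<Rightarrow> real^'n \<Rightarrow> real" where
  "weak_pderiv i h = (SOME w. is_weak_pderiv i h w)"

section \<open>The forms and their domains\<close>

definition form_core :: "(real^'n \<Rightarrow> real) set" where
  "form_core = {h. continuous_on UNIV h \<and> bounded (range h) \<and>
     (\<forall>i. \<exists>w. is_weak_pderiv i h w \<and> (\<exists>B. AE x in lborel. \<bar>w x\<bar> \<le> B))}"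

definition energy ::
  "(real^'n \<Rightarrow> real) \<Rightarrow> (real^'n \<Rightarrow> real) \<Rightarrow> (real^'n \<Rightarrow> real) \<Rightarrow> real" where
  "energy \<rho> h k = (\<Sum>i\<in>UNIV. \<integral>x. weak_pderiv i h x * weak_pderiv i k x * \<rho> x \<partial>lborel)"

definition direct_integral_domain ::
  "'s measure \<Rightarrow> ('s \<Rightarrow> real^'n \<Rightarrow> real) \<Rightarrow> ('s \<Rightarrow> real^'n \<Rightarrow> real) set" where
  "direct_integral_domain \<nu> \<rho> = {u.
     case_prod u \<in> borel_measurable (\<nu> \<Otimes>\<^sub>M borel) \<and>
     (\<exists>B. \<forall>s x. \<bar>u s x\<bar> \<le> B) \<and>
     (\<forall>s\<in>space \<nu>. u s \<in> form_core) \<and>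
     integrable \<nu> (\<lambda>s. energy (\<rho> s) (u s) (u s))}"

section \<open>Tent functions and primal functions\<close>

definition grid :: "real \<Rightarrow> (real^'n) set" where
  "grid r = {\<alpha>. \<forall>i. \<exists>k::int. \<alpha> $ i = r * of_int k}"

definition scaled :: "(real^'n \<Rightarrow> real) \<Rightarrow> real \<Rightarrow> real^'n \<Rightarrow> real^'n \<Rightarrow> real" where
  "scaled \<phi> r \<alpha> x = \<phi> ((1 / r) *\<^sub>R (x - \<alpha>))"

definition tent :: "real^'n \<Rightarrow> real" where
  "tent x = (let xmin = Min (range (\<lambda>k. x $ k)); xmax = Max (range (\<lambda>k. x $ k))
     in max 0 (min (1 + xmin) (min (1 - xmax) (1 + xmin - xmax))))"

text \<open>\<open>tent_expansion \<nu> r lam c\<close>: \<open>c \<alpha>\<close> is the coefficient of \<open>lam\<close> with index \<open>\<alpha>\<close>.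
  For each \<open>x\<close> only finitely many terms of the series are nonzero.\<close>

definition tent_expansion ::
  "'s measure \<Rightarrow> real \<Rightarrow> ('s \<Rightarrow> real^'n \<Rightarrow> real) \<Rightarrow> (real^'n \<Rightarrow> 's \<Rightarrow> real) \<Rightarrow> bool" where
  "tent_expansion \<nu> r lam c \<longleftrightarrow>
     (\<exists>M>0. \<forall>\<alpha>\<in>grid r. c \<alpha> \<in> borel_measurable \<nu> \<and> (\<forall>s\<in>space \<nu>. \<bar>c \<alpha> s\<bar> \<le> M)) \<and>
     (\<forall>s\<in>space \<nu>. \<forall>x. lam s x = (\<Sum>\<^sub>\<infinity>\<alpha>\<in>grid r. c \<alpha> s * scaled tent r \<alpha> x))"

definition tent_space :: "'s measure \<Rightarrow> real \<Rightarrow> ('s \<Rightarrow> real^'n \<Rightarrow> real) set" where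
  "tent_space \<nu> r = {lam. \<exists>c. tent_expansion \<nu> r lam c}"

definition primal :: "(real^'n \<Rightarrow> real) set" where
  "primal = {\<phi>. \<phi> \<in> borel_measurable borel \<and> (\<forall>x. 0 \<le> \<phi> x \<and> \<phi> x \<le> 1) \<and>
     fun_support \<phi> \<subseteq> {x. \<forall>i. - 2 \<le> x $ i \<and> x $ i \<le> 2} \<and>
     (\<integral>x. \<phi> x \<partial>lborel) = 1 \<and>
     (\<forall>x. (\<Sum>\<^sub>\<infinity>\<alpha>\<in>grid 1. \<phi> (x - \<alpha>)) = 1)}"

section \<open>Norms and moduli with values in the extended non-negative reals\<close>

definition ennreal_sqrt :: "ennreal \<Rightarrow> ennreal" where
  "ennreal_sqrt a = (if a = \<infinity> then \<infinity> else ennreal (sqrt (enn2real a)))"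

definition L2_norm :: "'a measure \<Rightarrow> ('a \<Rightarrow> ennreal) \<Rightarrow> ennreal" where
  "L2_norm M F = ennreal_sqrt (\<integral>\<^sup>+ x. (F x)\<^sup>2 \<partial>M)"

text \<open>On measurable functions this is \<open>esssup M F\<close>. The explicit form avoids that the
  library's \<open>esssup\<close> is set to \<open>top\<close> on non-measurable functions.\<close>

definition Linf_norm :: "'a measure \<Rightarrow> ('a \<Rightarrow> ennreal) \<Rightarrow> ennreal" where
  "Linf_norm M F = Inf {c. AE x in M. F x \<le> c}"

definition sup_norm :: "(real^'n \<Rightarrow> real) \<Rightarrow> ennreal" where
  "sup_norm g = (SUP x. ennreal \<bar>g x\<bar>)"

definition osc :: "real \<Rightarrow> (real^'n \<Rightarrow> real) \<Rightarrow> ennreal" where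
  "osc \<epsilon> g = (SUP (x, y)\<in>{(x, y). \<forall>j. \<bar>x $ j - y $ j\<bar> \<le> 4 * \<epsilon>}. ennreal \<bar>g x - g y\<bar>)"

definition grad_osc :: "real \<Rightarrow> (real^'n \<Rightarrow> real) \<Rightarrow> ennreal" where
  "grad_osc \<epsilon> g = (MAX i\<in>UNIV. osc \<epsilon> (pderiv_at i g))"

definition grad_sup_norm :: "(real^'n \<Rightarrow> real) \<Rightarrow> ennreal" where
  "grad_sup_norm g = (MAX i\<in>UNIV. sup_norm (pderiv_at i g))"

section \<open>The operators and the constants built from them\<close>

definition R_op ::
  "real \<Rightarrow> (real^'n \<Rightarrow> real) \<Rightarrow> (real^'n \<Rightarrow> real) \<Rightarrow> (real^'n \<Rightarrow> real) \<Rightarrow> real^'n \<Rightarrow> real" where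
  "R_op r \<phi> \<eta> h y = (\<Sum>\<^sub>\<infinity>\<alpha>\<in>grid r.
     (1 / r ^ CARD('n)) * (\<integral>x. \<bar>h y - h x\<bar> * scaled \<eta> r \<alpha> x \<partial>lborel) * scaled \<phi> r \<alpha> y)"

definition I_op ::
  "real \<Rightarrow> (real^'n \<Rightarrow> real) \<Rightarrow> (real^'n \<Rightarrow> real) \<Rightarrow> (real^'n \<Rightarrow> real) \<Rightarrow> real^'n \<Rightarrow> real" where
  "I_op r \<phi> \<eta> h y = (\<Sum>\<^sub>\<infinity>\<alpha>\<in>grid r.
     (1 / r ^ CARD('n)) * (\<integral>x. scaled \<eta> r \<alpha> x * h x \<partial>lborel) * scaled \<phi> r \<alpha> y)"

definition bounded_measurable :: "(real^'n \<Rightarrow> real) set" where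
  "bounded_measurable = {h. h \<in> borel_measurable borel \<and> bounded (range h)}"

definition density_measure :: "(real^'n \<Rightarrow> real) \<Rightarrow> (real^'n) measure" where
  "density_measure \<rho> = density lborel (\<lambda>x. ennreal (\<rho> x))"

text \<open>Division in \<open>ennreal\<close> realises the conventions \<open>1 / 0 = \<infinity>\<close> and \<open>\<infinity> * 0 = 0\<close>:
  \<open>a / 0\<close> is \<open>\<infinity>\<close> for \<open>a > 0\<close>, and \<open>0 / 0 = 0\<close>. The probability measure is given by its
  density \<open>\<rho>\<close>; the values do not depend on the version of the density.\<close>

definition delta_const :: "real \<Rightarrow> (real^'n \<Rightarrow> real) \<Rightarrow> (real^'n \<Rightarrow> real) \<Rightarrow> ennreal" where
  "delta_const r \<tau> \<rho> = (SUP \<phi>\<in>primal. SUP \<eta>\<in>primal. SUP h\<in>bounded_measurable.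
     ennreal \<bar>\<integral>x. h x * R_op r \<phi> \<eta> (\<lambda>x. \<tau> x * \<rho> x) x \<partial>lborel\<bar>
       / L2_norm (density_measure \<rho>) (\<lambda>x. ennreal \<bar>h x\<bar>))"

definition C_const :: "real \<Rightarrow> (real^'n \<Rightarrow> real) \<Rightarrow> (real^'n \<Rightarrow> real) \<Rightarrow> ennreal" where
  "C_const r \<tau> \<rho> = (SUP \<phi>\<in>primal. SUP \<eta>\<in>primal. SUP h\<in>bounded_measurable.
     ennreal \<bar>\<integral>x. h x * I_op r \<phi> \<eta> (\<lambda>x. \<tau> x * \<rho> x) x \<partial>lborel\<bar>
       / (\<integral>\<^sup>+ x. ennreal \<bar>h x\<bar> \<partial>density_measure \<rho>))"

end

theory Submission
  imports Defs
begin

text \<open>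
  Everything happens fibrewise. Let \<open>h = \<kappa> \<rho>\<close>. The coefficients of \<open>\<lambda>\<close> are averages of \<open>u\<close> against a
  smooth primal function that is a product of one-dimensional bumps. On the Kuhn triangulation the
  partial derivative of \<open>\<lambda>\<close> in direction \<open>i\<close> is piecewise constant, and its values are differences of
  neighbouring coefficients. By the choice of the bumps such a difference is again an average of the
  weak derivative \<open>\<partial>\<^sub>i u\<close>. So \<open>\<lambda>\<close> and its derivatives arise from \<open>u\<close> and \<open>\<partial>\<^sub>i u\<close> by the integral operator
  with the bistochastic kernel \<open>K(x, y) = \<Sum>\<alpha>. r\<^sup>-\<^sup>d \<phi>\<^sub>r\<^sup>\<alpha>(x) \<eta>\<^sub>r\<^sup>\<alpha>(y)\<close>, where \<open>\<phi>\<close> and \<open>\<eta>\<close> are primal and \<open>K\<close>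
  vanishes unless \<open>x\<close> and \<open>y\<close> have distance at most \<open>4r\<close>.

  Fubini and \<open>G(y) h(y) - G(x) h(x) = (G(y) - G(x)) h(y) + G(x) (h(y) - h(x))\<close> give
  \<open>\<bar>\<integral>G (w - K w) h\<bar> \<le> \<omega> \<integral>\<bar>w\<bar> h + \<parallel>G\<parallel> \<integral>\<bar>w\<bar> R(h)\<close>, and Jensen's inequality gives \<open>\<integral>(K w)\<^sup>2 h \<le> \<integral>w\<^sup>2 I(h)\<close>.
  The definitions of \<open>\<delta>\<close> and \<open>C\<close> then yield the three estimates.

  The convention \<open>\<infinity> * 0 = 0\<close> is a difficulty in the fibres where \<open>u\<close> has energy 0 but the interpolant has
  positive energy. There \<open>\<delta>\<close> is infinite, and the coefficients are set to 0.
\<close>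

section \<open>Smooth functions of one variable\<close>

text \<open>Differences of coefficients must be exact averages of the weak derivative, and the weak
  derivative can only be tested against smooth functions with compact support. This fixes the shape
  of the bumps: in one variable they are differences \<open>P t - P (t - 1)\<close> of a smooth
  transition from 0 to 1. The partition of unity telescopes, and if \<open>Q\<close> is a primitive
  of the bump of \<open>P\<close>, then the bump of \<open>Q\<close> has a difference of two bumps
  of \<open>P\<close> as its derivative. The supports are contained in [-1, 1] and [-1, 2], inside
  the [-2, 2] of a primal function.

  The Kuhn triangulation enters through random rounding: shift all coordinates of a point by the
  same uniform \<theta> in [0, 1) and round down; a grid point is hit with a probability given by
  the tent function. An increment in direction i comes only from those \<theta> for which coordinate
  i jumps, which gives the gradient without any enumeration of simplices.

  Measurability in s is delicate: \<delta> and C are suprema over uncountable families, and \<rho>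
  is not assumed jointly measurable. Degenerate fibres are therefore recognised by two energies and
  not by \<delta>.\<close>

text \<open>The derivative is quantified existentially, so that closure properties follow by
  induction over the order with an explicit witness. Continuity is left to the next order and need
  not be carried along.\<close>

fun times_diff :: "nat \<Rightarrow> (real \<Rightarrow> real) \<Rightarrow> bool" where
  "times_diff 0 h \<longleftrightarrow> True"
| "times_diff (Suc k) h \<longleftrightarrow> (\<exists>h'. (\<forall>x. (h has_real_derivative h' x) (at x)) \<and> times_diff k h')"

definition smooth :: "(real \<Rightarrow> real) \<Rightarrow> bool" where
  "smooth h \<longleftrightarrow> (\<forall>k. times_diff k h)"

lemma times_diff_Suc: "times_diff (Suc k) h \<Longrightarrow> times_diff k h"
  by (induction k arbitrary: h) (auto simp del: times_diff.simps(2), auto)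

lemma times_diff_add: "times_diff k f \<Longrightarrow> times_diff k g \<Longrightarrow> times_diff k (\<lambda>x. f x + g x)"
proof (induction k arbitrary: f g)
  case (Suc k)
  then obtain f' g' where "\<And>x. (f has_real_derivative f' x) (at x)" "times_diff k f'"
    "\<And>x. (g has_real_derivative g' x) (at x)" "times_diff k g'" by auto
  with Suc.IH show ?case
    by (auto intro!: exI[of _ "\<lambda>x. f' x + g' x"] DERIV_add)
qed simp

lemma times_diff_mult: "times_diff k f \<Longrightarrow> times_diff k g \<Longrightarrow> times_diff k (\<lambda>x. f x * g x)"
proof (induction k arbitrary: f g)
  case (Suc k)
  then obtain f' g' where *: "\<And>x. (f has_real_derivative f' x) (at x)" "times_diff k f'"
    "\<And>x. (g has_real_derivative g' x) (at x)" "times_diff k g'" by auto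
  have "times_diff k (\<lambda>x. f' x * g x + g' x * f x)"
    using Suc * times_diff_Suc by (intro times_diff_add Suc.IH) blast+
  with * show ?case
    by (auto intro!: exI[of _ "\<lambda>x. f' x * g x + g' x * f x"] DERIV_mult)
qed simp

lemma times_diff_const: "times_diff k (\<lambda>x. c)"
proof (induction k arbitrary: c)
  case (Suc k)
  then show ?case by (auto intro!: exI[of _ "\<lambda>x. 0"])
qed simp

lemma times_diff_affine: "times_diff k f \<Longrightarrow> times_diff k (\<lambda>x. f (a * x + b))"
proof (induction k arbitrary: f)
  case (Suc k)
  then obtain f' where *: "\<And>x. (f has_real_derivative f' x) (at x)" "times_diff k f'" by auto
  have "((\<lambda>x. f (a * x + b)) has_real_derivative f' (a * x + b) * a) (at x)" for x
    by (rule DERIV_chain'[where f = "\<lambda>x. a * x + b" and g = f, of a x UNIV])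
       (auto intro!: derivative_eq_intros *)
  moreover have "times_diff k (\<lambda>x. f' (a * x + b) * a)"
    using Suc.IH * times_diff_const by (intro times_diff_mult) auto
  ultimately show ?case by (auto intro!: exI[of _ "\<lambda>x. f' (a * x + b) * a"])
qed simp

lemma smooth_add: "smooth f \<Longrightarrow> smooth g \<Longrightarrow> smooth (\<lambda>x. f x + g x)"
  and smooth_mult: "smooth f \<Longrightarrow> smooth g \<Longrightarrow> smooth (\<lambda>x. f x * g x)"
  and smooth_const: "smooth (\<lambda>x. c)"
  and smooth_affine: "smooth f \<Longrightarrow> smooth (\<lambda>x. f (a * x + b))"
  by (auto simp: smooth_def times_diff_add times_diff_mult times_diff_const times_diff_affine)

lemma smooth_diff: "smooth f \<Longrightarrow> smooth g \<Longrightarrow> smooth (\<lambda>x. f x - g x)"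
  using smooth_add[of f "\<lambda>x. (-1) * g x"] smooth_mult[OF smooth_const, of g "-1"] by simp

lemma smooth_antideriv:
  assumes "\<And>x. (f has_real_derivative f' x) (at x)" "smooth f'"
  shows "smooth f"
  unfolding smooth_def
proof
  fix k show "times_diff k f"
    using assms by (cases k) (auto simp: smooth_def)
qed

text \<open>Derivatives are unique, so the witnesses for the different orders are one and the same
  function \<open>deriv f\<close>.\<close>

lemma smooth_deriv:
  assumes "smooth f"
  shows "\<And>x. (f has_real_derivative deriv f x) (at x)" "smooth (deriv f)"
proof -
  have *: "\<exists>f'. (\<forall>x. (f has_real_derivative f' x) (at x)) \<and> times_diff k f'" for k
    using assms unfolding smooth_def by (metis times_diff.simps(2))
  have eq: "(\<And>x. (f has_real_derivative f' x) (at x)) \<Longrightarrow> f' = deriv f" for f'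
    by (intro ext DERIV_imp_deriv[symmetric]) auto
  show "\<And>x. (f has_real_derivative deriv f x) (at x)" "smooth (deriv f)"
    using * eq unfolding smooth_def by metis+
qed

lemma smooth_cont: "smooth f \<Longrightarrow> continuous_on UNIV f"
  using DERIV_isCont[OF smooth_deriv(1)] by (auto simp: continuous_on_eq_continuous_at)

section \<open>A family of functions that are flat at the origin\<close>

text \<open>The functions p(1/t) exp(-1/t) with arbitrary polynomials p are closed under
  differentiation, so smoothness at 0 needs no separate treatment of higher orders.\<close>

definition flat_exp :: "real poly \<Rightarrow> real \<Rightarrow> real" where
  "flat_exp p t = (if t > 0 then poly p (1 / t) * exp (- (1 / t)) else 0)"

lemma flat_exp_tendsto_0: "(flat_exp p \<longlongrightarrow> 0) (at 0)"
proof -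
  have "((\<lambda>x. \<Sum>i\<le>degree p. coeff p i * (x ^ i / exp x)) \<longlongrightarrow> (\<Sum>i\<le>degree p. coeff p i * 0)) at_top"
    by (intro tendsto_intros tendsto_power_div_exp_0)
  then have "((\<lambda>x. poly p x * exp (- x)) \<longlongrightarrow> 0) at_top"
    by (simp add: poly_altdef sum_distrib_right exp_minus divide_inverse mult.assoc)
  then have "((\<lambda>t. poly p (inverse t) * exp (- inverse t)) \<longlongrightarrow> 0) (at_right 0)"
    by (rule filterlim_compose[OF _ filterlim_inverse_at_top_right])
  moreover have "\<forall>\<^sub>F t in at_right 0. poly p (inverse t) * exp (- inverse t) = flat_exp p t"
    by (rule eventually_at_rightI[of 0 1]) (auto simp: flat_exp_def field_simps)
  ultimately have r: "(flat_exp p \<longlongrightarrow> 0) (at_right 0)"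
    by (rule Lim_transform_eventually)
  have "\<forall>\<^sub>F t in at_left 0. 0 = flat_exp p t"
    by (rule eventually_at_leftI[of "-1"]) (auto simp: flat_exp_def)
  then have "(flat_exp p \<longlongrightarrow> 0) (at_left 0)"
    by (rule Lim_transform_eventually[OF tendsto_const])
  with r show ?thesis
    by (simp add: filterlim_at_split)
qed

text \<open>With x = 1/t the derivative is x^2 (p(x) - p'(x)) exp(-x); the two
  \<open>pCons 0\<close> are the factor x^2 from the inner derivative.\<close>

lemma DERIV_flat_exp:
  "(flat_exp p has_real_derivative flat_exp (pCons 0 (pCons 0 (p - pderiv p))) t) (at t)"
proof -
  consider "t > 0" | "t < 0" | "t = 0" by linarith
  then show ?thesis
  proof cases
    case 1
    have "((\<lambda>t. poly p (1 / t) * exp (- (1 / t))) has_real_derivative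
      flat_exp (pCons 0 (pCons 0 (p - pderiv p))) t) (at t)"
      using 1 by (auto intro!: derivative_eq_intros DERIV_chain2[OF poly_DERIV]
          simp: flat_exp_def field_simps power2_eq_square)
    then show ?thesis
      by (rule has_field_derivative_transform_within_open[of _ _ _ "{0<..}"])
         (use 1 in \<open>auto simp: flat_exp_def\<close>)
  next
    case 2
    have "((\<lambda>t. 0) has_real_derivative flat_exp (pCons 0 (pCons 0 (p - pderiv p))) t) (at t)"
      using 2 by (auto simp: flat_exp_def)
    then show ?thesis
      by (rule has_field_derivative_transform_within_open[of _ _ _ "{..<0}"])
         (use 2 in \<open>auto simp: flat_exp_def\<close>)
  next
    case 3
    \<comment> \<open>Dividing by h multiplies the polynomial by its variable, so the difference
      quotient at 0 is again a member of the family and tends to 0.\<close>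
    have "(\<lambda>h. (flat_exp p (0 + h) - flat_exp p 0) / h) = flat_exp (pCons 0 p)"
      by (auto simp: fun_eq_iff flat_exp_def)
    with flat_exp_tendsto_0[of "pCons 0 p"] 3 show ?thesis
      by (simp add: DERIV_def flat_exp_def)
  qed
qed

lemma smooth_flat_exp: "smooth (flat_exp p)"
  unfolding smooth_def
proof
  fix k show "times_diff k (flat_exp p)"
    by (induction k arbitrary: p) (auto intro: DERIV_flat_exp)
qed

lemma antiderivative_exists:
  fixes f :: "real \<Rightarrow> real"
  assumes "continuous_on UNIV f"
  obtains F where "\<And>x. (F has_real_derivative f x) (at x)"
  using einterval_antiderivative[of "-\<infinity>" "\<infinity>" f] assms
  by (auto simp: continuous_on_eq_continuous_at has_real_derivative_iff_has_vector_derivative)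

section \<open>Transitions from 0 to 1 and their bumps\<close>

definition transition :: "(real \<Rightarrow> real) \<Rightarrow> bool" where
  "transition P \<longleftrightarrow> smooth P \<and> mono P \<and> (\<forall>t\<le>-1. P t = 0) \<and> (\<forall>t\<ge>1. P t = 1)"

text \<open>Normalised primitives of nonnegative bumps. The interval is a parameter because [-1, 0]
  and [-1, 1] both occur.\<close>

lemma transition_antideriv:
  assumes "\<And>x. (F has_real_derivative f x) (at x)" "smooth f" "\<And>t. 0 \<le> f t"
    "\<And>t. t < a \<or> b < t \<Longrightarrow> f t = 0" "-1 \<le> a" "a < b" "b \<le> 1" "F a < F b"
  defines "P \<equiv> \<lambda>t. (F t - F a) / (F b - F a)"
  shows "transition P" "\<And>t. t \<le> a \<Longrightarrow> P t = 0" "\<And>t. t \<ge> b \<Longrightarrow> P t = 1"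
proof -
  have cF: "continuous_on A F" for A
    by (meson assms(1) DERIV_continuous_on has_field_derivative_at_within)
  have Fa: "F t = F a" if "t \<le> a" for t
  proof (cases "t = a")
    case False
    have "\<And>x. t < x \<Longrightarrow> x < a \<Longrightarrow> DERIV F x :> 0"
      using assms(1,4) by metis
    with False that show ?thesis
      by (intro DERIV_isconst_end[of t a F, symmetric] cF) auto
  qed simp
  show Pa: "P t = 0" if "t \<le> a" for t
    unfolding P_def Fa[OF that] by simp
  have Fb: "F t = F b" if "t \<ge> b" for t
  proof (cases "t = b")
    case False
    have "\<And>x. b < x \<Longrightarrow> x < t \<Longrightarrow> DERIV F x :> 0"
      using assms(1,4) by metis
    with False that show ?thesis
      by (intro DERIV_isconst_end[of b t F] cF) auto
  qed simp
  show Pb: "P t = 1" if "t \<ge> b" for t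
    unfolding P_def Fb[OF that] using assms(8) by simp
  have "mono F"
  proof (rule monoI)
    fix x y :: real assume "x \<le> y"
    then show "F x \<le> F y"
      by (rule DERIV_nonneg_imp_nondecreasing) (blast intro: assms(1,3))
  qed
  then have "mono P"
    using assms(8) by (simp add: P_def mono_def divide_right_mono)
  moreover have "smooth P"
    using smooth_mult[OF smooth_const[of "1 / (F b - F a)"] smooth_diff[OF smooth_antideriv[OF assms(1,2)] smooth_const[of "F a"]]]
    by (simp add: P_def)
  ultimately show "transition P" using Pa Pb assms(5-7)
    by (auto simp: transition_def)
qed

text \<open>All growth is confined to [-1, 0]. The bump of such a transition lives on [-1, 1], so
  that its own primitive still fits into the definition of a transition.\<close>

lemma transition_exists:
  obtains P where "transition P" "\<And>t. t \<ge> 0 \<Longrightarrow> P t = 1"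
proof -
  \<comment> \<open>Positive exactly on (-1, 0).\<close>
  define \<beta> where "\<beta> t = flat_exp 1 (t + 1) * flat_exp 1 (- t)" for t
  have sm: "smooth \<beta>"
    unfolding \<beta>_def using smooth_affine[OF smooth_flat_exp, of 1 1 1] smooth_affine[OF smooth_flat_exp, of 1 "-1" 0]
    by (intro smooth_mult) auto
  obtain F where F: "\<And>x. (F has_real_derivative \<beta> x) (at x)"
    using antiderivative_exists[OF smooth_cont[OF sm]] by blast
  have "\<beta> t > 0" if "-1 < t" "t < 0" for t
    using that by (auto simp: \<beta>_def flat_exp_def)
  then have "F (-1) < F 0"
    using F by (intro DERIV_pos_imp_increasing_open[of "-1" 0 F])
      (auto intro: DERIV_continuous_on has_field_derivative_at_within)
  moreover have "0 \<le> \<beta> t" "t < -1 \<or> 0 < t \<Longrightarrow> \<beta> t = 0" for t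
    by (auto simp: \<beta>_def flat_exp_def)
  ultimately show ?thesis
    by (intro that[of "\<lambda>t. (F t - F (-1)) / (F 0 - F (-1))"] transition_antideriv[OF F sm, of "-1" 0]) simp_all
qed

definition bump_of :: "(real \<Rightarrow> real) \<Rightarrow> real \<Rightarrow> real" where
  "bump_of P t = P t - P (t - 1)"

lemma smooth_bump_of: "transition P \<Longrightarrow> smooth (bump_of P)"
  unfolding bump_of_def transition_def using smooth_affine[of P 1 "-1"] by (auto intro!: smooth_diff)

lemma transition_bounds: "transition P \<Longrightarrow> 0 \<le> P t \<and> P t \<le> 1"
  unfolding transition_def mono_def by (metis linorder_linear)

lemma bump_of_bounds: "transition P \<Longrightarrow> 0 \<le> bump_of P t \<and> bump_of P t \<le> 1"
  using transition_bounds[of P t] transition_bounds[of P "t - 1"]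
  by (auto simp: bump_of_def transition_def mono_def)

lemma bump_of_0: "transition P \<Longrightarrow> t \<le> -1 \<or> t \<ge> 2 \<Longrightarrow> bump_of P t = 0"
  by (auto simp: bump_of_def transition_def)

text \<open>\<open>bump_of Q t\<close> is the integral of \<open>bump_of P\<close> over [t - 1, t],
  that is, the convolution of \<open>bump_of P\<close> with the indicator of a unit interval. In
  several variables this smears a cell along an edge of length 1, which turns a difference of
  averages into an average of a derivative.\<close>

lemma transition_pair:
  obtains P Q where "transition P" "transition Q"
    "\<And>t. (Q has_real_derivative bump_of P t) (at t)"
proof -
  obtain P where P: "transition P" "\<And>t. t \<ge> 0 \<Longrightarrow> P t = 1"
    using transition_exists by blast
  obtain F where F: "\<And>x. (F has_real_derivative bump_of P x) (at x)"
    using antiderivative_exists[OF smooth_cont[OF smooth_bump_of[OF P(1)]]] by blast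
  \<comment> \<open>On [0, 1] two neighbouring translates of the bump sum to 1, so \<open>G\<close>
    is constant there. Comparing its end values shows that the bump has integral 1, hence
    \<open>Q\<close> really reaches the value 1.\<close>
  define G where "G t = F t + F (t - 1) - t" for t
  have "(G has_real_derivative 0) (at t)" if "0 \<le> t" "t \<le> 1" for t
  proof -
    have "((\<lambda>t. F (t - 1)) has_real_derivative bump_of P (t - 1) * 1) (at t)"
      by (rule DERIV_chain'[where f = "\<lambda>x. x - 1" and g = F, of 1 t UNIV]) (auto intro!: derivative_eq_intros F)
    then have "(G has_real_derivative bump_of P t + bump_of P (t - 1) - 1) (at t)"
      unfolding G_def by (auto intro!: derivative_eq_intros F)
    moreover have "bump_of P t + bump_of P (t - 1) - 1 = 0"
      using P that by (auto simp: bump_of_def transition_def)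
    ultimately show ?thesis by simp
  qed
  then have "G 1 = G 0"
    by (intro DERIV_isconst_end[of 0 1 G] DERIV_continuous_on[of _ G "\<lambda>_. 0"]) (simp_all add: has_field_derivative_at_within)
  then have 1: "F 1 - F (-1) = 1" by (simp add: G_def)
  have z: "bump_of P t = 0" if "t < -1 \<or> 1 < t" for t
    using P that by (auto simp: bump_of_def transition_def)
  define Q where "Q t = (F t - F (-1)) / (F 1 - F (-1))" for t
  have "transition Q"
    unfolding Q_def
    by (rule transition_antideriv(1)[OF F smooth_bump_of[OF P(1)]]) (use bump_of_bounds[OF P(1)] z 1 in auto)
  moreover have "(Q has_real_derivative bump_of P t) (at t)" for t
    unfolding Q_def 1 by (auto intro!: derivative_eq_intros F)
  ultimately show ?thesis using that P(1) by blast
qed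

section \<open>Test functions and weak derivatives\<close>

definition tensor :: "('n::finite \<Rightarrow> real \<Rightarrow> real) \<Rightarrow> real^'n \<Rightarrow> real" where
  "tensor h x = (\<Prod>j\<in>UNIV. h j (x $ j))"

lemma has_derivative_tensor:
  fixes x :: "real^'n"
  assumes "\<And>j. smooth (h j)"
  shows "(tensor h has_derivative
     (\<lambda>y. \<Sum>i\<in>UNIV. deriv (h i) (x $ i) * y $ i * (\<Prod>j\<in>UNIV - {i}. h j (x $ j)))) (at x)"
proof -
  have "((\<lambda>x. h i (x $ i)) has_derivative (\<lambda>y. deriv (h i) (x $ i) * y $ i)) (at x)" for i
    using has_derivative_compose[OF _ smooth_deriv(1)[OF assms[of i], unfolded has_field_derivative_def],
        of "\<lambda>x. x $ i" "\<lambda>y. y $ i" x UNIV]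
    by (simp add: bounded_linear_imp_has_derivative bounded_linear_vec_nth)
  then show ?thesis
    unfolding tensor_def[abs_def] by (rule has_derivative_prod)
qed

text \<open>The class of tensor products is stable under partial derivatives, which is what makes
  the induction over the order of differentiability work.\<close>

lemma pderiv_tensor:
  fixes h :: "'n::finite \<Rightarrow> real \<Rightarrow> real"
  assumes "\<And>j. smooth (h j)"
  shows "pderiv_at i (tensor h) = tensor (h(i := deriv (h i)))"
proof
  fix x :: "real^'n"
  have "pderiv_at i (tensor h) x =
      (\<Sum>k\<in>UNIV. deriv (h k) (x $ k) * axis i 1 $ k * (\<Prod>j\<in>UNIV - {k}. h j (x $ j)))"
    unfolding pderiv_at_def frechet_derivative_at[OF has_derivative_tensor[OF assms], symmetric] ..
  also have "\<dots> = (\<Sum>k\<in>UNIV. if k = i then deriv (h i) (x $ i) * (\<Prod>j\<in>UNIV - {i}. h j (x $ j)) else 0)"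
    by (intro sum.cong) (auto simp: axis_def)
  also have "\<dots> = deriv (h i) (x $ i) * (\<Prod>j\<in>UNIV - {i}. h j (x $ j))"
    by simp
  also have "\<dots> = tensor (h(i := deriv (h i))) x"
    unfolding tensor_def by (subst prod.remove[of UNIV i]) (auto intro!: prod.cong)
  finally show "pderiv_at i (tensor h) x = tensor (h(i := deriv (h i))) x" .
qed

lemma continuous_tensor:
  assumes "\<And>j. continuous_on UNIV (h j)"
  shows "continuous_on UNIV (tensor h)"
  unfolding tensor_def[abs_def]
  by (intro continuous_on_prod continuous_on_compose2[OF assms] continuous_intros) auto

lemma continuously_diff_tensor:
  "(\<And>j. smooth (h j)) \<Longrightarrow> continuously_diff k (tensor h)"
proof (induction k arbitrary: h)
  case 0
  then show ?case by (auto intro: continuous_tensor smooth_cont)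
next
  case (Suc k)
  then have "continuously_diff k (pderiv_at i (tensor h))" for i
    unfolding pderiv_tensor[OF Suc.prems] by (auto intro!: Suc.IH smooth_deriv)
  then show ?case
    using has_derivative_tensor[of h, OF Suc.prems] unfolding continuously_diff.simps differentiable_def by blast
qed

lemma fun_support_subset:
  assumes "closed C" "\<And>x. x \<notin> C \<Longrightarrow> f x = 0"
  shows "fun_support f \<subseteq> C"
  unfolding fun_support_def using assms by (intro closure_minimal) auto

lemma not_in_fun_support: "x \<notin> fun_support f \<Longrightarrow> f x = 0"
  unfolding fun_support_def using closure_subset[of "{x. f x \<noteq> 0}"] by auto

lemma closed_fun_support: "closed (fun_support f)"
  by (simp add: fun_support_def)

lemma compact_fun_support:
  assumes "bounded C" "\<And>x. x \<notin> C \<Longrightarrow> f x = 0"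
  shows "compact (fun_support f)"
proof -
  have "{x. f x \<noteq> 0} \<subseteq> C" using assms(2) by blast
  then have "bounded {x. f x \<noteq> 0}" using assms(1) by (rule bounded_subset[rotated])
  then show ?thesis by (simp add: fun_support_def compact_eq_bounded_closed bounded_closure)
qed

lemma tensor_test_function:
  assumes "\<And>j. smooth (h j)" "\<And>j t. t < a $ j \<or> b $ j < t \<Longrightarrow> h j t = 0"
  shows "tensor h \<in> test_functions"
proof -
  have "tensor h x = 0" if "x \<notin> cbox a b" for x
  proof -
    obtain j where "x $ j < a $ j \<or> b $ j < x $ j"
      using \<open>x \<notin> cbox a b\<close> unfolding mem_box_cart by (auto simp: not_le)
    then have "h j (x $ j) = 0" using assms(2) by blast
    then show ?thesis unfolding tensor_def by (intro prod_zero) auto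
  qed
  then have "compact (fun_support (tensor h))"
    by (rule compact_fun_support[OF bounded_cbox])
  then show ?thesis
    unfolding test_functions_def using continuously_diff_tensor[of h] assms(1) by blast
qed

section \<open>Local integrability and derivatives along an axis\<close>

lemma lborel_integral_affine:
  fixes f :: "'a::euclidean_space \<Rightarrow> real"
  assumes [measurable]: "f \<in> borel_measurable borel" and "c \<noteq> 0"
  shows "(\<integral>x. f (t + c *\<^sub>R x) \<partial>lborel) = (\<integral>x. f x \<partial>lborel) / \<bar>c\<bar> ^ DIM('a)"
proof -
  have "(\<integral>x. f x \<partial>lborel) = \<bar>c\<bar> ^ DIM('a) * (\<integral>x. f (t + c *\<^sub>R x) \<partial>lborel)"
    by (subst lborel_affine[OF assms(2), of t]) (simp add: integral_density integral_distr)
  then show ?thesis using assms(2) by (simp add: field_simps)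
qed

lemma lborel_nn_integral_affine:
  fixes f :: "'a::euclidean_space \<Rightarrow> ennreal"
  assumes [measurable]: "f \<in> borel_measurable borel" and "c \<noteq> 0"
  shows "(\<integral>\<^sup>+x. f x \<partial>lborel) = ennreal (\<bar>c\<bar> ^ DIM('a)) * (\<integral>\<^sup>+x. f (t + c *\<^sub>R x) \<partial>lborel)"
  by (subst lborel_affine[OF assms(2), of t])
     (simp add: nn_integral_density nn_integral_distr nn_integral_cmult)

lemma locally_integrable_bounded:
  fixes f :: "real^'n \<Rightarrow> real"
  assumes [measurable]: "f \<in> borel_measurable borel" and "\<And>x. \<bar>f x\<bar> \<le> M"
  shows "locally_integrable f"
proof -
  have M: "\<bar>f x\<bar> \<le> \<bar>M\<bar>" for x using assms(2)[of x] by linarith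
  show ?thesis
    unfolding locally_integrable_def set_integrable_def
  proof (intro conjI allI impI)
    fix K :: "(real^'n) set" assume K: "compact K"
    then have [measurable]: "K \<in> sets borel" by (simp add: borel_compact)
    have "integrable lborel (\<lambda>x. M * indicat_real K x)"
      using emeasure_compact_finite[OF K] by (intro integrable_mult_right integrable_real_indicator) auto
    then show "integrable lborel (\<lambda>x. indicat_real K x *\<^sub>R f x)"
      by (rule Bochner_Integration.integrable_bound) (use M in \<open>auto split: split_indicator\<close>)
  qed (use assms in auto)
qed

lemma continuous_compact_support_bounded:
  assumes "continuous_on UNIV f" "compact (fun_support f)"
  obtains B :: real where "\<And>x. \<bar>f x\<bar> \<le> B" "B \<ge> 0"
proof -
  have "bounded (f ` fun_support f)"
    using assms by (intro compact_imp_bounded compact_continuous_image) (auto intro: continuous_on_subset)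
  then obtain B where B: "\<And>x. x \<in> fun_support f \<Longrightarrow> \<bar>f x\<bar> \<le> B"
    by (auto simp: bounded_iff)
  then have "\<bar>f x\<bar> \<le> max B 0" for x
    using not_in_fun_support[of x f] by (cases "x \<in> fun_support f") (fastforce simp: le_max_iff_disj)+
  then show ?thesis using that[of "max B 0"] by simp
qed

lemma integrable_mult_compact_support:
  assumes "locally_integrable f" "continuous_on UNIV \<psi>" "compact (fun_support \<psi>)"
  shows "integrable lborel (\<lambda>x. f x * \<psi> x)"
proof -
  obtain B where B: "\<And>x. \<bar>\<psi> x\<bar> \<le> B" "B \<ge> 0"
    using continuous_compact_support_bounded[OF assms(2,3)] by blast
  have [measurable]: "f \<in> borel_measurable borel" "\<psi> \<in> borel_measurable borel"
    using assms by (auto simp: locally_integrable_def intro: borel_measurable_continuous_onI)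
  have "integrable lborel (\<lambda>x. B * (indicat_real (fun_support \<psi>) x *\<^sub>R f x))"
    using assms unfolding locally_integrable_def set_integrable_def by (intro integrable_mult_right) auto
  then show ?thesis
  proof (rule Bochner_Integration.integrable_bound)
    show "AE x in lborel. norm (f x * \<psi> x) \<le> norm (B * (indicat_real (fun_support \<psi>) x *\<^sub>R f x))"
    proof (intro AE_I2)
      fix x
      show "norm (f x * \<psi> x) \<le> norm (B * (indicat_real (fun_support \<psi>) x *\<^sub>R f x))"
        using B mult_mono[of "\<bar>\<psi> x\<bar>" B "\<bar>f x\<bar>" "\<bar>f x\<bar>"] not_in_fun_support[of x \<psi>]
        by (cases "x \<in> fun_support \<psi>") (auto simp: abs_mult mult.commute)
    qed
  qed simp
qed

lemma DERIV_along_axis: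
  assumes "\<And>x. g differentiable (at x)"
  shows "((\<lambda>t. g (x + t *\<^sub>R axis i 1)) has_real_derivative pderiv_at i g (x + t *\<^sub>R axis i 1)) (at t)"
proof -
  let ?y = "x + t *\<^sub>R axis i 1"
  have d: "(g has_derivative frechet_derivative g (at ?y)) (at ?y)"
    using assms frechet_derivative_works by blast
  have "((\<lambda>t. g (x + t *\<^sub>R axis i 1)) has_derivative
      (\<lambda>s. frechet_derivative g (at ?y) (s *\<^sub>R axis i 1))) (at t)"
    by (rule has_derivative_compose[where g = g and f = "\<lambda>t. x + t *\<^sub>R axis i 1", OF _ d])
       (auto intro!: derivative_eq_intros)
  moreover have "frechet_derivative g (at ?y) (s *\<^sub>R axis i 1) = pderiv_at i g ?y * s" for s
    using linear_scale[OF has_derivative_linear[OF d]] by (simp add: pderiv_at_def)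
  ultimately show ?thesis by (simp add: has_field_derivative_def)
qed

lemma pderiv_at_not_in_fun_support:
  assumes "x \<notin> fun_support g"
  shows "pderiv_at i g x = 0"
proof -
  have "(g has_derivative (\<lambda>_. 0)) (at x)"
    by (rule has_derivative_transform_within_open[of "\<lambda>_. 0" _ _ _ "- fun_support g"])
       (use assms in \<open>auto simp: open_Compl closed_fun_support not_in_fun_support\<close>)
  then show ?thesis
    by (metis frechet_derivative_at pderiv_at_def)
qed

lemma compact_fun_support_pderiv:
  assumes "compact (fun_support g)"
  shows "compact (fun_support (pderiv_at i g))"
  by (rule compact_fun_support[of "fun_support g"])
     (use assms in \<open>auto simp: compact_imp_bounded pderiv_at_not_in_fun_support\<close>)

lemma lipschitz_along_axis:
  assumes "\<And>x. g differentiable (at x)" "\<And>x. \<bar>pderiv_at i g x\<bar> \<le> L"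
  shows "\<bar>g (x + h *\<^sub>R axis i 1) - g x\<bar> \<le> L * \<bar>h\<bar>"
  using field_differentiable_bound[of UNIV "\<lambda>t. g (x + t *\<^sub>R axis i 1)" "\<lambda>t. pderiv_at i g (x + t *\<^sub>R axis i 1)" L h 0]
    DERIV_along_axis[OF assms(1)] assms(2)
  by simp

lemma difference_quotient_along_axis:
  assumes "\<And>x. g differentiable (at x)" "filterlim h (at 0) F"
  shows "((\<lambda>n. (g (x + h n *\<^sub>R axis i 1) - g x) / h n) \<longlongrightarrow> pderiv_at i g x) F"
  using filterlim_compose[OF DERIV_along_axis[OF assms(1), of x i 0, unfolded DERIV_def] assms(2)]
  by simp

lemma test_function_pderiv:
  assumes "\<psi> \<in> test_functions"
  shows "pderiv_at i \<psi> \<in> test_functions"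
proof -
  have "continuously_diff (Suc k) \<psi>" for k
    using assms by (auto simp: test_functions_def simp del: continuously_diff.simps)
  then show ?thesis
    using assms by (auto simp: test_functions_def compact_fun_support_pderiv)
qed

lemma test_functionD:
  assumes "\<psi> \<in> test_functions"
  shows "continuous_on UNIV \<psi>" "compact (fun_support \<psi>)" "\<psi> differentiable (at x)"
  using assms unfolding test_functions_def
  by (auto dest: spec[of _ 0] spec[of _ "Suc 0"])

section \<open>Weak derivatives from one-sided difference quotients\<close>

text \<open>Difference quotients are moved from \<open>f\<close> to the test function by a
  translation, and dominated convergence applies on both sides. Only steps h > 0 are considered: a
  piecewise linear interpolant has right derivatives everywhere, whereas two-sided ones fail on
  faces of simplices.\<close>

lemma weak_pderivI:
  fixes f :: "real^'n \<Rightarrow> real"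
  assumes [measurable]: "f \<in> borel_measurable borel" and bdd: "\<And>x. \<bar>f x\<bar> \<le> M"
    and lip: "\<And>x h. h > 0 \<Longrightarrow> \<bar>f (x + h *\<^sub>R axis i 1) - f x\<bar> \<le> L * h"
    and lim: "\<And>x h. filterlim h (at_right 0) sequentially \<Longrightarrow>
        (\<lambda>n. (f (x + h n *\<^sub>R axis i 1) - f x) / h n) \<longlonglongrightarrow> w x"
  shows "is_weak_pderiv i f w"
proof -
  define h where "h n = inverse (real (Suc n))" for n
  have h0: "h n > 0" "h n \<le> 1" for n by (auto simp: h_def field_simps)
  have hlim: "h \<longlonglongrightarrow> 0"
    unfolding h_def[abs_def] by (rule LIMSEQ_inverse_real_of_nat)
  then have h: "filterlim h (at_right 0) sequentially"
    using h0 less_imp_neq[OF h0(1), symmetric] by (simp add: filterlim_at)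
  have "(\<lambda>n. - h n) \<longlonglongrightarrow> 0" using tendsto_minus[OF hlim] by simp
  then have hm: "filterlim (\<lambda>n. - h n) (at 0) sequentially"
    using h0 less_imp_neq[OF h0(1), symmetric] by (simp add: filterlim_at)
  define e where "e = (axis i 1 :: real^'n)"
  note lim = lim[OF h, folded e_def] note lip = lip[folded e_def]
  have "(\<lambda>x. f (x + h n *\<^sub>R e)) \<in> borel_measurable borel" for n by measurable
  then have w[measurable]: "w \<in> borel_measurable borel"
    by (intro borel_measurable_LIMSEQ_real[OF lim]) measurable
  have quot: "\<bar>(f (x + h n *\<^sub>R e) - f x) / h n\<bar> \<le> L" for x n
    using lip[OF h0(1), of x n] h0[of n] by (simp add: field_simps abs_divide)
  have wb: "\<bar>w x\<bar> \<le> L" for x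
    by (rule LIMSEQ_le_const2[OF tendsto_rabs[OF lim]]) (use quot in auto)
  have L0: "0 \<le> L" using wb[of 0] by linarith
  have "(\<integral>x. f x * pderiv_at i \<psi> x \<partial>lborel) = - (\<integral>x. w x * \<psi> x \<partial>lborel)"
    if \<psi>: "\<psi> \<in> test_functions" for \<psi>
  proof -
    note c\<psi> = test_functionD(1)[OF \<psi>] test_functionD(2)[OF \<psi>]
    have li: "locally_integrable f" using bdd by (rule locally_integrable_bounded[rotated]) simp
    note [measurable] = borel_measurable_continuous_onI[OF c\<psi>(1)]
    obtain R where R: "fun_support \<psi> \<subseteq> cball 0 R"
      using compact_imp_bounded[OF c\<psi>(2)] by (auto simp: bounded_iff subset_eq)
    obtain B where B: "\<And>x. \<bar>pderiv_at i \<psi> x\<bar> \<le> B" "B \<ge> 0"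
      using continuous_compact_support_bounded test_functionD(1,2)[OF test_function_pderiv[OF \<psi>]] by metis
    have int\<psi>: "integrable lborel \<psi>"
      using integrable_mult_compact_support[OF locally_integrable_bounded[of "\<lambda>_. 1" 1] c\<psi>] by simp
    have l1: "(\<lambda>n. \<integral>x. (f (x + h n *\<^sub>R e) - f x) / h n * \<psi> x \<partial>lborel) \<longlonglongrightarrow> (\<integral>x. w x * \<psi> x \<partial>lborel)"
    proof (rule integral_dominated_convergence[where w = "\<lambda>x. L * \<bar>\<psi> x\<bar>"])
      show "AE x in lborel. norm ((f (x + h n *\<^sub>R e) - f x) / h n * \<psi> x) \<le> L * \<bar>\<psi> x\<bar>" for n
        using quot by (intro AE_I2) (simp only: real_norm_def abs_mult, intro mult_right_mono, auto)
      show "AE x in lborel. (\<lambda>n. (f (x + h n *\<^sub>R e) - f x) / h n * \<psi> x) \<longlonglongrightarrow> w x * \<psi> x"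
        by (intro AE_I2 tendsto_mult lim tendsto_const)
    qed (use int\<psi> in auto)
    \<comment> \<open>All steps are at most 1, so the shifted test functions vanish outside the ball
      of radius R + 1; their quotients are bounded by the maximum of the derivative.\<close>
    have l2: "(\<lambda>n. \<integral>x. f x * ((\<psi> (x + (- h n) *\<^sub>R e) - \<psi> x) / (- h n)) \<partial>lborel) \<longlonglongrightarrow>
        (\<integral>x. f x * pderiv_at i \<psi> x \<partial>lborel)"
    proof (rule integral_dominated_convergence[where w = "\<lambda>x. M * B * indicator (cball 0 (R + 1)) x"])
      show "AE x in lborel. (\<lambda>n. f x * ((\<psi> (x + - h n *\<^sub>R e) - \<psi> x) / - h n)) \<longlonglongrightarrow> f x * pderiv_at i \<psi> x"
        unfolding e_def
        by (intro AE_I2 tendsto_intros difference_quotient_along_axis test_functionD(3)[OF \<psi>] hm)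
      fix n
      show "AE x in lborel. norm (f x * ((\<psi> (x + - h n *\<^sub>R e) - \<psi> x) / - h n)) \<le> M * B * indicator (cball 0 (R + 1)) x"
      proof (intro AE_I2)
        fix x
        have *: "\<bar>(\<psi> (x + - h n *\<^sub>R e) - \<psi> x) / - h n\<bar> \<le> B"
          using lipschitz_along_axis[OF test_functionD(3)[OF \<psi>] B(1), of x "- h n"] h0[of n]
          by (simp add: e_def field_simps abs_divide)
        show "norm (f x * ((\<psi> (x + - h n *\<^sub>R e) - \<psi> x) / - h n)) \<le> M * B * indicator (cball 0 (R + 1)) x"
        proof (cases "x \<in> cball 0 (R + 1)")
          case True
          have "\<bar>f x\<bar> * \<bar>(\<psi> (x + - h n *\<^sub>R e) - \<psi> x) / - h n\<bar> \<le> M * B"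
            using bdd[of x] * by (intro mult_mono) auto
          then show ?thesis using True by (simp add: abs_mult)
        next
          case False
          then have "norm x > R + 1" by simp
          moreover have "norm (h n *\<^sub>R e) \<le> 1" using h0[of n] by (simp add: e_def)
          ultimately have "norm (x + - h n *\<^sub>R e) > R"
            using norm_triangle_ineq2[of x "h n *\<^sub>R e"] by simp
          then have "\<psi> (x + - h n *\<^sub>R e) = 0" "\<psi> x = 0"
            using R \<open>norm x > R + 1\<close> by (auto intro!: not_in_fun_support)
          then show ?thesis using False by simp
        qed
      qed
    next
      show "integrable lborel (\<lambda>x. M * B * indicat_real (cball 0 (R + 1)) x)"
        using emeasure_compact_finite[of "cball 0 (R + 1)"]
        by (intro integrable_mult_right integrable_real_indicator) auto
    next
      show "(\<lambda>x. f x * pderiv_at i \<psi> x) \<in> borel_measurable lborel"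
        using borel_measurable_continuous_onI[OF test_functionD(1)[OF test_function_pderiv[OF \<psi>]]] by simp
    qed measurable
    \<comment> \<open>Discrete integration by parts: translation invariance puts the shift on \<psi>
      and reverses its direction.\<close>
    have "(\<integral>x. (f (x + h n *\<^sub>R e) - f x) / h n * \<psi> x \<partial>lborel) =
        - (\<integral>x. f x * ((\<psi> (x + (- h n) *\<^sub>R e) - \<psi> x) / (- h n)) \<partial>lborel)" for n
    proof -
      have sh: "(\<integral>x. f (x + h n *\<^sub>R e) * \<psi> x \<partial>lborel) = (\<integral>x. f x * \<psi> (x + (- h n) *\<^sub>R e) \<partial>lborel)"
        using lborel_integral_affine[of "\<lambda>x. f x * \<psi> (x + (- h n) *\<^sub>R e)" 1 "h n *\<^sub>R e"]
        by (simp add: add.commute)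
      have li2: "locally_integrable (\<lambda>x. f (x + h n *\<^sub>R e))"
        using bdd by (rule locally_integrable_bounded[rotated]) simp
      have i1: "integrable lborel (\<lambda>x. f x * \<psi> x)" "integrable lborel (\<lambda>x. f (x + h n *\<^sub>R e) * \<psi> x)"
        using integrable_mult_compact_support[OF li c\<psi>] integrable_mult_compact_support[OF li2 c\<psi>] by auto
      have "compact (fun_support (\<lambda>x. \<psi> (x + (- h n) *\<^sub>R e)))"
      proof (rule compact_fun_support)
        show "bounded ((\<lambda>x. h n *\<^sub>R e + x) ` fun_support \<psi>)"
          by (rule bounded_translation) (use c\<psi>(2) in \<open>simp add: compact_imp_bounded\<close>)
        show "\<psi> (x + - h n *\<^sub>R e) = 0" if "x \<notin> (\<lambda>x. h n *\<^sub>R e + x) ` fun_support \<psi>" for x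
          using that by (intro not_in_fun_support) (force intro!: image_eqI[of _ _ "x - h n *\<^sub>R e"])
      qed
      then have i2: "integrable lborel (\<lambda>x. f x * \<psi> (x + (- h n) *\<^sub>R e))"
        by (intro integrable_mult_compact_support li continuous_on_compose2[OF c\<psi>(1)] continuous_intros) auto
      have "(\<integral>x. (f (x + h n *\<^sub>R e) - f x) / h n * \<psi> x \<partial>lborel) =
          ((\<integral>x. f (x + h n *\<^sub>R e) * \<psi> x \<partial>lborel) - (\<integral>x. f x * \<psi> x \<partial>lborel)) / h n"
        using i1 by (subst Bochner_Integration.integral_diff[symmetric])
          (auto simp: field_simps simp flip: integral_divide_zero)
      also have "\<dots> = ((\<integral>x. f x * \<psi> (x + (- h n) *\<^sub>R e) \<partial>lborel) - (\<integral>x. f x * \<psi> x \<partial>lborel)) / h n"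
        unfolding sh ..
      also have "\<dots> = (\<integral>x. (f x * \<psi> (x + (- h n) *\<^sub>R e) - f x * \<psi> x) / h n \<partial>lborel)"
        using i1 i2 by (simp add: Bochner_Integration.integral_diff)
      also have "\<dots> = (\<integral>x. - (f x * ((\<psi> (x + (- h n) *\<^sub>R e) - \<psi> x) / (- h n))) \<partial>lborel)"
        by (intro Bochner_Integration.integral_cong) (auto simp: field_simps)
      finally show ?thesis by simp
    qed
    with l1 have "(\<lambda>n. - (\<integral>x. f x * ((\<psi> (x + (- h n) *\<^sub>R e) - \<psi> x) / (- h n)) \<partial>lborel)) \<longlonglongrightarrow>
      (\<integral>x. w x * \<psi> x \<partial>lborel)" by (simp only:)
    from LIMSEQ_unique[OF this tendsto_minus[OF l2]] show ?thesis by simp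
  qed
  then show ?thesis
    unfolding is_weak_pderiv_def using locally_integrable_bounded[of f M] locally_integrable_bounded[of w L] bdd wb
    by auto
qed

section \<open>Uniqueness of weak derivatives\<close>

lemma box_indicator_limit:
  obtains \<psi> :: "nat \<Rightarrow> real^'n \<Rightarrow> real"
  where "\<And>n. \<psi> n \<in> test_functions" "\<And>n x. \<bar>\<psi> n x\<bar> \<le> indicator (cbox a b) x"
    "\<And>x. (\<lambda>n. \<psi> n x) \<longlonglongrightarrow> indicator (box a b) x"
proof -
  obtain P where P: "transition P" using transition_exists by blast
  \<comment> \<open>The shift by 1 makes each factor vanish up to the boundary of the box, whatever
    n is; at distance at least 2/n inside, the factor is 1. Hence the limit is the indicator of the
    open box.\<close>
  define h where "h n j t = P (real n * (t - a $ j) - 1) * P (real n * (b $ j - t) - 1)" for n and j :: 'n and t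
  have P0: "P t = 0" if "t \<le> -1" for t using P that by (auto simp: transition_def)
  have P1: "P t = 1" if "1 \<le> t" for t using P that by (auto simp: transition_def)
  have sm: "smooth (h n j)" for n j
    unfolding h_def
    using smooth_affine[of P "real n" "- real n * a $ j - 1"] smooth_affine[of P "- real n" "real n * b $ j - 1"] P
    by (intro smooth_mult) (auto simp: transition_def algebra_simps)
  have hz: "h n j t = 0" if "t \<le> a $ j \<or> b $ j \<le> t" for n j t
    using that P0[of "real n * (t - a $ j) - 1"] P0[of "real n * (b $ j - t) - 1"]
    by (auto simp: h_def mult_nonneg_nonpos)
  have h01: "0 \<le> h n j t \<and> h n j t \<le> 1" for n j t
    using transition_bounds[OF P] by (auto simp: h_def intro!: mult_nonneg_nonneg mult_le_one)
  have Plim: "(\<lambda>n. P (real n * c - 1)) \<longlonglongrightarrow> 1" if "c > 0" for c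
  proof (rule tendsto_eventually)
    have "\<forall>\<^sub>F n in sequentially. real n \<ge> 2 / c"
      by (meson eventually_sequentiallyI nat_ceiling_le_eq)
    then show "\<forall>\<^sub>F n in sequentially. P (real n * c - 1) = 1"
      by eventually_elim (use that in \<open>auto intro!: P1 simp: field_simps\<close>)
  qed
  have hlim: "(\<lambda>n. h n j t) \<longlonglongrightarrow> (if a $ j < t \<and> t < b $ j then 1 else 0)" for j t
  proof (cases "a $ j < t \<and> t < b $ j")
    case True
    then show ?thesis
      unfolding h_def using tendsto_mult[OF Plim[of "t - a $ j"] Plim[of "b $ j - t"]] by simp
  next
    case False
    then have "(\<lambda>n. h n j t) = (\<lambda>n. 0)" using hz[of t j] by (auto simp: fun_eq_iff)
    with False show ?thesis by (simp add: if_not_P)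
  qed
  show ?thesis
  proof (rule that[of "\<lambda>n. tensor (h n)"])
    show "tensor (h n) \<in> test_functions" for n
      by (rule tensor_test_function[of _ a b]) (use sm hz in auto)
    show "\<bar>tensor (h n) x\<bar> \<le> indicator (cbox a b) x" for n x
    proof (cases "x \<in> cbox a b")
      case True
      then show ?thesis
        using h01 by (auto simp: tensor_def abs_prod intro!: prod_le_1)
    next
      case False
      then obtain j where "x $ j < a $ j \<or> b $ j < x $ j"
        unfolding mem_box_cart by (auto simp: not_le)
      then have "h n j (x $ j) = 0" using hz by auto
      then show ?thesis unfolding tensor_def by (subst prod_zero) auto
    qed
    fix x :: "real^'n"
    have "(\<lambda>n. tensor (h n) x) \<longlonglongrightarrow> (\<Prod>j\<in>UNIV. if a $ j < x $ j \<and> x $ j < b $ j then 1 else 0)"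
      unfolding tensor_def by (intro tendsto_prod hlim)
    also have "(\<Prod>j\<in>UNIV. if a $ j < x $ j \<and> x $ j < b $ j then 1 else 0) = indicat_real (box a b) x"
    proof (cases "x \<in> box a b")
      case False
      then obtain j where "\<not> (a $ j < x $ j \<and> x $ j < b $ j)"
        unfolding mem_box_cart by auto
      then show ?thesis using False by (subst prod_zero) (auto intro!: bexI[of _ j])
    qed (auto simp: mem_box_cart)
    finally show "(\<lambda>n. tensor (h n) x) \<longlonglongrightarrow> indicator (box a b) x" .
  qed
qed

text \<open>Open boxes form a generator of the Borel sets that is stable under intersections, so the
  vanishing of the integrals extends to all Borel sets, and the density is then zero by
  uniqueness.\<close>

lemma AE_zero_if_box_integrals_zero:
  fixes w :: "'a::euclidean_space \<Rightarrow> real"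
  assumes [measurable]: "w \<in> borel_measurable borel"
    and int: "\<And>a b. set_integrable lborel (box a b) w"
    and zero: "\<And>a b. (LINT x:box a b|lborel. w x) = 0"
  shows "AE x in lborel. w x = 0"
proof -
  \<comment> \<open>\<open>w\<close> is only locally integrable. The induction passes to complements
    and needs the integral over the whole space, so \<open>w\<close> is first cut off to a large
    box; intersections with it are again boxes.\<close>
  define C where "C n = box (- (real n *\<^sub>R One)) (real n *\<^sub>R One :: 'a)" for n
  have "AE x in lborel. indicator (C n) x * w x = 0" for n
  proof -
    define f where "f x = indicator (C n) x * w x" for x
    have fi: "integrable lborel f"
      using int[of "- (real n *\<^sub>R One)" "real n *\<^sub>R One"] by (simp add: set_integrable_def f_def[abs_def] C_def)
    have [measurable]: "f \<in> borel_measurable borel" unfolding f_def C_def by measurable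
    have fA: "set_integrable lborel A f" if "A \<in> sets borel" for A
      using that fi by (auto simp: set_integrable_def simp del: real_scaleR_def intro!: integrable_mult_indicator)
    have "(LINT x:A|lborel. f x) = 0" if "A \<in> sets lborel" for A
    proof -
      from that have "A \<in> sigma_sets UNIV (range (\<lambda>(a, b). box a b :: 'a set))"
        by (simp add: borel_eq_box)
      then show ?thesis
      proof (induction rule: sigma_sets_induct_disjoint[rotated 2, consumes 1])
        show "Int_stable (range (\<lambda>(a, b). box a b :: 'a set))"
          by (auto simp: Int_stable_def box_Int_box)
        show "range (\<lambda>(a, b). box a b) \<subseteq> Pow (UNIV :: 'a set)" by simp
      next
        fix A assume "A \<in> range (\<lambda>(a, b). box a b :: 'a set)"
        then obtain a b where A: "A = box a b" by auto
        have "(LINT x:A|lborel. f x) = (LINT x:A \<inter> C n|lborel. w x)"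
          unfolding set_lebesgue_integral_def f_def
          by (intro Bochner_Integration.integral_cong) (auto split: split_indicator)
        then show "(LINT x:A|lborel. f x) = 0"
          unfolding A C_def box_Int_box zero .
      next
        show "(LINT x:{}|lborel. f x) = 0" by (simp add: set_lebesgue_integral_def)
      next
        fix A assume A: "A \<in> sigma_sets UNIV (range (\<lambda>(a, b). box a b :: 'a set))"
          and IH: "(LINT x:A|lborel. f x) = 0"
        then have Ab: "A \<in> sets borel" by (simp add: borel_eq_box)
        have "(\<integral>x. f x \<partial>lborel) = 0"
          using zero[of "- (real n *\<^sub>R One)" "real n *\<^sub>R One"]
          by (simp add: set_lebesgue_integral_def f_def[abs_def] C_def)
        moreover have "(LINT x:UNIV - A|lborel. f x) = (\<integral>x. f x \<partial>lborel) - (LINT x:A|lborel. f x)"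
        proof -
          have eq: "(\<lambda>x. indicat_real (UNIV - A) x *\<^sub>R f x) = (\<lambda>x. f x - indicat_real A x *\<^sub>R f x)"
            by (auto split: split_indicator)
          show ?thesis
            unfolding set_lebesgue_integral_def eq
            by (rule Bochner_Integration.integral_diff) (use fi fA[OF Ab] in \<open>auto simp: set_integrable_def\<close>)
        qed
        ultimately show "(LINT x:UNIV - A|lborel. f x) = 0" using IH by simp
      next
        fix A :: "nat \<Rightarrow> 'a set"
        assume d: "disjoint_family A" and A: "range A \<subseteq> sigma_sets UNIV (range (\<lambda>(a, b). box a b :: 'a set))"
          and IH: "\<And>i. (LINT x:A i|lborel. f x) = 0"
        then have Ab: "A i \<in> sets borel" for i by (auto simp: borel_eq_box)
        then have "(\<Union>i. A i) \<in> sets borel" by auto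
        then have "(LINT x:(\<Union>i. A i)|lborel. f x) = (\<Sum>i. (LINT x:A i|lborel. f x))"
          using d Ab fA by (intro lebesgue_integral_countable_add) (auto simp: disjoint_family_on_def)
        then show "(LINT x:(\<Union>i. A i)|lborel. f x) = 0" using IH by simp
      qed
    qed
    then have "AE x in lborel. f x = 0"
      using sigma_finite_measure.density_unique_banach[OF lborel.sigma_finite_measure_axioms, OF fi, of "\<lambda>_. 0"] by (simp add: set_lebesgue_integral_def)
    then show ?thesis by (simp add: f_def)
  qed
  then have "AE x in lborel. \<forall>n. indicator (C n) x * w x = 0"
    unfolding AE_all_countable by blast
  then show ?thesis
  proof eventually_elim
    case (elim x)
    have "x \<in> (\<Union>i::nat. box (- (real i *\<^sub>R One)) (real i *\<^sub>R One))"
      unfolding UN_box_eq_UNIV by simp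
    then obtain n where "x \<in> C n" by (auto simp: C_def)
    with elim[rule_format, of n] show ?case by simp
  qed
qed

text \<open>The fundamental lemma of the calculus of variations: indicators of boxes are dominated
  limits of test functions.\<close>

lemma AE_zero_if_test_integrals_zero:
  fixes w :: "real^'n \<Rightarrow> real"
  assumes "locally_integrable w" "\<And>\<psi>. \<psi> \<in> test_functions \<Longrightarrow> (\<integral>x. w x * \<psi> x \<partial>lborel) = 0"
  shows "AE x in lborel. w x = 0"
proof (rule AE_zero_if_box_integrals_zero)
  show [measurable]: "w \<in> borel_measurable borel" using assms by (simp add: locally_integrable_def)
  have c: "set_integrable lborel (cbox a b) w" for a b
    using assms by (simp add: locally_integrable_def)
  show "set_integrable lborel (box a b) w" for a b
    by (rule set_integrable_subset[OF c[of a b]]) (auto simp: box_subset_cbox)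
  fix a b :: "real^'n"
  obtain \<psi> where \<psi>: "\<And>n. \<psi> n \<in> test_functions" "\<And>n x. \<bar>\<psi> n x\<bar> \<le> indicator (cbox a b) x"
    "\<And>x. (\<lambda>n. \<psi> n x) \<longlonglongrightarrow> indicator (box a b) x"
    using box_indicator_limit[of a b] by blast
  have [measurable]: "\<psi> n \<in> borel_measurable borel" for n
    using test_functionD(1)[OF \<psi>(1)] by (rule borel_measurable_continuous_onI)
  have "(\<lambda>n. \<integral>x. w x * \<psi> n x \<partial>lborel) \<longlonglongrightarrow> (\<integral>x. w x * indicator (box a b) x \<partial>lborel)"
  proof (rule integral_dominated_convergence[where w = "\<lambda>x. \<bar>indicator (cbox a b) x * w x\<bar>"])
    show "AE x in lborel. norm (w x * \<psi> n x) \<le> \<bar>indicator (cbox a b) x * w x\<bar>" for n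
    proof (rule AE_I2)
      fix x
      have "\<bar>w x\<bar> * \<bar>\<psi> n x\<bar> \<le> \<bar>w x\<bar> * indicator (cbox a b) x"
        by (intro mult_left_mono \<psi>) simp
      then show "norm (w x * \<psi> n x) \<le> \<bar>indicator (cbox a b) x * w x\<bar>"
        by (simp add: abs_mult mult.commute)
    qed
    show "integrable lborel (\<lambda>x. \<bar>indicat_real (cbox a b) x * w x\<bar>)"
      using c[of a b] by (simp add: set_integrable_def)
  qed (auto intro!: AE_I2 tendsto_intros \<psi>)
  with assms(2)[OF \<psi>(1)] have "(\<integral>x. w x * indicator (box a b) x \<partial>lborel) = 0"
    using LIMSEQ_unique[OF _ tendsto_const] by auto
  then show "(LINT x:box a b|lborel. w x) = 0"
    by (simp add: set_lebesgue_integral_def mult.commute)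
qed

lemma weak_pderiv_unique:
  assumes "is_weak_pderiv i h w" "is_weak_pderiv i h w'"
  shows "AE x in lborel. w x = w' x"
proof -
  have lw: "locally_integrable w" "locally_integrable w'" using assms by (auto simp: is_weak_pderiv_def)
  have "AE x in lborel. w x - w' x = 0"
  proof (rule AE_zero_if_test_integrals_zero)
    show "locally_integrable (\<lambda>x. w x - w' x)"
      using lw by (auto simp: locally_integrable_def)
    fix \<psi> :: "real^'a \<Rightarrow> real" assume \<psi>: "\<psi> \<in> test_functions"
    note t = test_functionD(1,2)[OF \<psi>]
    have "(\<integral>x. (w x - w' x) * \<psi> x \<partial>lborel) = (\<integral>x. w x * \<psi> x \<partial>lborel) - (\<integral>x. w' x * \<psi> x \<partial>lborel)"
      unfolding left_diff_distrib
      by (intro Bochner_Integration.integral_diff integrable_mult_compact_support lw t)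
    also have "\<dots> = 0"
      using assms \<psi> by (auto simp: is_weak_pderiv_def)
    finally show "(\<integral>x. (w x - w' x) * \<psi> x \<partial>lborel) = 0" .
  qed
  then show ?thesis by simp
qed

lemma weak_pderiv_AE:
  assumes "is_weak_pderiv i h w"
  shows "AE x in lborel. weak_pderiv i h x = w x"
  using someI[of "is_weak_pderiv i h", OF assms] weak_pderiv_unique assms unfolding weak_pderiv_def by blast

lemma is_weak_pderiv_weak_pderiv:
  "is_weak_pderiv i h w \<Longrightarrow> is_weak_pderiv i h (weak_pderiv i h)"
  using someI[of "is_weak_pderiv i h"] unfolding weak_pderiv_def by blast

lemma is_weak_pderiv_diff:
  assumes "is_weak_pderiv i h w" "is_weak_pderiv i h' w'"
  shows "is_weak_pderiv i (\<lambda>x. h x - h' x) (\<lambda>x. w x - w' x)"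
proof -
  have l: "locally_integrable w" "locally_integrable w'" "locally_integrable h" "locally_integrable h'"
    using assms by (auto simp: is_weak_pderiv_def)
  show ?thesis
    unfolding is_weak_pderiv_def
  proof (intro conjI ballI)
    show "locally_integrable (\<lambda>x. h x - h' x)" "locally_integrable (\<lambda>x. w x - w' x)"
      using l by (auto simp: locally_integrable_def)
    fix \<psi> :: "real^'a \<Rightarrow> real" assume \<psi>: "\<psi> \<in> test_functions"
    note t = test_functionD(1,2)[OF \<psi>] test_functionD(1,2)[OF test_function_pderiv[OF \<psi>]]
    show "(\<integral>x. (h x - h' x) * pderiv_at i \<psi> x \<partial>lborel) = - (\<integral>x. (w x - w' x) * \<psi> x \<partial>lborel)"
      unfolding left_diff_distrib using assms \<psi>
      by (simp add: Bochner_Integration.integral_diff integrable_mult_compact_support l t is_weak_pderiv_def)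
  qed
qed

lemma is_weak_pderiv_cong_AE:
  assumes "is_weak_pderiv i h w" "AE x in lborel. w x = w' x" "w' \<in> borel_measurable borel"
  shows "is_weak_pderiv i h w'"
proof -
  have [measurable]: "w \<in> borel_measurable borel" "w' \<in> borel_measurable borel"
    using assms by (auto simp: is_weak_pderiv_def locally_integrable_def)
  have "(\<integral>x. w x * \<psi> x \<partial>lborel) = (\<integral>x. w' x * \<psi> x \<partial>lborel)" if "\<psi> \<in> test_functions" for \<psi>
    using borel_measurable_continuous_onI[OF test_functionD(1)[OF that]] assms(2)
    by (intro integral_cong_AE) auto
  moreover have "locally_integrable w'"
    unfolding locally_integrable_def
  proof (intro conjI allI impI assms(3))
    fix K :: "(real^'a) set" assume K: "compact K"
    then have [measurable]: "K \<in> sets borel" by (simp add: borel_compact)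
    have "integrable lborel (\<lambda>x. indicator K x *\<^sub>R w x)"
      using assms(1) K by (auto simp: is_weak_pderiv_def locally_integrable_def set_integrable_def)
    then show "set_integrable lborel K w'"
      unfolding set_integrable_def
      by (rule integrable_cong_AE_imp) (use assms(2) in auto)
  qed
  ultimately show ?thesis using assms(1) by (auto simp: is_weak_pderiv_def)
qed

lemma Cc1D:
  assumes "g \<in> Cc1"
  shows "g differentiable (at x)" "continuous_on UNIV g" "continuous_on UNIV (pderiv_at i g)"
    "compact (fun_support g)" "compact (fun_support (pderiv_at i g))"
  using assms compact_fun_support_pderiv
  by (auto simp: Cc1_def continuous_on_eq_continuous_at differentiable_imp_continuous_within)

text \<open>The bounded classical derivative provides both the Lipschitz constant and the limit of
  the difference quotients.\<close>

lemma is_weak_pderiv_Cc1: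
  assumes "g \<in> Cc1"
  shows "is_weak_pderiv i g (pderiv_at i g)"
proof -
  obtain B where B: "\<And>x. \<bar>g x\<bar> \<le> B"
    using continuous_compact_support_bounded Cc1D(2,4)[OF assms] by metis
  obtain L where L: "\<And>x. \<bar>pderiv_at i g x\<bar> \<le> L"
    using continuous_compact_support_bounded Cc1D(3,5)[OF assms] by metis
  show ?thesis
  proof (rule weak_pderivI[OF _ B])
    show "g \<in> borel_measurable borel"
      using Cc1D(2)[OF assms] by (rule borel_measurable_continuous_onI)
    show "\<bar>g (x + h *\<^sub>R axis i 1) - g x\<bar> \<le> L * h" if "h > 0" for x h
      using lipschitz_along_axis[OF Cc1D(1)[OF assms] L, of x h] that by simp
    show "(\<lambda>n. (g (x + h n *\<^sub>R axis i 1) - g x) / h n) \<longlonglongrightarrow> pderiv_at i g x"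
      if "filterlim h (at_right 0) sequentially" for x h
      by (rule difference_quotient_along_axis[OF Cc1D(1)[OF assms]])
        (use that in \<open>auto simp: filterlim_at elim: eventually_mono\<close>)
  qed
qed

text \<open>Truncation turns the bound almost everywhere into a bound everywhere, the form in which
  the kernel estimates take their argument.\<close>

lemma form_core_bounded_weak_pderiv:
  assumes "h \<in> form_core"
  obtains w B where "is_weak_pderiv i h w" "\<And>x. \<bar>w x\<bar> \<le> B" "w \<in> borel_measurable borel"
proof -
  obtain w B where w: "is_weak_pderiv i h w" "AE x in lborel. \<bar>w x\<bar> \<le> B"
    using assms by (fastforce simp: form_core_def)
  then have [measurable]: "w \<in> borel_measurable borel"
    by (auto simp: is_weak_pderiv_def locally_integrable_def)
  define w' where "w' x = (if \<bar>w x\<bar> \<le> B then w x else 0)" for x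
  have [measurable]: "w' \<in> borel_measurable borel" unfolding w'_def by measurable
  have "is_weak_pderiv i h w'"
    by (rule is_weak_pderiv_cong_AE[OF w(1)]) (use w(2) in \<open>auto simp: w'_def elim: eventually_mono\<close>)
  moreover have "\<bar>w' x\<bar> \<le> \<bar>B\<bar>" for x by (auto simp: w'_def)
  ultimately show ?thesis by (rule that) simp
qed

section \<open>Primal functions and their averaging kernels\<close>

lemma grid_eq_range: "grid r = range (\<lambda>k :: 'n \<Rightarrow> int. (\<chi> i. r * of_int (k i)) :: real^'n)"
proof (intro equalityI subsetI)
  fix \<alpha> :: "real^'n" assume "\<alpha> \<in> grid r"
  then have "\<forall>i. \<exists>k::int. \<alpha> $ i = r * of_int k" by (simp add: grid_def)
  from choice[OF this] obtain k :: "'n \<Rightarrow> int" where "\<And>i. \<alpha> $ i = r * of_int (k i)" by blast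
  then show "\<alpha> \<in> range (\<lambda>k :: 'n \<Rightarrow> int. (\<chi> i. r * of_int (k i)) :: real^'n)"
    by (intro range_eqI[of _ _ k]) (simp add: vec_eq_iff)
qed (auto simp: grid_def)

lemma countable_grid: "countable (grid r :: (real^'n) set)"
  unfolding grid_eq_range by simp

lemma grid_1_iff: "\<alpha> \<in> grid 1 \<longleftrightarrow> (\<forall>i. \<alpha> $ i \<in> \<int>)"
  by (auto simp: grid_def Ints_def)

lemma bij_betw_grid: "r \<noteq> 0 \<Longrightarrow> bij_betw (\<lambda>\<beta>. r *\<^sub>R \<beta>) (grid 1) (grid r :: (real^'n) set)"
  unfolding bij_betw_def
proof
  assume r: "r \<noteq> 0"
  then show "inj_on ((*\<^sub>R) r) (grid 1 :: (real^'n) set)" by (auto simp: inj_on_def)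
  show "(*\<^sub>R) r ` grid 1 = (grid r :: (real^'n) set)"
    unfolding grid_eq_range image_image by (simp add: vec_eq_iff) (auto simp: vec_eq_iff image_def)
qed

text \<open>A finite set of indices, common to all primal functions, outside of which the scaled
  translates vanish at \<open>x\<close>. The radius 2r is the support bound in
  \<open>primal\<close>; it turns all grid sums into finite ones.\<close>

definition near :: "real \<Rightarrow> real^'n \<Rightarrow> (real^'n) set" where
  "near r x = {\<alpha>\<in>grid r. \<forall>j. \<bar>x $ j - \<alpha> $ j\<bar> \<le> 2 * r}"

lemma finite_near:
  assumes "0 < r"
  shows "finite (near r (x :: real^'n))"
proof -
  define A where "A j = {\<lfloor>x $ j / r\<rfloor> - 3..\<lfloor>x $ j / r\<rfloor> + 3}" for j
  have "near r x \<subseteq> (\<lambda>k. (\<chi> i. r * of_int (k i))) ` (Pi\<^sub>E UNIV A)"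
  proof
    fix \<alpha> assume a: "\<alpha> \<in> near r x"
    then obtain k :: "'n \<Rightarrow> int" where k: "\<alpha> = (\<chi> i. r * of_int (k i))"
      unfolding near_def grid_eq_range by auto
    have "k j \<in> A j" for j
    proof -
      have "\<bar>x $ j - r * of_int (k j)\<bar> \<le> 2 * r" using a by (simp add: k near_def)
      then have "\<bar>x $ j / r - of_int (k j)\<bar> \<le> 2"
        using assms by (simp add: field_simps abs_le_iff)
      then show ?thesis unfolding A_def by (auto simp: abs_le_iff) linarith+
    qed
    with k show "\<alpha> \<in> (\<lambda>k. (\<chi> i. r * of_int (k i))) ` (Pi\<^sub>E UNIV A)" by auto
  qed
  moreover have "finite (Pi\<^sub>E UNIV A)" by (intro finite_PiE) (auto simp: A_def)
  ultimately show ?thesis using finite_surj by blast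
qed

lemma near_subset_grid: "near r x \<subseteq> grid r" by (auto simp: near_def)

lemma infsum_grid_eq_near:
  assumes "0 < r" "\<And>\<alpha>. \<alpha> \<in> grid r \<Longrightarrow> \<alpha> \<notin> near r x \<Longrightarrow> f \<alpha> = (0 :: real)"
  shows "infsum f (grid r) = sum f (near r x)"
proof -
  have "infsum f (grid r) = infsum f (near r x)"
    by (rule infsum_cong_neutral) (use assms near_subset_grid in auto)
  then show ?thesis by (simp add: finite_near[OF assms(1)])
qed

text \<open>The set of nonzero terms varies with z. The sum is therefore read as an integral over a
  counting measure, and measurability comes from that of parameter integrals.\<close>

lemma borel_measurable_infsum_finite_support:
  fixes f :: "'a \<Rightarrow> 'b \<Rightarrow> real"
  assumes A: "countable A" and f: "\<And>\<alpha>. \<alpha> \<in> A \<Longrightarrow> f \<alpha> \<in> borel_measurable M"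
    and fin: "\<And>z. finite {\<alpha>\<in>A. f \<alpha> z \<noteq> 0}"
  shows "(\<lambda>z. \<Sum>\<^sub>\<infinity>\<alpha>\<in>A. f \<alpha> z) \<in> borel_measurable M"
proof -
  interpret sigma_finite_measure "count_space A" by (rule sigma_finite_measure_count_space_countable[OF A])
  have "infsum (\<lambda>\<alpha>. f \<alpha> z) A = (\<integral>\<alpha>. f \<alpha> z \<partial>count_space A)" for z
  proof -
    have "infsum (\<lambda>\<alpha>. f \<alpha> z) A = infsum (\<lambda>\<alpha>. f \<alpha> z) {\<alpha>\<in>A. f \<alpha> z \<noteq> 0}"
      by (rule infsum_cong_neutral) auto
    then show ?thesis using fin[of z] by (simp add: lebesgue_integral_count_space_finite_support)
  qed
  moreover have "(\<lambda>p. f (snd p) (fst p)) \<in> borel_measurable (M \<Otimes>\<^sub>M count_space A)"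
    by (rule measurable_compose_countable'[where f = "\<lambda>\<alpha> p. f \<alpha> (fst p)" and I = A])
       (use A f in measurable)
  then have "(\<lambda>(z, \<alpha>). f \<alpha> z) \<in> borel_measurable (M \<Otimes>\<^sub>M count_space A)" by (simp add: split_def)
  from borel_measurable_lebesgue_integral[OF this] 
  have "(\<lambda>z. \<integral>\<alpha>. f \<alpha> z \<partial>count_space A) \<in> borel_measurable M" by simp
  ultimately show ?thesis by simp
qed

section \<open>Scaled translates of primal functions\<close>

lemma primalD:
  assumes "\<phi> \<in> primal"
  shows "\<phi> \<in> borel_measurable borel" "0 \<le> \<phi> x" "\<phi> x \<le> 1" "(\<integral>x. \<phi> x \<partial>lborel) = 1"
    "(\<Sum>\<^sub>\<infinity>\<alpha>\<in>grid 1. \<phi> (x - \<alpha>)) = 1" "\<phi> x \<noteq> 0 \<Longrightarrow> \<bar>x $ j\<bar> \<le> 2"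
proof -
  show "\<bar>x $ j\<bar> \<le> 2" if "\<phi> x \<noteq> 0"
  proof -
    have "x \<in> fun_support \<phi>" using that not_in_fun_support[of x \<phi>] by blast
    with assms have "- 2 \<le> x $ j \<and> x $ j \<le> 2" unfolding primal_def by blast
    then show ?thesis by auto
  qed
qed (use assms in \<open>auto simp: primal_def\<close>)

lemma measurable_scaled[measurable]:
  assumes [measurable]: "\<phi> \<in> borel_measurable borel"
  shows "scaled \<phi> r \<alpha> \<in> borel_measurable borel"
  unfolding scaled_def[abs_def] by measurable

lemma scaled_bounds: "\<phi> \<in> primal \<Longrightarrow> 0 \<le> scaled \<phi> r \<alpha> x \<and> scaled \<phi> r \<alpha> x \<le> 1"
  by (simp add: scaled_def primalD)

lemma scaled_zero:
  assumes "\<phi> \<in> primal" "0 < r" "\<alpha> \<in> grid r" "\<alpha> \<notin> near r x"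
  shows "scaled \<phi> r \<alpha> x = 0"
proof (rule ccontr)
  assume nz: "scaled \<phi> r \<alpha> x \<noteq> 0"
  have "\<bar>x $ j - \<alpha> $ j\<bar> \<le> 2 * r" for j
    using primalD(6)[OF assms(1) nz[unfolded scaled_def], of j] assms(2)
    by (simp add: field_simps abs_le_iff)
  with assms show False by (simp add: near_def)
qed

lemma sum_scaled:
  assumes "\<phi> \<in> primal" "0 < r"
  shows "(\<Sum>\<alpha>\<in>near r x. scaled \<phi> r \<alpha> x) = 1"
proof -
  have "(\<Sum>\<alpha>\<in>near r x. scaled \<phi> r \<alpha> x) = (\<Sum>\<^sub>\<infinity>\<alpha>\<in>grid r. scaled \<phi> r \<alpha> x)"
    using infsum_grid_eq_near[of r x "\<lambda>\<alpha>. scaled \<phi> r \<alpha> x"] scaled_zero[OF assms] assms by simp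
  also have "\<dots> = (\<Sum>\<^sub>\<infinity>\<beta>\<in>grid 1. scaled \<phi> r (r *\<^sub>R \<beta>) x)"
    using infsum_reindex_bij_betw[OF bij_betw_grid, of r "\<lambda>\<alpha>. scaled \<phi> r \<alpha> x"] assms by simp
  also have "\<dots> = (\<Sum>\<^sub>\<infinity>\<beta>\<in>grid 1. \<phi> ((1 / r) *\<^sub>R x - \<beta>))"
    using assms by (simp add: scaled_def scaleR_diff_right)
  finally show ?thesis using primalD(5)[OF assms(1)] by simp
qed

lemma integral_scaled:
  assumes "\<phi> \<in> primal" "0 < r"
  shows "(\<integral>x. scaled \<phi> r \<alpha> x \<partial>lborel) = r ^ CARD('n)" "integrable lborel (scaled \<phi> r (\<alpha> :: real^'n))"
proof -
  have "(\<integral>x. scaled \<phi> r \<alpha> x \<partial>lborel) = (\<integral>x. \<phi> ((- (1 / r)) *\<^sub>R \<alpha> + (1 / r) *\<^sub>R x) \<partial>lborel)"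
    by (simp add: scaled_def algebra_simps)
  also have "\<dots> = 1 / \<bar>1 / r\<bar> ^ DIM(real^'n)"
    using assms primalD[OF assms(1)] by (subst lborel_integral_affine) auto
  finally show 1: "(\<integral>x. scaled \<phi> r \<alpha> x \<partial>lborel) = r ^ CARD('n)"
    using assms by (simp add: power_one_over)
  \<comment> \<open>A function that is not integrable has integral 0 by convention, but the integral
    was just found to be positive.\<close>
  show "integrable lborel (scaled \<phi> r \<alpha>)"
    using 1 not_integrable_integral_eq[of lborel "scaled \<phi> r \<alpha>"] assms(2) by force
qed

lemma integrable_scaled_mult:
  assumes "\<phi> \<in> primal" "0 < r" and [measurable]: "F \<in> borel_measurable borel" and "\<And>x. \<bar>F x\<bar> \<le> B"
  shows "integrable lborel (\<lambda>x. scaled \<phi> r \<alpha> x * F x)"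
proof (rule Bochner_Integration.integrable_bound)
  show "integrable lborel (\<lambda>x. B * scaled \<phi> r \<alpha> x)"
    using integral_scaled(2)[OF assms(1,2)] by simp
  have [measurable]: "\<phi> \<in> borel_measurable borel" using assms primalD by blast
  show "(\<lambda>x. scaled \<phi> r \<alpha> x * F x) \<in> borel_measurable lborel" by measurable
  show "AE x in lborel. norm (scaled \<phi> r \<alpha> x * F x) \<le> norm (B * scaled \<phi> r \<alpha> x)"
  proof (rule AE_I2)
    fix x
    have "\<bar>F x\<bar> * scaled \<phi> r \<alpha> x \<le> \<bar>B\<bar> * scaled \<phi> r \<alpha> x"
      using assms(4)[of x] scaled_bounds[OF assms(1)] by (intro mult_right_mono) auto
    then show "norm (scaled \<phi> r \<alpha> x * F x) \<le> norm (B * scaled \<phi> r \<alpha> x)"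
      using scaled_bounds[OF assms(1)] by (simp add: abs_mult mult.commute)
  qed
qed

lemma integrable_scaled_mult_integrable:
  assumes "\<phi> \<in> primal" "integrable lborel F"
  shows "integrable lborel (\<lambda>x. scaled \<phi> r \<alpha> x * F x)"
proof (rule Bochner_Integration.integrable_bound[OF assms(2)])
  have [measurable]: "\<phi> \<in> borel_measurable borel" "F \<in> borel_measurable borel" using assms primalD by auto
  show "(\<lambda>x. scaled \<phi> r \<alpha> x * F x) \<in> borel_measurable lborel" by measurable
  show "AE x in lborel. norm (scaled \<phi> r \<alpha> x * F x) \<le> norm (F x)"
    using scaled_bounds[OF assms(1), of r \<alpha>] by (auto simp: abs_mult mult_left_le_one_le)
qed

section \<open>The averaging kernel of a pair of primal functions\<close>

definition ikernel ::
  "real \<Rightarrow> (real^'n \<Rightarrow> real) \<Rightarrow> (real^'n \<Rightarrow> real) \<Rightarrow> real^'n \<Rightarrow> real^'n \<Rightarrow> real" where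
  "ikernel r \<phi> \<eta> x y = (\<Sum>\<^sub>\<infinity>\<alpha>\<in>grid r. (1 / r ^ CARD('n)) * scaled \<phi> r \<alpha> x * scaled \<eta> r \<alpha> y)"

text \<open>Passing to the adjoint kernel swaps the two primal functions, so every fact about one
  variable also serves for the other.\<close>

lemma kernel_sym: "ikernel r \<phi> \<eta> x y = ikernel r \<eta> \<phi> y x"
  by (simp add: ikernel_def mult.commute mult.left_commute)

lemma kernel_eq_sum:
  fixes x y :: "real^'n"
  assumes "\<phi> \<in> primal" "\<eta> \<in> primal" "0 < r"
  shows "ikernel r \<phi> \<eta> x y = (\<Sum>\<alpha>\<in>near r y. (1 / r ^ CARD('n)) * scaled \<phi> r \<alpha> x * scaled \<eta> r \<alpha> y)"
  unfolding ikernel_def by (rule infsum_grid_eq_near) (use assms scaled_zero in auto)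

lemma kernel_nonneg:
  assumes "\<phi> \<in> primal" "\<eta> \<in> primal" "0 < r"
  shows "0 \<le> ikernel r \<phi> \<eta> x y"
  unfolding kernel_eq_sum[OF assms] using assms scaled_bounds by (intro sum_nonneg mult_nonneg_nonneg) auto

text \<open>Both points are within 2r of a common grid point. This is the origin of the 4 in
  \<open>osc\<close>.\<close>

lemma kernel_near:
  assumes "\<phi> \<in> primal" "\<eta> \<in> primal" "0 < r" "ikernel r \<phi> \<eta> x y \<noteq> 0"
  shows "\<bar>x $ j - y $ j\<bar> \<le> 4 * r"
proof -
  obtain \<alpha> where a: "\<alpha> \<in> near r y" "scaled \<phi> r \<alpha> x \<noteq> 0"
    using assms(4) unfolding kernel_eq_sum[OF assms(1-3)] by (metis (no_types, lifting) mult_zero_left mult_zero_right sum.neutral)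
  then have "\<alpha> \<in> near r x"
    using scaled_zero[OF assms(1,3), of \<alpha> x] near_subset_grid by blast
  with a(1) have "\<bar>x $ j - \<alpha> $ j\<bar> \<le> 2 * r" "\<bar>y $ j - \<alpha> $ j\<bar> \<le> 2 * r"
    by (auto simp: near_def)
  then show ?thesis by linarith
qed

lemma finite_scaled_support:
  assumes "\<phi> \<in> primal" "0 < r"
  shows "finite {\<alpha>\<in>grid r. scaled \<phi> r \<alpha> x \<noteq> 0}"
  by (rule finite_subset[OF _ finite_near[OF assms(2), of x]]) (use scaled_zero assms in auto)

lemma measurable_kernel:
  fixes \<phi> \<eta> :: "real^'n \<Rightarrow> real"
  assumes "\<phi> \<in> primal" "\<eta> \<in> primal" "0 < r"
  shows "case_prod (ikernel r \<phi> \<eta>) \<in> borel_measurable (borel \<Otimes>\<^sub>M borel)"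
proof -
  have [measurable]: "\<phi> \<in> borel_measurable borel" "\<eta> \<in> borel_measurable borel" using assms primalD by auto
  have "(\<lambda>z. \<Sum>\<^sub>\<infinity>\<alpha>\<in>grid r. (1 / r ^ CARD('n)) * scaled \<phi> r \<alpha> (fst z) * scaled \<eta> r \<alpha> (snd z))
      \<in> borel_measurable (borel \<Otimes>\<^sub>M borel)"
  proof (rule borel_measurable_infsum_finite_support[OF countable_grid])
    fix z :: "(real^'n) \<times> (real^'n)"
    show "finite {\<alpha> \<in> grid r. (1 / r ^ CARD('n)) * scaled \<phi> r \<alpha> (fst z) * scaled \<eta> r \<alpha> (snd z) \<noteq> 0}"
      by (rule finite_subset[OF _ finite_scaled_support[OF assms(1,3), of "fst z"]]) auto
  qed measurable
  then show ?thesis by (simp add: ikernel_def split_def)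
qed

text \<open>One computation for three uses: the constant 1 gives the mass of the kernel, a function
  of x gives \<open>I_op\<close>, and the distance to the value at a fixed y gives
  \<open>R_op\<close>.\<close>

lemma kernel_integral:
  fixes \<phi> \<eta> F :: "real^'n \<Rightarrow> real"
  assumes "\<phi> \<in> primal" "\<eta> \<in> primal" "0 < r"
    and F: "\<And>\<alpha>. \<alpha> \<in> grid r \<Longrightarrow> integrable lborel (\<lambda>x. scaled \<phi> r \<alpha> x * F x)"
  shows "integrable lborel (\<lambda>x. ikernel r \<phi> \<eta> x y * F x)"
    and "(\<integral>x. ikernel r \<phi> \<eta> x y * F x \<partial>lborel) =
      (\<Sum>\<^sub>\<infinity>\<alpha>\<in>grid r. (1 / r ^ CARD('n)) * (\<integral>x. scaled \<phi> r \<alpha> x * F x \<partial>lborel) * scaled \<eta> r \<alpha> y)"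
proof -
  define c where "c = 1 / r ^ CARD('n)"
  have eq: "ikernel r \<phi> \<eta> x y * F x = (\<Sum>\<alpha>\<in>near r y. (c * scaled \<eta> r \<alpha> y) * (scaled \<phi> r \<alpha> x * F x))" for x
    unfolding kernel_eq_sum[OF assms(1-3)] c_def sum_distrib_right by (intro sum.cong) auto
  have i: "integrable lborel (\<lambda>x. (c * scaled \<eta> r \<alpha> y) * (scaled \<phi> r \<alpha> x * F x))" if "\<alpha> \<in> near r y" for \<alpha>
    using F[of \<alpha>] that near_subset_grid[of r y] by auto
  show "integrable lborel (\<lambda>x. ikernel r \<phi> \<eta> x y * F x)"
    unfolding eq by (intro Bochner_Integration.integrable_sum i)
  have "(\<integral>x. ikernel r \<phi> \<eta> x y * F x \<partial>lborel) =
      (\<Sum>\<alpha>\<in>near r y. c * scaled \<eta> r \<alpha> y * (\<integral>x. scaled \<phi> r \<alpha> x * F x \<partial>lborel))"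
    unfolding eq by (subst Bochner_Integration.integral_sum[OF i]) auto
  also have "\<dots> = (\<Sum>\<alpha>\<in>near r y. c * (\<integral>x. scaled \<phi> r \<alpha> x * F x \<partial>lborel) * scaled \<eta> r \<alpha> y)"
    by (simp add: ac_simps)
  also have "\<dots> = (\<Sum>\<^sub>\<infinity>\<alpha>\<in>grid r. c * (\<integral>x. scaled \<phi> r \<alpha> x * F x \<partial>lborel) * scaled \<eta> r \<alpha> y)"
    by (rule infsum_grid_eq_near[symmetric]) (use assms(3) scaled_zero[OF assms(2,3)] in auto)
  finally show "(\<integral>x. ikernel r \<phi> \<eta> x y * F x \<partial>lborel) =
      (\<Sum>\<^sub>\<infinity>\<alpha>\<in>grid r. (1 / r ^ CARD('n)) * (\<integral>x. scaled \<phi> r \<alpha> x * F x \<partial>lborel) * scaled \<eta> r \<alpha> y)"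
    by (simp add: c_def)
qed

text \<open>The factor r^(-d) compensates the integral of one primal function, and the other one
  sums to 1 over the grid. By symmetry this holds in both variables.\<close>

lemma kernel_integral_one:
  assumes "\<phi> \<in> primal" "\<eta> \<in> primal" "0 < r"
  shows "integrable lborel (\<lambda>x. ikernel r \<phi> \<eta> x y)" "(\<integral>x. ikernel r \<phi> \<eta> x y \<partial>lborel) = 1"
    "integrable lborel (\<lambda>x. ikernel r \<eta> \<phi> y x)" "(\<integral>x. ikernel r \<eta> \<phi> y x \<partial>lborel) = 1"
proof -
  note k = kernel_integral[OF assms, of "\<lambda>_. 1" y]
  show 1: "integrable lborel (\<lambda>x. ikernel r \<phi> \<eta> x y)"
    using k(1) integral_scaled[OF assms(1,3)] by simp
  have "(\<integral>x. ikernel r \<phi> \<eta> x y \<partial>lborel) = (\<Sum>\<^sub>\<infinity>\<alpha>\<in>grid r. scaled \<eta> r \<alpha> y)"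
    using k(2) integral_scaled[OF assms(1,3)] assms(3) by simp
  also have "\<dots> = 1"
    using infsum_grid_eq_near[of r y "\<lambda>\<alpha>. scaled \<eta> r \<alpha> y"] scaled_zero[OF assms(2,3)]
      sum_scaled[OF assms(2,3)] assms by simp
  finally show 2: "(\<integral>x. ikernel r \<phi> \<eta> x y \<partial>lborel) = 1" .
  show "integrable lborel (\<lambda>x. ikernel r \<eta> \<phi> y x)" "(\<integral>x. ikernel r \<eta> \<phi> y x \<partial>lborel) = 1"
    using 1 2 by (simp_all add: kernel_sym[of r \<phi> \<eta>])
qed

lemma I_op_eq_kernel:
  assumes "\<phi> \<in> primal" "\<eta> \<in> primal" "0 < r"
    and "\<And>\<alpha>. \<alpha> \<in> grid r \<Longrightarrow> integrable lborel (\<lambda>x. scaled \<eta> r \<alpha> x * F x)"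
  shows "I_op r \<phi> \<eta> F x = (\<integral>y. ikernel r \<phi> \<eta> x y * F y \<partial>lborel)"
    "integrable lborel (\<lambda>y. ikernel r \<phi> \<eta> x y * F y)"
  using kernel_integral[OF assms(2,1,3,4), of x]
  by (simp_all add: I_op_def kernel_sym[of r \<phi> \<eta>])

lemma R_op_eq_kernel:
  fixes \<phi> \<eta> F :: "real^'n \<Rightarrow> real"
  assumes "\<phi> \<in> primal" "\<eta> \<in> primal" "0 < r" "integrable lborel F"
  shows "R_op r \<eta> \<phi> F y = (\<integral>x. ikernel r \<phi> \<eta> x y * \<bar>F y - F x\<bar> \<partial>lborel)"
proof -
  have "integrable lborel (\<lambda>x. scaled \<phi> r \<alpha> x * (\<bar>F y\<bar> + \<bar>F x\<bar>))" for \<alpha>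
    unfolding distrib_left
    using integral_scaled(2)[OF assms(1,3), of \<alpha>] integrable_scaled_mult_integrable[OF assms(1), of "\<lambda>x. \<bar>F x\<bar>" r \<alpha>] assms(4)
    by simp
  then have "integrable lborel (\<lambda>x. scaled \<phi> r \<alpha> x * \<bar>F y - F x\<bar>)" for \<alpha>
  proof (rule Bochner_Integration.integrable_bound)
    have [measurable]: "\<phi> \<in> borel_measurable borel" "F \<in> borel_measurable borel"
      using assms primalD by auto
    show "(\<lambda>x. scaled \<phi> r \<alpha> x * \<bar>F y - F x\<bar>) \<in> borel_measurable lborel" by measurable
    show "AE x in lborel. norm (scaled \<phi> r \<alpha> x * \<bar>F y - F x\<bar>) \<le> norm (scaled \<phi> r \<alpha> x * (\<bar>F y\<bar> + \<bar>F x\<bar>))"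
    proof (rule AE_I2)
      fix x
      have "scaled \<phi> r \<alpha> x * \<bar>F y - F x\<bar> \<le> scaled \<phi> r \<alpha> x * (\<bar>F y\<bar> + \<bar>F x\<bar>)"
        using scaled_bounds[OF assms(1)] by (intro mult_left_mono) auto
      then show "norm (scaled \<phi> r \<alpha> x * \<bar>F y - F x\<bar>) \<le> norm (scaled \<phi> r \<alpha> x * (\<bar>F y\<bar> + \<bar>F x\<bar>))"
        using scaled_bounds[OF assms(1), of r \<alpha> x] by (simp add: abs_mult)
    qed
  qed
  from kernel_integral(2)[OF assms(1-3) this, of y] show ?thesis
    by (simp add: R_op_def mult.commute)
qed

text \<open>Integrating first over the variable that is absent from \<open>h\<close> leaves |h|,
  because the kernel has mass 1.\<close>

lemma integrable_kernel_product_fst: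
  fixes \<phi> \<eta> h :: "real^'n \<Rightarrow> real"
  assumes "\<phi> \<in> primal" "\<eta> \<in> primal" "0 < r" "integrable lborel h"
  shows "integrable (lborel \<Otimes>\<^sub>M lborel) (\<lambda>(x, y). ikernel r \<phi> \<eta> x y * h x)"
proof (rule lborel_pair.Fubini_integrable)
  have [measurable]: "(\<lambda>p. ikernel r \<phi> \<eta> (fst p) (snd p)) \<in> borel_measurable (lborel \<Otimes>\<^sub>M lborel)"
    using measurable_kernel[OF assms(1-3)] by (simp add: split_def)
  have [measurable]: "h \<in> borel_measurable borel" using assms by auto
  show "(\<lambda>(x, y). ikernel r \<phi> \<eta> x y * h x) \<in> borel_measurable (lborel \<Otimes>\<^sub>M lborel)"
    unfolding split_def by measurable
  note k1 = kernel_integral_one[OF assms(2,1,3)]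
  have "(\<integral>y. norm (ikernel r \<phi> \<eta> x y * h x) \<partial>lborel) = \<bar>h x\<bar>" for x
    using k1(4) kernel_nonneg[OF assms(1-3)] by (simp add: abs_mult)
  then show "integrable lborel (\<lambda>x. \<integral>y. norm (case (x, y) of (x, y) \<Rightarrow> ikernel r \<phi> \<eta> x y * h x) \<partial>lborel)"
    using assms(4) by simp
  show "AE x in lborel. integrable lborel (\<lambda>y. case (x, y) of (x, y) \<Rightarrow> ikernel r \<phi> \<eta> x y * h x)"
    using k1(3) by simp
qed

lemma integrable_kernel_product_snd:
  fixes \<phi> \<eta> h :: "real^'n \<Rightarrow> real"
  assumes "\<phi> \<in> primal" "\<eta> \<in> primal" "0 < r" "integrable lborel h"
  shows "integrable (lborel \<Otimes>\<^sub>M lborel) (\<lambda>(x, y). ikernel r \<phi> \<eta> x y * h y)"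
  using lborel_pair.integrable_product_swap[OF integrable_kernel_product_fst[OF assms(2,1,3,4)]]
  by (simp add: kernel_sym[of r \<phi> \<eta>] split_def)

section \<open>Averaging a bounded function, measured against an integrable density\<close>

locale averaging_kernel =
  fixes r :: real and \<phi> \<eta> h w :: "real^'n \<Rightarrow> real" and B :: real
  assumes primal: "\<phi> \<in> primal" "\<eta> \<in> primal" and r: "0 < r"
    and h: "integrable lborel h" "\<And>x. 0 \<le> h x"
    and w: "w \<in> borel_measurable borel" "\<And>x. \<bar>w x\<bar> \<le> B"
begin

abbreviation "K \<equiv> ikernel r \<phi> \<eta>"

lemma K_nonneg: "0 \<le> K x y"
  by (rule kernel_nonneg[OF primal r])

lemma measurable_K[measurable]: "(\<lambda>p. K (fst p) (snd p)) \<in> borel_measurable (lborel \<Otimes>\<^sub>M lborel)"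
  using measurable_kernel[OF primal r] by (simp add: split_def)

lemma measurable_h[measurable]: "h \<in> borel_measurable borel" and measurable_w[measurable]: "w \<in> borel_measurable borel"
  using h w by auto

lemma B_nonneg: "0 \<le> B" using w(2)[of 0] by linarith

lemma I_w: "I_op r \<phi> \<eta> w x = (\<integral>y. K x y * w y \<partial>lborel)" "integrable lborel (\<lambda>y. K x y * w y)"
  using I_op_eq_kernel[OF primal r integrable_scaled_mult[OF primal(2) r w]] by auto

lemma I_h: "I_op r \<eta> \<phi> h y = (\<integral>x. K x y * h x \<partial>lborel)"
    "integrable lborel (\<lambda>x. K x y * h x)"
  using I_op_eq_kernel[OF primal(2,1) r integrable_scaled_mult_integrable[OF primal(1) h(1)]]
  by (simp_all add: kernel_sym[of r \<eta> \<phi>])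

lemma R_h: "R_op r \<eta> \<phi> h y = (\<integral>x. K x y * \<bar>h y - h x\<bar> \<partial>lborel)"
  by (rule R_op_eq_kernel[OF primal r h(1)])

lemma I_h_nonneg: "0 \<le> I_op r \<eta> \<phi> h y"
  unfolding I_h using K_nonneg h(2) by (intro integral_nonneg_AE) auto

lemma R_h_nonneg: "0 \<le> R_op r \<eta> \<phi> h y"
  unfolding R_h using K_nonneg by (intro integral_nonneg_AE) auto

lemma mult_le_h:
  assumes "\<bar>a\<bar> \<le> C" "\<bar>b\<bar> \<le> h x + h y"
  shows "\<bar>a * b\<bar> \<le> C * (h x + h y)"
  unfolding abs_mult using assms order_trans[OF abs_ge_zero assms(1)] by (intro mult_mono) auto

lemma abs_h_le: "\<bar>h x\<bar> \<le> h x + h y" "\<bar>h y\<bar> \<le> h x + h y" "\<bar>h y - h x\<bar> \<le> h x + h y"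
  using h(2)[of x] h(2)[of y] by auto

lemma abs_abs_w: "\<bar>\<bar>w x\<bar>\<bar> \<le> B"
  using w(2) by simp

text \<open>Every double integral below has a bounded factor times \<open>h x\<close>,
  \<open>h y\<close> or their difference. A single dominating function justifies Fubini for all of
  them.\<close>

lemma integrable_K_mult:
  assumes F: "F \<in> borel_measurable (lborel \<Otimes>\<^sub>M lborel)"
    and le: "\<And>x y. \<bar>F (x, y)\<bar> \<le> C * (h x + h y)"
  shows "integrable (lborel \<Otimes>\<^sub>M lborel) (\<lambda>(x, y). K x y * F (x, y))"
proof (rule Bochner_Integration.integrable_bound)
  show "integrable (lborel \<Otimes>\<^sub>M lborel) (\<lambda>p. C * ((\<lambda>(x, y). K x y * h x) p + (\<lambda>(x, y). K x y * h y) p))"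
    using integrable_kernel_product_fst[OF primal r h(1)] integrable_kernel_product_snd[OF primal r h(1)]
    by (intro integrable_mult_right Bochner_Integration.integrable_add)
  note [measurable] = F
  show "(\<lambda>(x, y). K x y * F (x, y)) \<in> borel_measurable (lborel \<Otimes>\<^sub>M lborel)"
    unfolding split_def prod.collapse by measurable
  show "AE p in lborel \<Otimes>\<^sub>M lborel. norm ((\<lambda>(x, y). K x y * F (x, y)) p)
      \<le> norm (C * ((\<lambda>(x, y). K x y * h x) p + (\<lambda>(x, y). K x y * h y) p))"
  proof (rule AE_I2)
    fix p :: "(real^'n) \<times> (real^'n)"
    obtain x y where p: "p = (x, y)" by force
    have "K x y * \<bar>F (x, y)\<bar> \<le> K x y * (C * (h x + h y))"
      by (intro mult_left_mono le K_nonneg)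
    then show "norm ((\<lambda>(x, y). K x y * F (x, y)) p)
      \<le> norm (C * ((\<lambda>(x, y). K x y * h x) p + (\<lambda>(x, y). K x y * h y) p))"
      using K_nonneg[of x y] by (simp add: p abs_mult algebra_simps)
  qed
qed

lemma integral_K_mult:
  assumes F: "F \<in> borel_measurable (lborel \<Otimes>\<^sub>M lborel)"
    and le: "\<And>x y. \<bar>F (x, y)\<bar> \<le> C * (h x + h y)"
  shows "integrable lborel (\<lambda>x. \<integral>y. K x y * F (x, y) \<partial>lborel)"
    "integrable lborel (\<lambda>y. \<integral>x. K x y * F (x, y) \<partial>lborel)"
    "(\<integral>x. \<integral>y. K x y * F (x, y) \<partial>lborel \<partial>lborel) = (\<integral>p. K (fst p) (snd p) * F p \<partial>(lborel \<Otimes>\<^sub>M lborel))"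
    "(\<integral>y. \<integral>x. K x y * F (x, y) \<partial>lborel \<partial>lborel) = (\<integral>p. K (fst p) (snd p) * F p \<partial>(lborel \<Otimes>\<^sub>M lborel))"
    "integrable (lborel \<Otimes>\<^sub>M lborel) (\<lambda>p. K (fst p) (snd p) * F p)"
  using integrable_K_mult[OF assms]
    lborel_pair.integrable_fst[OF integrable_K_mult[OF assms]]
    lborel_pair.integral_fst[OF integrable_K_mult[OF assms]]
    lborel_pair.integrable_snd[OF integrable_K_mult[OF assms]]
    lborel_pair.integral_snd[OF integrable_K_mult[OF assms]]
  by (simp_all add: split_def)

lemma abs_w_mult_le: "0 \<le> a \<Longrightarrow> \<bar>w y\<bar> * a \<le> B * a"
  by (intro mult_right_mono w)

lemma integrable_w_h: "integrable lborel (\<lambda>y. \<bar>w y\<bar> * h y)"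
  by (rule Bochner_Integration.integrable_bound[OF integrable_mult_right[OF h(1), of B]])
     (use abs_w_mult_le[OF h(2)] h(2) B_nonneg in \<open>auto simp: abs_mult\<close>)

lemma
  shows integrable_w_R: "integrable lborel (\<lambda>y. \<bar>w y\<bar> * R_op r \<eta> \<phi> h y)"
    and w_R_eq: "(\<integral>y. \<bar>w y\<bar> * R_op r \<eta> \<phi> h y \<partial>lborel) =
      (\<integral>p. K (fst p) (snd p) * (\<bar>w (snd p)\<bar> * \<bar>h (snd p) - h (fst p)\<bar>) \<partial>(lborel \<Otimes>\<^sub>M lborel))"
proof -
  have le: "\<bar>\<bar>w (snd (x, y))\<bar> * \<bar>h (snd (x, y)) - h (fst (x, y))\<bar>\<bar> \<le> B * (h x + h y)" for x y
    using mult_le_h[OF abs_abs_w, of "\<bar>h y - h x\<bar>" x y y] abs_h_le(3)[of y x] by simp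
  have m: "(\<lambda>p. \<bar>w (snd p)\<bar> * \<bar>h (snd p) - h (fst p)\<bar>) \<in> borel_measurable (lborel \<Otimes>\<^sub>M lborel)"
    by measurable
  have eq: "(\<integral>x. K x y * (\<bar>w y\<bar> * \<bar>h y - h x\<bar>) \<partial>lborel) = \<bar>w y\<bar> * R_op r \<eta> \<phi> h y" for y
    unfolding R_h by (subst integral_mult_right_zero[symmetric]) (simp add: ac_simps)
  show "integrable lborel (\<lambda>y. \<bar>w y\<bar> * R_op r \<eta> \<phi> h y)"
    "(\<integral>y. \<bar>w y\<bar> * R_op r \<eta> \<phi> h y \<partial>lborel) =
      (\<integral>p. K (fst p) (snd p) * (\<bar>w (snd p)\<bar> * \<bar>h (snd p) - h (fst p)\<bar>) \<partial>(lborel \<Otimes>\<^sub>M lborel))"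
    using integral_K_mult(2,4)[OF m le] by (simp_all add: eq)
qed

lemma
  assumes [measurable]: "v \<in> borel_measurable borel" and vB: "\<And>x. \<bar>v x\<bar> \<le> C"
  shows integrable_bdd_I: "integrable lborel (\<lambda>y. v y * I_op r \<eta> \<phi> h y)"
    and bdd_I_eq: "(\<integral>y. v y * I_op r \<eta> \<phi> h y \<partial>lborel) =
      (\<integral>p. K (fst p) (snd p) * (v (snd p) * h (fst p)) \<partial>(lborel \<Otimes>\<^sub>M lborel))"
proof -
  have le: "\<bar>v (snd (x, y)) * h (fst (x, y))\<bar> \<le> C * (h x + h y)" for x y
    using mult_le_h[OF vB abs_h_le(1)] by simp
  have m: "(\<lambda>p. v (snd p) * h (fst p)) \<in> borel_measurable (lborel \<Otimes>\<^sub>M lborel)"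
    by measurable
  have eq: "(\<integral>x. K x y * (v y * h x) \<partial>lborel) = v y * I_op r \<eta> \<phi> h y" for y
    unfolding I_h by (subst integral_mult_right_zero[symmetric]) (simp add: ac_simps)
  show "integrable lborel (\<lambda>y. v y * I_op r \<eta> \<phi> h y)"
    "(\<integral>y. v y * I_op r \<eta> \<phi> h y \<partial>lborel) =
      (\<integral>p. K (fst p) (snd p) * (v (snd p) * h (fst p)) \<partial>(lborel \<Otimes>\<^sub>M lborel))"
    using integral_K_mult(2,4)[OF m le] by (simp_all add: eq)
qed

lemma I_w_bound: "\<bar>I_op r \<phi> \<eta> w x\<bar> \<le> B"
proof -
  note k = kernel_integral_one(3,4)[OF primal(2,1) r, of x]
  have "\<bar>I_op r \<phi> \<eta> w x\<bar> \<le> (\<integral>y. \<bar>K x y * w y\<bar> \<partial>lborel)"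
    unfolding I_w by (rule integral_abs_bound)
  also have "\<dots> \<le> (\<integral>y. B * K x y \<partial>lborel)"
  proof (rule integral_mono)
    show "integrable lborel (\<lambda>y. \<bar>K x y * w y\<bar>)" "integrable lborel (\<lambda>y. B * K x y)"
      using integrable_abs[OF I_w(2)[of x]] k by simp_all
    show "\<bar>K x y * w y\<bar> \<le> B * K x y" for y
      using abs_w_mult_le[OF K_nonneg, of y x y] K_nonneg[of x y] by (simp add: abs_mult mult.commute)
  qed
  finally show ?thesis using k by simp
qed

lemma measurable_I_w[measurable]: "I_op r \<phi> \<eta> w \<in> borel_measurable borel"
proof -
  have "(\<lambda>p. K (fst p) (snd p) * w (snd p)) \<in> borel_measurable (borel \<Otimes>\<^sub>M lborel)"
  proof -
    have [measurable]: "(\<lambda>p. K (fst p) (snd p)) \<in> borel_measurable (borel \<Otimes>\<^sub>M lborel)"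
      using measurable_kernel[OF primal r] by (simp add: split_def)
    show ?thesis by measurable
  qed
  then have "(\<lambda>(x, y). K x y * w y) \<in> borel_measurable (borel \<Otimes>\<^sub>M lborel)" by (simp add: split_def)
  from lborel.borel_measurable_lebesgue_integral[OF this] show ?thesis
    by (simp add: I_w(1)[abs_def])
qed

lemma interpolation_error:
  assumes G: "G \<in> borel_measurable borel" "\<And>x. \<bar>G x\<bar> \<le> D"
    and osc: "\<And>x y. (\<And>j. \<bar>x $ j - y $ j\<bar> \<le> 4 * r) \<Longrightarrow> \<bar>G x - G y\<bar> \<le> \<omega>"
  shows "\<bar>\<integral>x. G x * (w x - I_op r \<phi> \<eta> w x) * h x \<partial>lborel\<bar> \<le>
    \<omega> * (\<integral>y. \<bar>w y\<bar> * h y \<partial>lborel) + D * (\<integral>y. \<bar>w y\<bar> * R_op r \<eta> \<phi> h y \<partial>lborel)"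
proof -
  have [measurable]: "G \<in> borel_measurable borel" by fact
  have D: "0 \<le> D" using G(2)[of 0] by linarith
  \<comment> \<open>Both terms are written over the product space with the same factor
    \<open>w y\<close>. The first carries G h at y, because the kernel has mass 1 in x; the second
    carries G h at x, because integrating over y produces the average of \<open>w\<close>.
    \<open>F3\<close> and \<open>F4\<close> majorise the difference.\<close>
  define F1 :: "(real^'n) \<times> (real^'n) \<Rightarrow> real" where "F1 p = G (snd p) * w (snd p) * h (snd p)" for p
  define F2 :: "(real^'n) \<times> (real^'n) \<Rightarrow> real" where "F2 p = G (fst p) * h (fst p) * w (snd p)" for p
  define F3 :: "(real^'n) \<times> (real^'n) \<Rightarrow> real" where "F3 p = \<bar>w (snd p)\<bar> * h (snd p)" for p
  define F4 :: "(real^'n) \<times> (real^'n) \<Rightarrow> real" where "F4 p = \<bar>w (snd p)\<bar> * \<bar>h (snd p) - h (fst p)\<bar>" for p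
  have m[measurable]: "F1 \<in> borel_measurable (lborel \<Otimes>\<^sub>M lborel)" "F2 \<in> borel_measurable (lborel \<Otimes>\<^sub>M lborel)"
      "F3 \<in> borel_measurable (lborel \<Otimes>\<^sub>M lborel)" "F4 \<in> borel_measurable (lborel \<Otimes>\<^sub>M lborel)"
    unfolding F1_def F2_def F3_def F4_def by measurable
  have DB: "\<bar>G x * w y\<bar> \<le> D * B" for x y
    unfolding abs_mult using G(2) w(2) D by (intro mult_mono) auto
  have le1: "\<bar>F1 (x, y)\<bar> \<le> (D * B) * (h x + h y)" for x y
    using mult_le_h[OF DB abs_h_le(2), of y y y x] by (simp add: F1_def)
  have le2: "\<bar>F2 (x, y)\<bar> \<le> (D * B) * (h x + h y)" for x y
    using mult_le_h[OF DB abs_h_le(1), of x y x y] by (simp add: F2_def ac_simps)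
  have le3: "\<bar>F3 (x, y)\<bar> \<le> B * (h x + h y)" for x y
    using mult_le_h[OF abs_abs_w abs_h_le(2), of y y x] by (simp add: F3_def)
  have le4: "\<bar>F4 (x, y)\<bar> \<le> B * (h x + h y)" for x y
    using mult_le_h[OF abs_abs_w, of "\<bar>h y - h x\<bar>" x y y] abs_h_le(3)[of y x] by (simp add: F4_def)
  let ?I = "\<lambda>F. \<integral>p. K (fst p) (snd p) * F p \<partial>(lborel \<Otimes>\<^sub>M lborel)"
  note i1 = integral_K_mult[OF m(1) le1] and i2 = integral_K_mult[OF m(2) le2]
    and i3 = integral_K_mult[OF m(3) le3] and i4 = integral_K_mult[OF m(4) le4]
  have e1: "(\<integral>x. K x y * F1 (x, y) \<partial>lborel) = G y * w y * h y" for y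
    using kernel_integral_one(2)[OF primal r, of y] by (simp add: F1_def)
  have e2: "(\<integral>y. K x y * F2 (x, y) \<partial>lborel) = G x * I_op r \<phi> \<eta> w x * h x" for x
  proof -
    have "(\<integral>y. K x y * F2 (x, y) \<partial>lborel) = (\<integral>y. (G x * h x) * (K x y * w y) \<partial>lborel)"
      by (simp add: F2_def ac_simps)
    then show ?thesis by (simp add: I_w(1) ac_simps)
  qed
  have e3: "(\<integral>x. K x y * F3 (x, y) \<partial>lborel) = \<bar>w y\<bar> * h y" for y
    using kernel_integral_one(2)[OF primal r, of y] by (simp add: F3_def)
  have "(\<integral>x. G x * (w x - I_op r \<phi> \<eta> w x) * h x \<partial>lborel) =
      (\<integral>x. G x * w x * h x \<partial>lborel) - (\<integral>x. G x * I_op r \<phi> \<eta> w x * h x \<partial>lborel)"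
    using i1(2)[unfolded e1] i2(1)[unfolded e2]
    by (subst Bochner_Integration.integral_diff[symmetric]) (auto simp: algebra_simps)
  also have "\<dots> = ?I F1 - ?I F2"
    using i1(4)[unfolded e1] i2(3)[unfolded e2] by simp
  also have "\<dots> = (\<integral>p. K (fst p) (snd p) * F1 p - K (fst p) (snd p) * F2 p \<partial>(lborel \<Otimes>\<^sub>M lborel))"
    using i1(5) i2(5) by simp
  also have "\<bar>\<dots>\<bar> \<le> (\<integral>p. \<bar>K (fst p) (snd p) * F1 p - K (fst p) (snd p) * F2 p\<bar> \<partial>(lborel \<Otimes>\<^sub>M lborel))"
    by (rule integral_abs_bound)
  also have "\<dots> \<le> (\<integral>p. \<omega> * (K (fst p) (snd p) * F3 p) + D * (K (fst p) (snd p) * F4 p) \<partial>(lborel \<Otimes>\<^sub>M lborel))"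
  proof (rule integral_mono)
    show "integrable (lborel \<Otimes>\<^sub>M lborel) (\<lambda>p. \<bar>K (fst p) (snd p) * F1 p - K (fst p) (snd p) * F2 p\<bar>)"
      using i1(5) i2(5) by simp
    show "integrable (lborel \<Otimes>\<^sub>M lborel) (\<lambda>p. \<omega> * (K (fst p) (snd p) * F3 p) + D * (K (fst p) (snd p) * F4 p))"
      using i3(5) i4(5) by simp
    fix p :: "(real^'n) \<times> (real^'n)"
    obtain x y where p: "p = (x, y)" by force
    show "\<bar>K (fst p) (snd p) * F1 p - K (fst p) (snd p) * F2 p\<bar> \<le>
        \<omega> * (K (fst p) (snd p) * F3 p) + D * (K (fst p) (snd p) * F4 p)"
    \<comment> \<open>The oscillation bound is available only for points within 4r in each
      coordinate, and elsewhere the kernel vanishes.\<close>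
    proof (cases "K x y = 0")
      case False
      then have "\<bar>G x - G y\<bar> \<le> \<omega>"
        using kernel_near[OF primal r] by (intro osc) auto
      then have "\<bar>G y - G x\<bar> * h y \<le> \<omega> * h y"
        using h(2) by (intro mult_right_mono) auto
      moreover have "\<bar>G x\<bar> * \<bar>h y - h x\<bar> \<le> D * \<bar>h y - h x\<bar>"
        using G(2) by (intro mult_right_mono) auto
      moreover have "G y * h y - G x * h x = (G y - G x) * h y + G x * (h y - h x)"
        by (simp add: algebra_simps)
      moreover have "\<bar>(G y - G x) * h y + G x * (h y - h x)\<bar> \<le> \<bar>G y - G x\<bar> * h y + \<bar>G x\<bar> * \<bar>h y - h x\<bar>"
        using h(2)[of y] abs_triangle_ineq[of "(G y - G x) * h y" "G x * (h y - h x)"] by (simp add: abs_mult)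
      ultimately have *: "\<bar>G y * h y - G x * h x\<bar> \<le> \<omega> * h y + D * \<bar>h y - h x\<bar>" by linarith
      have "\<bar>K x y * F1 (x, y) - K x y * F2 (x, y)\<bar> = (K x y * \<bar>w y\<bar>) * \<bar>G y * h y - G x * h x\<bar>"
      proof -
        have "K x y * F1 (x, y) - K x y * F2 (x, y) = (K x y * w y) * (G y * h y - G x * h x)"
          by (simp add: F1_def F2_def algebra_simps)
        then show ?thesis using K_nonneg by (simp add: abs_mult)
      qed
      also have "\<dots> \<le> (K x y * \<bar>w y\<bar>) * (\<omega> * h y + D * \<bar>h y - h x\<bar>)"
        using * K_nonneg by (intro mult_left_mono) auto
      also have "\<dots> = \<omega> * (K x y * F3 (x, y)) + D * (K x y * F4 (x, y))"
        by (simp add: F3_def F4_def algebra_simps)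
      finally show ?thesis by (simp add: p)
    qed (simp add: p)
  qed
  also have "\<dots> = \<omega> * ?I F3 + D * ?I F4"
    using i3(5) i4(5) by simp
  also have "?I F3 = (\<integral>y. \<bar>w y\<bar> * h y \<partial>lborel)"
    using i3(4)[unfolded e3] by simp
  also have "?I F4 = (\<integral>y. \<bar>w y\<bar> * R_op r \<eta> \<phi> h y \<partial>lborel)"
    unfolding w_R_eq F4_def ..
  finally show ?thesis .
qed

lemma interpolation_energy:
  "(\<integral>x. (I_op r \<phi> \<eta> w x)\<^sup>2 * h x \<partial>lborel) \<le> (\<integral>y. (w y)\<^sup>2 * I_op r \<eta> \<phi> h y \<partial>lborel)"
proof -
  have w2: "\<bar>(w x)\<^sup>2\<bar> \<le> B\<^sup>2" for x
    using w(2)[of x] B_nonneg by (simp add: abs_le_square_iff[symmetric] power2_eq_square[symmetric])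
  define F :: "(real^'n) \<times> (real^'n) \<Rightarrow> real" where "F p = (w (snd p))\<^sup>2 * h (fst p)" for p
  have m: "F \<in> borel_measurable (lborel \<Otimes>\<^sub>M lborel)" unfolding F_def by measurable
  have le: "\<bar>F (x, y)\<bar> \<le> B\<^sup>2 * (h x + h y)" for x y
    using mult_le_h[OF w2 abs_h_le(1), of y x y] by (simp add: F_def)
  note i = integral_K_mult[OF m le]
  have jensen: "(I_op r \<phi> \<eta> w x)\<^sup>2 \<le> (\<integral>y. K x y * (w y)\<^sup>2 \<partial>lborel)" for x
  proof -
    note k = kernel_integral_one(3,4)[OF primal(2,1) r, of x]
    have k2: "integrable lborel (\<lambda>y. K x y * (w y)\<^sup>2)"
      using I_op_eq_kernel(2)[OF primal r integrable_scaled_mult[OF primal(2) r _ w2]] by simp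
    let ?m = "I_op r \<phi> \<eta> w x"
    \<comment> \<open>Jensen's inequality for the square is the nonnegativity of a variance under
      the probability density \<open>K x\<close>.\<close>
    have "0 \<le> (\<integral>y. K x y * (w y - ?m)\<^sup>2 \<partial>lborel)"
      using K_nonneg by (intro integral_nonneg_AE) auto
    also have "\<dots> = (\<integral>y. K x y * (w y)\<^sup>2 - (2 * ?m) * (K x y * w y) + ?m\<^sup>2 * K x y \<partial>lborel)"
      by (intro Bochner_Integration.integral_cong) (auto simp: power2_eq_square algebra_simps)
    also have "\<dots> = (\<integral>y. K x y * (w y)\<^sup>2 \<partial>lborel) - (2 * ?m) * ?m + ?m\<^sup>2 * 1"
      using k k2 I_w[of x] by simp
    finally show ?thesis by (simp add: power2_eq_square)
  qed
  have e: "(\<integral>y. K x y * F (x, y) \<partial>lborel) = (\<integral>y. K x y * (w y)\<^sup>2 \<partial>lborel) * h x" for x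
    by (simp add: F_def flip: mult.assoc)
  have "integrable lborel (\<lambda>x. (I_op r \<phi> \<eta> w x)\<^sup>2 * h x)"
  proof (rule Bochner_Integration.integrable_bound[OF i(1)])
    show "AE x in lborel. norm ((I_op r \<phi> \<eta> w x)\<^sup>2 * h x) \<le> norm (\<integral>y. K x y * F (x, y) \<partial>lborel)"
      unfolding e using jensen h(2) order_trans[OF zero_le_power2 jensen]
      by (auto simp: abs_mult intro!: mult_right_mono)
  qed measurable
  then have "(\<integral>x. (I_op r \<phi> \<eta> w x)\<^sup>2 * h x \<partial>lborel) \<le> (\<integral>x. \<integral>y. K x y * F (x, y) \<partial>lborel \<partial>lborel)"
    using i(1) unfolding e by (intro integral_mono mult_right_mono jensen h)
  also have "\<dots> = (\<integral>y. (w y)\<^sup>2 * I_op r \<eta> \<phi> h y \<partial>lborel)"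
    unfolding i(3) using bdd_I_eq[OF _ w2] by (simp add: F_def)
  finally show ?thesis .
qed

text \<open>Pointwise \<open>I_op r \<eta> \<phi> h\<close> is at most \<open>h\<close> plus
  \<open>R_op r \<eta> \<phi> h\<close>, so the hypotheses annihilate the integral of |w| against
  it. By Fubini that integral dominates the one of the averaged function against \<open>h\<close>.
  The lemma serves to show that \<delta> is infinite in degenerate fibres.\<close>

lemma interpolation_zero:
  assumes "(\<integral>y. \<bar>w y\<bar> * h y \<partial>lborel) = 0" "(\<integral>y. \<bar>w y\<bar> * R_op r \<eta> \<phi> h y \<partial>lborel) = 0"
  shows "AE x in lborel. I_op r \<phi> \<eta> w x * h x = 0"
proof -
  have m: "(\<lambda>x. \<bar>w x\<bar>) \<in> borel_measurable borel" by measurable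
  define F :: "(real^'n) \<times> (real^'n) \<Rightarrow> real" where "F p = \<bar>w (snd p)\<bar> * h (fst p)" for p
  have mF: "F \<in> borel_measurable (lborel \<Otimes>\<^sub>M lborel)" unfolding F_def by measurable
  have le: "\<bar>F (x, y)\<bar> \<le> B * (h x + h y)" for x y
    using mult_le_h[OF abs_abs_w abs_h_le(1), of y x y] by (simp add: F_def)
  note i = integral_K_mult[OF mF le]
  have IR: "I_op r \<eta> \<phi> h y \<le> h y + R_op r \<eta> \<phi> h y" for y
  proof -
    note k = kernel_integral_one(1,2)[OF primal r, of y]
    have d: "integrable lborel (\<lambda>x. K x y * (h y - h x))"
      unfolding right_diff_distrib using k I_h(2)[of y] by simp
    then have d2: "integrable lborel (\<lambda>x. K x y * \<bar>h y - h x\<bar>)"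
      using integrable_abs[OF d] K_nonneg by (simp add: abs_mult)
    have "I_op r \<eta> \<phi> h y \<le> (\<integral>x. h y * K x y + K x y * \<bar>h y - h x\<bar> \<partial>lborel)"
      unfolding I_h
    proof (rule integral_mono[OF I_h(2)])
      show "integrable lborel (\<lambda>x. h y * K x y + K x y * \<bar>h y - h x\<bar>)" using k d2 by simp
      show "K x y * h x \<le> h y * K x y + K x y * \<bar>h y - h x\<bar>" for x
        using mult_left_mono[of "h x" "h y + \<bar>h y - h x\<bar>" "K x y"] K_nonneg[of x y]
        by (simp add: algebra_simps)
    qed
    also have "\<dots> = h y + R_op r \<eta> \<phi> h y"
      using k d2 by (simp add: R_h)
    finally show ?thesis .
  qed
  have e: "(\<integral>y. K x y * F (x, y) \<partial>lborel) = (\<integral>y. K x y * \<bar>w y\<bar> \<partial>lborel) * h x" for x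
    by (simp add: F_def flip: mult.assoc)
  have lew: "\<bar>I_op r \<phi> \<eta> w x\<bar> \<le> (\<integral>y. K x y * \<bar>w y\<bar> \<partial>lborel)" for x
    using integral_abs_bound[of lborel "\<lambda>y. K x y * w y"] K_nonneg by (simp add: I_w(1) abs_mult)
  have "(\<integral>y. \<bar>w y\<bar> * I_op r \<eta> \<phi> h y \<partial>lborel) \<le> (\<integral>y. \<bar>w y\<bar> * h y + \<bar>w y\<bar> * R_op r \<eta> \<phi> h y \<partial>lborel)"
    using integrable_w_h integrable_w_R integrable_bdd_I[OF m abs_abs_w] mult_left_mono[OF IR, of "\<bar>w _\<bar>"]
    by (intro integral_mono) (auto simp: distrib_left)
  also have "\<dots> = 0"
    using integrable_w_h integrable_w_R assms by simp
  finally have 0: "(\<integral>y. \<bar>w y\<bar> * I_op r \<eta> \<phi> h y \<partial>lborel) \<le> 0" .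
  have ii: "integrable lborel (\<lambda>x. \<bar>I_op r \<phi> \<eta> w x\<bar> * h x)"
  proof (rule Bochner_Integration.integrable_bound[OF i(1)])
    show "AE x in lborel. norm (\<bar>I_op r \<phi> \<eta> w x\<bar> * h x) \<le> norm (\<integral>y. K x y * F (x, y) \<partial>lborel)"
      unfolding e using lew h(2) order_trans[OF abs_ge_zero lew]
      by (auto simp: abs_mult intro!: mult_right_mono)
  qed measurable
  then have "(\<integral>x. \<bar>I_op r \<phi> \<eta> w x\<bar> * h x \<partial>lborel) \<le> (\<integral>x. \<integral>y. K x y * F (x, y) \<partial>lborel \<partial>lborel)"
    using i(1) unfolding e by (intro integral_mono mult_right_mono lew h)
  also have "\<dots> = (\<integral>y. \<bar>w y\<bar> * I_op r \<eta> \<phi> h y \<partial>lborel)"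
    unfolding i(3) using bdd_I_eq[OF m abs_abs_w] by (simp add: F_def)
  also have "\<dots> \<le> 0" by (rule 0)
  finally have "(\<integral>x. \<bar>I_op r \<phi> \<eta> w x\<bar> * h x \<partial>lborel) = 0"
    using h(2) by (intro antisym integral_nonneg_AE) auto
  then have "AE x in lborel. \<bar>I_op r \<phi> \<eta> w x\<bar> * h x = 0"
    using ii h(2) by (subst (asm) integral_nonneg_eq_0_iff_AE) auto
  then show ?thesis by auto
qed

end

section \<open>The Kuhn triangulation\<close>

lemma grid_1_cases:
  assumes "\<alpha> \<in> grid 1"
  obtains k :: "'n::finite \<Rightarrow> int" where "\<alpha> = (\<chi> i. of_int (k i) :: real^'n)"
  using assms unfolding grid_eq_range by auto

lemma One_eq_vec: "(One :: real^'n) = (\<chi> j. 1)"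
proof -
  have "(One :: real^'n) $ i = 1" for i
  proof -
    have "(One :: real^'n) $ i = (One :: real^'n) \<bullet> axis i 1" by (rule cart_eq_inner_axis)
    also have "\<dots> = 1" by (rule inner_sum_left_Basis[of _ "\<lambda>_. 1", simplified]) (simp add: axis_in_Basis_iff)
    finally show ?thesis .
  qed
  then show ?thesis by (simp only: vec_eq_iff vec_lambda_beta simp_thms)
qed

lemma emeasure_half_open_cube: "emeasure lborel {x :: real^'n. \<forall>j. 0 \<le> x $ j \<and> x $ j < 1} = 1"
proof (rule antisym)
  have [measurable]: "{x :: real^'n. \<forall>j. 0 \<le> x $ j \<and> x $ j < 1} \<in> sets borel" by measurable
  have b: "emeasure lborel (box 0 One :: (real^'n) set) = 1" "emeasure lborel (cbox 0 One :: (real^'n) set) = 1"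
    by (simp_all add: emeasure_lborel_box_eq emeasure_lborel_cbox_eq inner_Basis)
  have "emeasure lborel {x :: real^'n. \<forall>j. 0 \<le> x $ j \<and> x $ j < 1} \<le> emeasure lborel (cbox 0 One :: (real^'n) set)"
    by (intro emeasure_mono) (auto simp del: sum_component simp: One_eq_vec mem_box_cart less_imp_le)
  then show "emeasure lborel {x :: real^'n. \<forall>j. 0 \<le> x $ j \<and> x $ j < 1} \<le> 1" using b by simp
  have "emeasure lborel (box 0 One :: (real^'n) set) \<le> emeasure lborel {x :: real^'n. \<forall>j. 0 \<le> x $ j \<and> x $ j < 1}"
    by (intro emeasure_mono) (auto simp del: sum_component simp: One_eq_vec mem_box_cart less_imp_le)
  then show "1 \<le> emeasure lborel {x :: real^'n. \<forall>j. 0 \<le> x $ j \<and> x $ j < 1}" using b by simp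
qed

text \<open>The partition of unity already implies the integral and the upper bound. Integrating the
  partition of unity over a half-open unit cube unfolds to the integral over the whole
  space.\<close>

lemma primalI:
  fixes \<phi> :: "real^'n \<Rightarrow> real"
  assumes [measurable]: "\<phi> \<in> borel_measurable borel" and nonneg: "\<And>x. 0 \<le> \<phi> x"
    and supp: "\<And>x j. \<phi> x \<noteq> 0 \<Longrightarrow> \<bar>x $ j\<bar> \<le> 2"
    and sum1: "\<And>x. (\<Sum>\<^sub>\<infinity>\<alpha>\<in>grid 1. \<phi> (x - \<alpha>)) = 1"
  shows "\<phi> \<in> primal"
proof -
  have z: "\<phi> (x - \<alpha>) = 0" if "\<alpha> \<in> grid 1" "\<alpha> \<notin> near 1 x" for x \<alpha>
    using supp[of "x - \<alpha>"] that by (auto simp: near_def)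
  have s: "(\<Sum>\<alpha>\<in>near 1 x. \<phi> (x - \<alpha>)) = 1" for x
    using sum1[of x] infsum_grid_eq_near[of 1 x "\<lambda>\<alpha>. \<phi> (x - \<alpha>)"] z by simp
  \<comment> \<open>\<open>\<phi> x\<close> is the term with index 0 in a sum of nonnegative terms
    that equals 1.\<close>
  have "0 \<in> near 1 x" if "\<phi> x \<noteq> 0" for x
    using supp[OF that] by (auto simp: near_def grid_1_iff)
  then have "\<phi> x \<le> 1" for x
    using member_le_sum[of 0 "near 1 x" "\<lambda>\<alpha>. \<phi> (x - \<alpha>)"] nonneg s[of x] finite_near[of 1 x]
    by (cases "\<phi> x = 0") auto
  moreover have "fun_support \<phi> \<subseteq> {x. \<forall>i. - 2 \<le> x $ i \<and> x $ i \<le> 2}"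
  proof -
    have "fun_support \<phi> \<subseteq> cbox (\<chi> i. - 2) (\<chi> i. 2)"
    proof (rule fun_support_subset)
      fix x :: "real^'n" assume "x \<notin> cbox (\<chi> i. - 2) (\<chi> i. 2)"
      then obtain j where "x $ j < - 2 \<or> 2 < x $ j" by (auto simp: mem_box_cart not_le)
      then show "\<phi> x = 0" using supp[of x j] by force
    qed (rule closed_cbox)
    then show ?thesis by (auto simp: mem_box_cart)
  qed
  moreover have "(\<integral>x. \<phi> x \<partial>lborel) = 1"
  proof -
    define Q where "Q = {x :: real^'n. \<forall>j. 0 \<le> x $ j \<and> x $ j < 1}"
    have [measurable]: "Q \<in> sets borel" unfolding Q_def by measurable
    have ns: "(\<integral>\<^sup>+\<alpha>. ennreal (\<phi> (x - \<alpha>)) \<partial>count_space (grid 1)) = 1" for x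
    proof -
      have fin: "finite {\<alpha>\<in>grid 1. 0 < ennreal (\<phi> (x - \<alpha>))}"
        by (rule finite_subset[OF _ finite_near[of 1 x]]) (use z[of _ x] in force)+
      have "(\<integral>\<^sup>+\<alpha>. ennreal (\<phi> (x - \<alpha>)) \<partial>count_space (grid 1)) =
          (\<Sum>\<alpha>\<in>{\<alpha>\<in>grid 1. 0 < ennreal (\<phi> (x - \<alpha>))}. ennreal (\<phi> (x - \<alpha>)))"
        using fin by (simp add: nn_integral_count_space)
      also have "\<dots> = (\<Sum>\<alpha>\<in>near 1 x. ennreal (\<phi> (x - \<alpha>)))"
      proof (rule sum.mono_neutral_left)
        show "{\<alpha> \<in> grid 1. 0 < ennreal (\<phi> (x - \<alpha>))} \<subseteq> near 1 x" using z[of _ x] by force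
        show "\<forall>\<alpha>\<in>near 1 x - {\<alpha> \<in> grid 1. 0 < ennreal (\<phi> (x - \<alpha>))}. ennreal (\<phi> (x - \<alpha>)) = 0"
          using near_subset_grid[of 1 x] by (auto simp: ennreal_eq_0_iff not_less)
      qed (simp add: finite_near)
      finally show ?thesis using s[of x] nonneg by (simp add: sum_ennreal)
    qed
    have qs: "(\<integral>\<^sup>+\<alpha>. indicator Q (x + \<alpha>) \<partial>count_space (grid 1)) = (1 :: ennreal)" for x
    proof -
      \<comment> \<open>The only integer vector that moves \<open>x\<close> into the half-open cube
        \<open>Q\<close>.\<close>
      define \<beta> where "\<beta> = (\<chi> j. - of_int \<lfloor>x $ j\<rfloor> :: real^'n)"
      have \<beta>: "\<beta> \<in> grid 1" by (auto simp: grid_1_iff \<beta>_def)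
      have "indicator Q (x + \<alpha>) = (indicator {\<beta>} \<alpha> :: ennreal)" if \<alpha>: "\<alpha> \<in> grid 1" for \<alpha>
      proof -
        obtain k :: "'n \<Rightarrow> int" where k: "\<alpha> = (\<chi> i. of_int (k i))"
          using \<alpha> by (rule grid_1_cases)
        have "x + \<alpha> \<in> Q \<longleftrightarrow> (\<forall>j. \<lfloor>x $ j\<rfloor> = - k j)"
          unfolding Q_def k by (simp add: floor_eq_iff) (smt (verit))
        also have "\<dots> \<longleftrightarrow> \<alpha> = \<beta>"
        proof -
          have "\<lfloor>x $ j\<rfloor> = - k j \<longleftrightarrow> real_of_int (k j) = - of_int \<lfloor>x $ j\<rfloor>" for j by linarith
          then show ?thesis unfolding k \<beta>_def by (simp add: vec_eq_iff)
        qed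
        finally show ?thesis by (simp add: indicator_def)
      qed
      then have "(\<integral>\<^sup>+\<alpha>. indicator Q (x + \<alpha>) \<partial>count_space (grid 1)) =
          (\<integral>\<^sup>+\<alpha>. indicator {\<beta>} \<alpha> \<partial>count_space (grid 1 :: (real^'n) set))"
        by (intro nn_integral_cong) simp
      then show ?thesis using \<beta> by (simp add: one_ennreal_def[symmetric])
    qed
    \<comment> \<open>Insert the tiling by translates of \<open>Q\<close>, shift each piece back
      into \<open>Q\<close>, and sum the translates of \<phi> there.\<close>
    have "(\<integral>\<^sup>+x. ennreal (\<phi> x) \<partial>lborel) =
        (\<integral>\<^sup>+x. (\<integral>\<^sup>+\<alpha>. ennreal (\<phi> x) * indicator Q (x + \<alpha>) \<partial>count_space (grid 1)) \<partial>lborel)"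
      by (simp add: nn_integral_cmult qs)
    also have "\<dots> = (\<integral>\<^sup>+\<alpha>. (\<integral>\<^sup>+x. ennreal (\<phi> x) * indicator Q (x + \<alpha>) \<partial>lborel) \<partial>count_space (grid 1))"
      by (rule nn_integral_count_space_nn_integral) (auto intro: countable_grid)
    also have "\<dots> = (\<integral>\<^sup>+\<alpha>. (\<integral>\<^sup>+x. ennreal (\<phi> (x - \<alpha>)) * indicator Q x \<partial>lborel) \<partial>count_space (grid 1))"
    proof (rule nn_integral_cong)
      fix \<alpha> :: "real^'n"
      show "(\<integral>\<^sup>+x. ennreal (\<phi> x) * indicator Q (x + \<alpha>) \<partial>lborel) =
          (\<integral>\<^sup>+x. ennreal (\<phi> (x - \<alpha>)) * indicator Q x \<partial>lborel)"
        using lborel_nn_integral_affine[of "\<lambda>x. ennreal (\<phi> (x - \<alpha>)) * indicator Q x" 1 \<alpha>]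
        by (simp add: add.commute)
    qed
    also have "\<dots> = (\<integral>\<^sup>+x. (\<integral>\<^sup>+\<alpha>. ennreal (\<phi> (x - \<alpha>)) * indicator Q x \<partial>count_space (grid 1)) \<partial>lborel)"
      by (rule nn_integral_count_space_nn_integral[symmetric]) (auto intro: countable_grid)
    also have "\<dots> = (\<integral>\<^sup>+x. indicator Q x \<partial>lborel)"
      by (simp add: nn_integral_multc ns)
    also have "\<dots> = 1"
      using emeasure_half_open_cube by (simp add: Q_def)
    finally show ?thesis
      using nonneg by (simp add: integral_eq_nn_integral)
  qed
  ultimately show ?thesis
    using nonneg sum1 by (simp add: primal_def)
qed

text \<open>The sum over the grid becomes a product of one-dimensional sums once it is cut to a
  product of finite windows; outside of them some coordinate differs by more than 2.\<close>

lemma tensor_primal: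
  fixes p :: "'n::finite \<Rightarrow> real \<Rightarrow> real"
  assumes cont: "\<And>j. continuous_on UNIV (p j)" and nonneg: "\<And>j t. 0 \<le> p j t"
    and supp: "\<And>j t. 2 < \<bar>t\<bar> \<Longrightarrow> p j t = 0"
    and sum1: "\<And>j t. (\<Sum>k\<in>{\<lfloor>t\<rfloor> - 3..\<lfloor>t\<rfloor> + 3}. p j (t - of_int k)) = 1"
  shows "tensor p \<in> primal"
proof (rule primalI)
  show "tensor p \<in> borel_measurable borel"
    by (intro borel_measurable_continuous_onI continuous_tensor cont)
  show "0 \<le> tensor p x" for x unfolding tensor_def by (intro prod_nonneg nonneg ballI)
  show supp': "\<bar>x $ j\<bar> \<le> 2" if "tensor p x \<noteq> 0" for x j
    using that supp[of "x $ j" j] unfolding tensor_def by (force simp: not_le[symmetric])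
  fix x :: "real^'n"
  define A where "A j = {\<lfloor>x $ j\<rfloor> - 3..\<lfloor>x $ j\<rfloor> + 3}" for j
  define v where "v k = (\<chi> i. of_int (k i) :: real^'n)" for k
  have inj: "inj_on v (Pi\<^sub>E UNIV A)"
    by (auto simp: inj_on_def v_def vec_eq_iff)
  have fin: "finite (Pi\<^sub>E UNIV A)" by (intro finite_PiE) (auto simp: A_def)
  have "(\<Sum>\<^sub>\<infinity>\<alpha>\<in>grid 1. tensor p (x - \<alpha>)) = (\<Sum>\<^sub>\<infinity>\<alpha>\<in>v ` Pi\<^sub>E UNIV A. tensor p (x - \<alpha>))"
  proof (rule infsum_cong_neutral)
    fix \<alpha> assume a: "\<alpha> \<in> grid 1 - v ` Pi\<^sub>E UNIV A"
    then obtain k :: "'n \<Rightarrow> int" where k: "\<alpha> = v k" unfolding v_def using grid_1_cases by blast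
    with a obtain j where "k j \<notin> A j" by auto
    then have "2 < \<bar>(x - \<alpha>) $ j\<bar>" unfolding A_def k v_def by (auto simp: abs_if) linarith+
    then show "tensor p (x - \<alpha>) = 0" using supp'[of "x - \<alpha>" j] by force
  qed (auto simp: v_def grid_1_iff)
  also have "\<dots> = (\<Sum>k\<in>Pi\<^sub>E UNIV A. tensor p (x - v k))"
    using fin inj by (simp add: sum.reindex)
  also have "\<dots> = (\<Prod>j\<in>UNIV. \<Sum>k\<in>A j. p j (x $ j - of_int k))"
    unfolding tensor_def v_def by (subst prod_sum_PiE) (auto simp: A_def)
  also have "\<dots> = 1" using sum1 by (simp add: A_def)
  finally show "(\<Sum>\<^sub>\<infinity>\<alpha>\<in>grid 1. tensor p (x - \<alpha>)) = 1" .
qed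

text \<open>The sum telescopes, and the window is wide enough for its two end values to be 1 and
  0.\<close>

lemma bump_of_sum:
  assumes "transition P"
  shows "(\<Sum>k\<in>{\<lfloor>t\<rfloor> - 3..\<lfloor>t\<rfloor> + 3}. bump_of P (t - of_int k)) = 1"
proof -
  define m where "m = \<lfloor>t\<rfloor>"
  have "{m - 3..m + 3} = {m - 3, m - 2, m - 1, m, m + 1, m + 2, m + 3}" by auto
  then have "(\<Sum>k\<in>{m - 3..m + 3}. bump_of P (t - of_int k)) = P (t - m + 3) - P (t - m - 4)"
    by (simp add: bump_of_def algebra_simps)
  moreover have "t - m + 3 \<ge> 1" "t - m - 4 \<le> -1" unfolding m_def by linarith+
  ultimately show ?thesis using assms by (simp add: m_def transition_def)
qed

lemma tensor_bump_primal:
  assumes "\<And>j. transition (P j)"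
  shows "tensor (\<lambda>j. bump_of (P j)) \<in> primal"
  by (rule tensor_primal)
     (use assms in \<open>auto simp: smooth_bump_of smooth_cont bump_of_bounds bump_of_sum intro!: bump_of_0\<close>)

section \<open>Barycentric coordinates by random rounding\<close>

text \<open>All coordinates receive the same shift. As \<theta> grows from 0 to 1 they jump in the
  order of decreasing fractional parts, so the rounded point runs through the vertices of a Kuhn
  simplex that contains \<open>y\<close>, and the time spent at a vertex is its barycentric
  coordinate.\<close>

definition round_shift :: "real^'n \<Rightarrow> real \<Rightarrow> real^'n" where
  "round_shift y \<theta> = (\<chi> j. of_int \<lfloor>y $ j + \<theta>\<rfloor>)"

lemma round_shift_set_eq:
  fixes y \<beta> :: "real^'n"
  assumes "\<beta> \<in> grid 1"
  shows "{\<theta>\<in>{0..<1}. round_shift y \<theta> = \<beta>} =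
    {max 0 (- Min (range (\<lambda>k. (y - \<beta>) $ k)))..<min 1 (1 - Max (range (\<lambda>k. (y - \<beta>) $ k)))}"
proof -
  obtain k :: "'n \<Rightarrow> int" where k: "\<beta> = (\<chi> i. of_int (k i))"
    using assms by (rule grid_1_cases)
  define m where "m = Min (range (\<lambda>k. (y - \<beta>) $ k))"
  define M where "M = Max (range (\<lambda>k. (y - \<beta>) $ k))"
  have "round_shift y \<theta> = \<beta> \<longleftrightarrow> (\<forall>j. - \<theta> \<le> (y - \<beta>) $ j \<and> (y - \<beta>) $ j < 1 - \<theta>)" for \<theta>
  proof -
    have "\<lfloor>y $ j + \<theta>\<rfloor> = k j \<longleftrightarrow> - \<theta> \<le> y $ j - of_int (k j) \<and> y $ j - of_int (k j) < 1 - \<theta>" for j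
      unfolding floor_eq_iff by linarith
    then show ?thesis unfolding round_shift_def k by (simp add: vec_eq_iff)
  qed
  moreover have "- \<theta> \<le> m \<longleftrightarrow> (\<forall>j. - \<theta> \<le> (y - \<beta>) $ j)" for \<theta>
    unfolding m_def by (subst Min_ge_iff) simp_all
  moreover have "M < 1 - \<theta> \<longleftrightarrow> (\<forall>j. (y - \<beta>) $ j < 1 - \<theta>)" for \<theta>
    unfolding M_def by (subst Max_less_iff) simp_all
  ultimately have key: "round_shift y \<theta> = \<beta> \<longleftrightarrow> - \<theta> \<le> m \<and> M < 1 - \<theta>" for \<theta> by blast
  show ?thesis
    unfolding m_def[symmetric] M_def[symmetric]
    by (intro set_eqI, unfold mem_Collect_eq atLeastLessThan_iff key max.bounded_iff min_less_iff_conj) linarith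
qed

lemma emeasure_lborel_Ico_finite: "emeasure lborel {a..<b :: real} < \<infinity>"
  by (cases "a \<le> b") auto

lemma tent_eq_measure:
  fixes y \<beta> :: "real^'n"
  assumes "\<beta> \<in> grid 1"
  shows "tent (y - \<beta>) = measure lborel {\<theta>\<in>{0..<1}. round_shift y \<theta> = \<beta>}"
    "{\<theta>\<in>{0..<1}. round_shift y \<theta> = \<beta>} \<in> sets borel"
    "emeasure lborel {\<theta>\<in>{0..<1}. round_shift y \<theta> = \<beta>} < \<infinity>"
proof -
  define m where "m = Min (range (\<lambda>k. (y - \<beta>) $ k))"
  define M where "M = Max (range (\<lambda>k. (y - \<beta>) $ k))"
  have mM: "m \<le> M" unfolding m_def M_def by (rule order_trans[OF Min_le Max_ge]) auto
  \<comment> \<open>The length of the interval is the least of four differences of end points. The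
    difference 1 - 0 drops out because \<open>m \<le> M\<close>; the other three are those in
    \<open>tent\<close>.\<close>
  have "measure lborel {max 0 (- m)..<min 1 (1 - M)} = max 0 (min (1 + m) (min (1 - M) (1 + m - M)))"
  proof -
    have "measure lborel {a..<b} = max 0 (b - a)" for a b :: real
      by (cases "a \<le> b") auto
    then show ?thesis using mM unfolding max_def min_def by (smt (verit))
  qed
  then show "tent (y - \<beta>) = measure lborel {\<theta>\<in>{0..<1}. round_shift y \<theta> = \<beta>}"
    unfolding round_shift_set_eq[OF assms] tent_def Let_def m_def M_def by simp
  show "{\<theta>\<in>{0..<1}. round_shift y \<theta> = \<beta>} \<in> sets borel"
    "emeasure lborel {\<theta>\<in>{0..<1}. round_shift y \<theta> = \<beta>} < \<infinity>"
    unfolding round_shift_set_eq[OF assms] using emeasure_lborel_Ico_finite by auto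
qed

lemma round_shift_near: "\<theta> \<in> {0..<1} \<Longrightarrow> round_shift y \<theta> \<in> near 1 y"
  unfolding near_def grid_1_iff round_shift_def by (auto simp: abs_le_iff) linarith+

lemma tent_zero: "\<beta> \<in> grid 1 \<Longrightarrow> \<beta> \<notin> near 1 y \<Longrightarrow> tent (y - \<beta>) = 0"
proof -
  assume b: "\<beta> \<in> grid 1" "\<beta> \<notin> near 1 y"
  then have e: "{\<theta>\<in>{0..<1}. round_shift y \<theta> = \<beta>} = {}" using round_shift_near by blast
  show ?thesis unfolding tent_eq_measure(1)[OF b(1)] e by (rule measure_empty)
qed

text \<open>Interpolation on the Kuhn triangulation is the average over \<open>\<theta>\<close> of the values at the
  randomly rounded point.\<close>

lemma
  fixes y :: "real^'n" and b :: "real^'n \<Rightarrow> real"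
  shows tent_sum_eq_integral:
      "(\<Sum>\<^sub>\<infinity>\<beta>\<in>grid 1. b \<beta> * tent (y - \<beta>)) = (\<integral>\<theta>. indicator {0..<1} \<theta> * b (round_shift y \<theta>) \<partial>lborel)"
    and integrable_round_shift: "integrable lborel (\<lambda>\<theta>. indicator {0..<1} \<theta> * b (round_shift y \<theta>))"
proof -
  define S where "S \<beta> = {\<theta>\<in>{0..<1}. round_shift y \<theta> = \<beta>}" for \<beta>
  have Siff: "\<theta> \<in> S \<beta> \<longleftrightarrow> \<theta> \<in> {0..<1} \<and> round_shift y \<theta> = \<beta>" for \<theta> \<beta>
    unfolding S_def by blast
  have eq: "indicator {0..<1} \<theta> * b (round_shift y \<theta>) = (\<Sum>\<beta>\<in>near 1 y. b \<beta> * indicator (S \<beta>) \<theta>)" for \<theta>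
  proof (cases "\<theta> \<in> {0..<1}")
    case True
    then have "(\<Sum>\<beta>\<in>near 1 y. b \<beta> * indicator (S \<beta>) \<theta>) =
        (\<Sum>\<beta>\<in>near 1 y. if \<beta> = round_shift y \<theta> then b \<beta> else 0)"
      by (intro sum.cong) (auto simp: indicator_def Siff)
    also have "\<dots> = b (round_shift y \<theta>)"
      using round_shift_near[OF True, of y] finite_near[of 1 y] by simp
    finally show ?thesis using True by simp
  next
    case False
    then have "indicator (S \<beta>) \<theta> = (0 :: real)" for \<beta> using Siff by (auto simp: indicator_def)
    then show ?thesis using False by simp
  qed
  have i: "integrable lborel (\<lambda>\<theta>. b \<beta> * indicator (S \<beta>) \<theta>)" if "\<beta> \<in> near 1 y" for \<beta>
    unfolding S_def using tent_eq_measure(2,3)[of \<beta> y] that near_subset_grid[of 1 y]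
    by (intro integrable_mult_right integrable_real_indicator) auto
  show "integrable lborel (\<lambda>\<theta>. indicator {0..<1} \<theta> * b (round_shift y \<theta>))"
    unfolding eq by (intro Bochner_Integration.integrable_sum i)
  have "(\<integral>\<theta>. indicator {0..<1} \<theta> * b (round_shift y \<theta>) \<partial>lborel) = (\<Sum>\<beta>\<in>near 1 y. b \<beta> * measure lborel (S \<beta>))"
    unfolding eq by (subst Bochner_Integration.integral_sum[OF i]) auto
  also have "\<dots> = (\<Sum>\<beta>\<in>near 1 y. b \<beta> * tent (y - \<beta>))"
    using near_subset_grid[of 1 y] by (intro sum.cong) (auto simp: tent_eq_measure(1)[of _ y] S_def)
  also have "\<dots> = (\<Sum>\<^sub>\<infinity>\<beta>\<in>grid 1. b \<beta> * tent (y - \<beta>))"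
    by (rule infsum_grid_eq_near[symmetric]) (auto simp: tent_zero)
  finally show "(\<Sum>\<^sub>\<infinity>\<beta>\<in>grid 1. b \<beta> * tent (y - \<beta>)) =
    (\<integral>\<theta>. indicator {0..<1} \<theta> * b (round_shift y \<theta>) \<partial>lborel)" ..
qed

text \<open>The partition of unity is the interpolation of the constant coefficients 1.\<close>

lemma tent_primal: "(tent :: real^'n \<Rightarrow> real) \<in> primal"
proof (rule primalI)
  show "(tent :: real^'n \<Rightarrow> real) \<in> borel_measurable borel"
    unfolding tent_def[abs_def] Let_def by measurable
  show "0 \<le> tent x" for x :: "real^'n" by (simp add: tent_def Let_def)
  show "\<bar>x $ j\<bar> \<le> 2" if "tent x \<noteq> 0" for x :: "real^'n" and j
  proof -
    have "max 0 (min (1 + m) (min (1 - M) (1 + m - M))) \<noteq> 0 \<Longrightarrow> - 1 < m \<and> M < 1" for m M :: real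
      by (auto simp: max_def min_def split: if_splits)
    from this[OF that[unfolded tent_def Let_def]]
    have "- 1 < Min (range (\<lambda>k. x $ k))" "Max (range (\<lambda>k. x $ k)) < 1" by blast+
    moreover have "Min (range (\<lambda>k. x $ k)) \<le> x $ j" "x $ j \<le> Max (range (\<lambda>k. x $ k))" by simp_all
    ultimately show ?thesis by linarith
  qed
  show "(\<Sum>\<^sub>\<infinity>\<alpha>\<in>grid 1. tent (x - \<alpha>)) = 1" for x :: "real^'n"
    using tent_sum_eq_integral[of "\<lambda>_. 1" x] by simp
qed

section \<open>The gradient of the piecewise linear interpolant\<close>

text \<open>Coordinate i jumps at the shift \<theta> =
  \<open>of_int \<lfloor>y $ i\<rfloor> + 1 - y $ i\<close>. The vertex is the rounded point just
  before this jump: \<open>\<lceil>t\<rceil> - 1\<close> is the left limit of the floor function at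
  t. The edge in direction i starts there.\<close>

definition kuhn_vertex :: "'n \<Rightarrow> real^'n \<Rightarrow> real^'n" where
  "kuhn_vertex i y = (\<chi> j. of_int (\<lceil>y $ j + (of_int \<lfloor>y $ i\<rfloor> + 1 - y $ i)\<rceil> - 1))"

text \<open>\<open>kuhn_edge i\<close> is the indicator of the union of the simplices that contain the edge from
  \<open>0\<close> to \<open>axis i 1\<close>, with the boundaries assigned so that the translates partition the space.\<close>

definition kuhn_edge :: "'n \<Rightarrow> real^'n \<Rightarrow> real" where
  "kuhn_edge i z = (if kuhn_vertex i z = 0 then 1 else 0)"

lemma kuhn_vertex_grid: "kuhn_vertex i y \<in> grid 1"
  by (simp add: kuhn_vertex_def grid_1_iff)

text \<open>The jump time depends only on the fractional part of coordinate i. This equivariance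
  makes the translates of \<open>kuhn_edge\<close> a partition.\<close>

lemma kuhn_vertex_diff:
  fixes y :: "real^'n"
  assumes "\<beta> \<in> grid 1"
  shows "kuhn_vertex i (y - \<beta>) = kuhn_vertex i y - \<beta>"
proof -
  obtain k :: "'n \<Rightarrow> int" where k: "\<beta> = (\<chi> i. of_int (k i))"
    using assms by (rule grid_1_cases)
  have "\<lceil>y $ j - of_int (k j) + (of_int \<lfloor>y $ i - of_int (k i)\<rfloor> + 1 - (y $ i - of_int (k i)))\<rceil> =
    \<lceil>y $ j + (of_int \<lfloor>y $ i\<rfloor> + 1 - y $ i)\<rceil> - k j" for j
  proof -
    have "y $ j - of_int (k j) + (of_int \<lfloor>y $ i - of_int (k i)\<rfloor> + 1 - (y $ i - of_int (k i))) =
      y $ j + (of_int \<lfloor>y $ i\<rfloor> + 1 - y $ i) - of_int (k j)" by simp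
    then show ?thesis by (simp only: ceiling_diff_of_int)
  qed
  then show ?thesis by (simp add: kuhn_vertex_def k vec_eq_iff)
qed

lemma sum_kuhn_edge:
  fixes y :: "real^'n"
  shows "(\<Sum>\<^sub>\<infinity>\<beta>\<in>grid 1. c \<beta> * kuhn_edge i (y - \<beta>)) = c (kuhn_vertex i y)"
proof -
  have "(\<Sum>\<^sub>\<infinity>\<beta>\<in>grid 1. c \<beta> * kuhn_edge i (y - \<beta>)) = (\<Sum>\<^sub>\<infinity>\<beta>\<in>{kuhn_vertex i y}. c \<beta> * kuhn_edge i (y - \<beta>))"
    by (rule infsum_cong_neutral) (auto simp: kuhn_edge_def kuhn_vertex_diff kuhn_vertex_grid)
  then show ?thesis by (simp add: kuhn_edge_def kuhn_vertex_diff kuhn_vertex_grid)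
qed

lemma kuhn_edge_primal: "(kuhn_edge i :: real^'n \<Rightarrow> real) \<in> primal"
proof (rule primalI)
  have "kuhn_edge i = (\<lambda>z :: real^'n. if \<forall>j. real_of_int \<lceil>z $ j + (of_int \<lfloor>z $ i\<rfloor> + 1 - z $ i)\<rceil> = 1 then 1 else 0)"
    by (auto simp: kuhn_edge_def kuhn_vertex_def vec_eq_iff fun_eq_iff)
  also have "\<dots> \<in> borel_measurable borel" by measurable
  finally show "(kuhn_edge i :: real^'n \<Rightarrow> real) \<in> borel_measurable borel" .
  show "0 \<le> kuhn_edge i x" for x :: "real^'n" by (simp add: kuhn_edge_def)
  show "\<bar>x $ j\<bar> \<le> 2" if "kuhn_edge i x \<noteq> 0" for x :: "real^'n" and j
  proof -
    have z: "\<lceil>x $ j + (of_int \<lfloor>x $ i\<rfloor> + 1 - x $ i)\<rceil> = 1" for j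
      using that by (auto simp: kuhn_edge_def kuhn_vertex_def vec_eq_iff split: if_splits)
    then show ?thesis using z[of j] by linarith
  qed
  show "(\<Sum>\<^sub>\<infinity>\<alpha>\<in>grid 1. kuhn_edge i (x - \<alpha>)) = 1" for x :: "real^'n"
    using sum_kuhn_edge[of "\<lambda>_. 1"] by simp
qed

lemma round_shift_axis:
  "round_shift (y + h *\<^sub>R axis i 1) \<theta> = (\<chi> j. if j = i then of_int \<lfloor>y $ i + h + \<theta>\<rfloor> else of_int \<lfloor>y $ j + \<theta>\<rfloor>)"
  by (auto simp: round_shift_def vec_eq_iff axis_def)

text \<open>Compare both points under the same \<theta>. The rounded points differ only for \<theta>
  in [t - h, t), an interval of length h, where they are the two ends of the edge in direction
  i.\<close>

lemma tent_sum_right_difference: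
  fixes y :: "real^'n" and b :: "real^'n \<Rightarrow> real"
  defines "L \<equiv> \<lambda>y. \<Sum>\<^sub>\<infinity>\<beta>\<in>grid 1. b \<beta> * tent (y - \<beta>)"
  shows "\<exists>h0>0. \<forall>h. 0 < h \<and> h \<le> h0 \<longrightarrow>
    L (y + h *\<^sub>R axis i 1) - L y = h * (b (kuhn_vertex i y + axis i 1) - b (kuhn_vertex i y))"
proof -
  define t where "t = of_int \<lfloor>y $ i\<rfloor> + 1 - y $ i"
  define \<beta> where "\<beta> = kuhn_vertex i y"
  have t: "0 < t" "t \<le> 1" unfolding t_def by linarith+
  have \<beta>j: "\<beta> $ j = of_int (\<lceil>y $ j + t\<rceil> - 1)" for j by (simp add: \<beta>_def kuhn_vertex_def t_def)
  have pos: "0 < y $ j + t - \<beta> $ j" for j unfolding \<beta>j by linarith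
  \<comment> \<open>The bound t keeps the interval [t - h, t) inside [0, 1); the other bounds ensure
    that no coordinate jumps in its interior.\<close>
  define h0 where "h0 = Min (insert t (range (\<lambda>j. y $ j + t - \<beta> $ j)))"
  have h0: "0 < h0" "h0 \<le> t" "\<And>j. h0 \<le> y $ j + t - \<beta> $ j"
  proof -
    show "0 < h0" unfolding h0_def using pos t by auto
    have "h0 \<le> z" if "z \<in> insert t (range (\<lambda>j. y $ j + t - \<beta> $ j))" for z
      unfolding h0_def using that by (intro Min_le) auto
    then show "h0 \<le> t" "\<And>j. h0 \<le> y $ j + t - \<beta> $ j" by auto
  qed
  have "L (y + h *\<^sub>R axis i 1) - L y = h * (b (\<beta> + axis i 1) - b \<beta>)" if h: "0 < h" "h \<le> h0" for h
  proof -
    have fi: "\<lfloor>y $ i + \<theta>\<rfloor> = (if \<theta> < t then \<lfloor>y $ i\<rfloor> else \<lfloor>y $ i\<rfloor> + 1)" if "\<theta> \<in> {0..<1}" for \<theta>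
      using that unfolding t_def by (auto simp: floor_eq_iff) linarith+
    have fh: "\<lfloor>y $ i + h + \<theta>\<rfloor> = (if \<theta> < t - h then \<lfloor>y $ i\<rfloor> else \<lfloor>y $ i\<rfloor> + 1)" if "\<theta> \<in> {0..<1}" for \<theta>
      using that h h0(2) unfolding t_def by (auto simp: floor_eq_iff) linarith+
    have \<beta>i: "\<beta> $ i = of_int \<lfloor>y $ i\<rfloor>"
    proof -
      have "\<lceil>y $ i + t\<rceil> = \<lfloor>y $ i\<rfloor> + 1" unfolding t_def by simp
      then show ?thesis unfolding \<beta>j by simp
    qed
    have fj: "of_int \<lfloor>y $ j + \<theta>\<rfloor> = \<beta> $ j" if "t - h \<le> \<theta>" "\<theta> < t" for j \<theta>
    proof -
      have "y $ j + \<theta> \<ge> \<beta> $ j" using h0(3)[of j] h that by linarith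
      moreover have "y $ j + \<theta> < \<beta> $ j + 1" using that unfolding \<beta>j by linarith
      ultimately have "\<lfloor>y $ j + \<theta>\<rfloor> = \<lceil>y $ j + t\<rceil> - 1" unfolding \<beta>j by (intro floor_unique) auto
      then show ?thesis unfolding \<beta>j by simp
    qed
    have eq: "indicator {0..<1} \<theta> * b (round_shift (y + h *\<^sub>R axis i 1) \<theta>) - indicator {0..<1} \<theta> * b (round_shift y \<theta>) =
        indicator {t - h..<t} \<theta> * (b (\<beta> + axis i 1) - b \<beta>)" for \<theta>
    proof (cases "t - h \<le> \<theta> \<and> \<theta> < t")
      case True
      then have th: "\<theta> \<in> {0..<1}" using h h0(2) t by auto
      have "round_shift y \<theta> = \<beta>"
        using True by (simp add: round_shift_def vec_eq_iff fj)
      moreover have "round_shift (y + h *\<^sub>R axis i 1) \<theta> = \<beta> + axis i 1"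
        unfolding round_shift_axis using True fh[OF th] by (auto simp: vec_eq_iff fj axis_def \<beta>i)
      ultimately show ?thesis using True th by simp
    next
      case False
      have "round_shift (y + h *\<^sub>R axis i 1) \<theta> = round_shift y \<theta>" if th: "\<theta> \<in> {0..<1}"
        unfolding round_shift_axis using False h(1) fh[OF th] fi[OF th] by (auto simp: vec_eq_iff round_shift_def)
      then show ?thesis using False by (auto split: split_indicator)
    qed
    have "L (y + h *\<^sub>R axis i 1) - L y = (\<integral>\<theta>. indicator {t - h..<t} \<theta> * (b (\<beta> + axis i 1) - b \<beta>) \<partial>lborel)"
      unfolding L_def tent_sum_eq_integral eq[symmetric]
      by (rule Bochner_Integration.integral_diff[symmetric]) (rule integrable_round_shift)+
    also have "\<dots> = h * (b (\<beta> + axis i 1) - b \<beta>)"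
      using h by simp
    finally show ?thesis .
  qed
  then show ?thesis using h0(1) unfolding \<beta>_def by blast
qed

text \<open>Random rounding is unbiased. This gives the expected number of jumps of a coordinate in
  the Lipschitz estimate.\<close>

lemma
  fixes s :: real
  shows integral_floor: "(\<integral>\<theta>. indicator {0..<1} \<theta> * of_int \<lfloor>s + \<theta>\<rfloor> \<partial>lborel) = s" (is ?eq)
    and integrable_floor: "integrable lborel (\<lambda>\<theta>. indicator {0..<1} \<theta> * real_of_int \<lfloor>s + \<theta>\<rfloor>)" (is ?int)
proof -
  define t where "t = of_int \<lfloor>s\<rfloor> + 1 - s"
  have t: "0 < t" "t \<le> 1" unfolding t_def by linarith+
  have eq: "indicator {0..<1} \<theta> * real_of_int \<lfloor>s + \<theta>\<rfloor> =
      of_int \<lfloor>s\<rfloor> * indicator {0..<1} \<theta> + indicator {t..<1} \<theta>" for \<theta>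
  proof -
    have "\<lfloor>s + \<theta>\<rfloor> = (if \<theta> < t then \<lfloor>s\<rfloor> else \<lfloor>s\<rfloor> + 1)" if "\<theta> \<in> {0..<1}"
      using that unfolding t_def by (auto simp: floor_eq_iff) linarith+
    then show ?thesis using t by (auto split: split_indicator)
  qed
  have i: "integrable lborel (indicat_real {0..<1::real})" "integrable lborel (indicat_real {t..<1})"
  proof -
    have *: "integrable lborel (indicat_real {a..<b})" for a b :: real
      by (rule integrable_real_indicator[OF _ emeasure_lborel_Ico_finite]) simp
    show "integrable lborel (indicat_real {0..<1::real})" by (rule *)
    show "integrable lborel (indicat_real {t..<1})" by (rule *)
  qed
  show ?int unfolding eq using i by simp
  show ?eq unfolding eq using i t by (simp add: t_def)
qed

text \<open>The rounded points can differ only where the floors of coordinate i differ. There the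
  values differ by at most 2M, hence by at most 2M times the increment of the floor, whose mean is
  h.\<close>

lemma tent_sum_lipschitz:
  fixes y :: "real^'n" and b :: "real^'n \<Rightarrow> real"
  defines "L \<equiv> \<lambda>y. \<Sum>\<^sub>\<infinity>\<beta>\<in>grid 1. b \<beta> * tent (y - \<beta>)"
  assumes b: "\<And>\<beta>. \<beta> \<in> grid 1 \<Longrightarrow> \<bar>b \<beta>\<bar> \<le> M" and h: "0 \<le> h"
  shows "\<bar>L (y + h *\<^sub>R axis i 1) - L y\<bar> \<le> 2 * M * h"
proof -
  have rg: "round_shift y \<theta> \<in> grid 1" for y :: "real^'n" and \<theta>
    by (simp add: round_shift_def grid_1_iff)
  have M: "0 \<le> M" using b[OF rg] abs_ge_zero order_trans by blast
  let ?f = "\<lambda>\<theta>. indicator {0..<1} \<theta> * b (round_shift (y + h *\<^sub>R axis i 1) \<theta>) - indicator {0..<1} \<theta> * b (round_shift y \<theta>)"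
  let ?g = "\<lambda>\<theta>. 2 * M * (indicator {0..<1} \<theta> * real_of_int \<lfloor>(y $ i + h) + \<theta>\<rfloor> - indicator {0..<1} \<theta> * real_of_int \<lfloor>y $ i + \<theta>\<rfloor>)"
  have e: "L (y + h *\<^sub>R axis i 1) - L y = (\<integral>\<theta>. ?f \<theta> \<partial>lborel)"
    unfolding L_def tent_sum_eq_integral
    by (rule Bochner_Integration.integral_diff[symmetric]) (rule integrable_round_shift)+
  have 1: "\<bar>L (y + h *\<^sub>R axis i 1) - L y\<bar> \<le> (\<integral>\<theta>. \<bar>?f \<theta>\<bar> \<partial>lborel)"
    unfolding e by (rule integral_abs_bound)
  have 2: "(\<integral>\<theta>. \<bar>?f \<theta>\<bar> \<partial>lborel) \<le> (\<integral>\<theta>. ?g \<theta> \<partial>lborel)"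
  proof (rule integral_mono)
    show "integrable lborel (\<lambda>\<theta>. \<bar>?f \<theta>\<bar>)"
      by (intro integrable_abs Bochner_Integration.integrable_diff integrable_round_shift)
    show "integrable lborel ?g"
      by (intro integrable_mult_right Bochner_Integration.integrable_diff integrable_floor)
    fix \<theta>
    show "\<bar>?f \<theta>\<bar> \<le> ?g \<theta>"
    proof (cases "\<theta> \<in> {0..<1}")
      case True
      show ?thesis
      proof (cases "\<lfloor>(y $ i + h) + \<theta>\<rfloor> = \<lfloor>y $ i + \<theta>\<rfloor>")
        case eq: True
        then have "round_shift (y + h *\<^sub>R axis i 1) \<theta> = round_shift y \<theta>"
          unfolding round_shift_axis by (auto simp: round_shift_def vec_eq_iff)
        then show ?thesis by (simp add: eq)
      next
        case False
        moreover have "\<lfloor>y $ i + \<theta>\<rfloor> \<le> \<lfloor>(y $ i + h) + \<theta>\<rfloor>" using h by (intro floor_mono) simp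
        ultimately have "\<lfloor>y $ i + \<theta>\<rfloor> + 1 \<le> \<lfloor>(y $ i + h) + \<theta>\<rfloor>" by linarith
        then have "1 \<le> real_of_int \<lfloor>(y $ i + h) + \<theta>\<rfloor> - real_of_int \<lfloor>y $ i + \<theta>\<rfloor>" by linarith
        then have "2 * M * 1 \<le> 2 * M * (real_of_int \<lfloor>(y $ i + h) + \<theta>\<rfloor> - real_of_int \<lfloor>y $ i + \<theta>\<rfloor>)"
          using M by (intro mult_left_mono) auto
        moreover have "\<bar>b (round_shift (y + h *\<^sub>R axis i 1) \<theta>) - b (round_shift y \<theta>)\<bar> \<le> 2 * M"
          using b[OF rg, of "y + h *\<^sub>R axis i 1" \<theta>] b[OF rg, of y \<theta>] by linarith
        ultimately show ?thesis using True by simp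
      qed
    qed simp
  qed
  have 3: "(\<integral>\<theta>. ?g \<theta> \<partial>lborel) = 2 * M * ((y $ i + h) - y $ i)"
    using integrable_floor integral_floor by simp
  from order_trans[OF 1 2] show ?thesis unfolding 3 by simp
qed

section \<open>Interpolation on the scaled grid\<close>

definition tent_sum :: "real \<Rightarrow> (real^'n \<Rightarrow> real) \<Rightarrow> real^'n \<Rightarrow> real" where
  "tent_sum r a x = (\<Sum>\<^sub>\<infinity>\<alpha>\<in>grid r. a \<alpha> * scaled tent r \<alpha> x)"

lemma infsum_grid_scaled:
  assumes "0 < r"
  shows "(\<Sum>\<^sub>\<infinity>\<alpha>\<in>grid r. a \<alpha> * scaled \<phi> r \<alpha> x) = (\<Sum>\<^sub>\<infinity>\<beta>\<in>grid 1. a (r *\<^sub>R \<beta>) * \<phi> ((1 / r) *\<^sub>R x - \<beta>))"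
proof -
  have "(\<Sum>\<^sub>\<infinity>\<alpha>\<in>grid r. a \<alpha> * scaled \<phi> r \<alpha> x) = (\<Sum>\<^sub>\<infinity>\<beta>\<in>grid 1. a (r *\<^sub>R \<beta>) * scaled \<phi> r (r *\<^sub>R \<beta>) x)"
    using infsum_reindex_bij_betw[OF bij_betw_grid, of r "\<lambda>\<alpha>. a \<alpha> * scaled \<phi> r \<alpha> x"] assms by simp
  then show ?thesis using assms by (simp add: scaled_def scaleR_diff_right)
qed

lemma measurable_grid_sum:
  assumes "\<phi> \<in> primal" "0 < r"
  shows "(\<lambda>x. \<Sum>\<^sub>\<infinity>\<alpha>\<in>grid r. a \<alpha> * scaled \<phi> r \<alpha> x) \<in> borel_measurable borel"
proof (rule borel_measurable_infsum_finite_support[OF countable_grid])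
  have [measurable]: "\<phi> \<in> borel_measurable borel" using assms primalD by blast
  show "(\<lambda>x. a \<alpha> * scaled \<phi> r \<alpha> x) \<in> borel_measurable borel" for \<alpha> by measurable
  show "finite {\<alpha> \<in> grid r. a \<alpha> * scaled \<phi> r \<alpha> x \<noteq> 0}" for x
    by (rule finite_subset[OF _ finite_scaled_support[OF assms, of x]]) auto
qed

lemma grid_sum_bound:
  assumes "\<phi> \<in> primal" "0 < r" "\<And>\<alpha>. \<alpha> \<in> grid r \<Longrightarrow> \<bar>a \<alpha>\<bar> \<le> M"
  shows "\<bar>\<Sum>\<^sub>\<infinity>\<alpha>\<in>grid r. a \<alpha> * scaled \<phi> r \<alpha> x\<bar> \<le> M"
proof -
  have "(\<Sum>\<^sub>\<infinity>\<alpha>\<in>grid r. a \<alpha> * scaled \<phi> r \<alpha> x) = (\<Sum>\<alpha>\<in>near r x. a \<alpha> * scaled \<phi> r \<alpha> x)"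
    by (rule infsum_grid_eq_near) (use assms(2) scaled_zero[OF assms(1,2)] in auto)
  also have "\<bar>\<dots>\<bar> \<le> (\<Sum>\<alpha>\<in>near r x. \<bar>a \<alpha> * scaled \<phi> r \<alpha> x\<bar>)" by (rule sum_abs)
  also have "\<dots> \<le> (\<Sum>\<alpha>\<in>near r x. M * scaled \<phi> r \<alpha> x)"
  proof (rule sum_mono)
    fix \<alpha> assume "\<alpha> \<in> near r x"
    then have "\<bar>a \<alpha>\<bar> \<le> M" using near_subset_grid assms(3) by blast
    then show "\<bar>a \<alpha> * scaled \<phi> r \<alpha> x\<bar> \<le> M * scaled \<phi> r \<alpha> x"
      using scaled_bounds[OF assms(1), of r \<alpha> x] by (simp add: abs_mult mult_right_mono)
  qed
  also have "\<dots> = M" using sum_scaled[OF assms(1,2)] by (simp flip: sum_distrib_left)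
  finally show ?thesis .
qed

text \<open>After rescaling to mesh 1, the right derivative exists everywhere and is the slope along
  the edge selected by \<open>kuhn_edge\<close>; together with the Lipschitz bound this meets the
  difference quotient criterion.\<close>

lemma is_weak_pderiv_tent_sum:
  fixes a :: "real^'n \<Rightarrow> real"
  assumes r: "0 < r" and a: "\<And>\<alpha>. \<alpha> \<in> grid r \<Longrightarrow> \<bar>a \<alpha>\<bar> \<le> M"
  shows "is_weak_pderiv i (tent_sum r a)
    (\<lambda>x. \<Sum>\<^sub>\<infinity>\<alpha>\<in>grid r. ((a (\<alpha> + r *\<^sub>R axis i 1) - a \<alpha>) / r) * scaled (kuhn_edge i) r \<alpha> x)"
proof (rule weak_pderivI)
  show "tent_sum r a \<in> borel_measurable borel"
    unfolding tent_sum_def[abs_def] by (rule measurable_grid_sum[OF tent_primal r])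
  show "\<bar>tent_sum r a x\<bar> \<le> M" for x
    unfolding tent_sum_def by (rule grid_sum_bound[OF tent_primal r a])
  define b where "b \<beta> = a (r *\<^sub>R \<beta>)" for \<beta>
  define L where "L y = (\<Sum>\<^sub>\<infinity>\<beta>\<in>grid 1. b \<beta> * tent (y - \<beta>))" for y
  have tL: "tent_sum r a x = L ((1 / r) *\<^sub>R x)" for x
    unfolding tent_sum_def L_def b_def by (rule infsum_grid_scaled[OF r])
  have sh: "tent_sum r a (x + h *\<^sub>R axis i 1) = L ((1 / r) *\<^sub>R x + (h / r) *\<^sub>R axis i 1)" for x h
    unfolding tL by (simp add: scaleR_add_right)
  have bM: "\<bar>b \<beta>\<bar> \<le> M" if "\<beta> \<in> grid 1" for \<beta>
    unfolding b_def using bij_betwE[OF bij_betw_grid, of r] that r by (intro a) auto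
  show "\<bar>tent_sum r a (x + h *\<^sub>R axis i 1) - tent_sum r a x\<bar> \<le> (2 * M / r) * h" if "0 < h" for x h
    using tent_sum_lipschitz[of b M "h / r" "(1 / r) *\<^sub>R x" i, OF bM] that r
    unfolding sh unfolding tL L_def by simp
  fix x :: "real^'n" and h :: "nat \<Rightarrow> real"
  assume h: "filterlim h (at_right 0) sequentially"
  define y where "y = (1 / r) *\<^sub>R x"
  define v where "v = kuhn_vertex i y"
  obtain h0 where h0: "h0 > 0" "\<And>h. 0 < h \<Longrightarrow> h \<le> h0 \<Longrightarrow>
      L (y + h *\<^sub>R axis i 1) - L y = h * (b (v + axis i 1) - b v)"
    using tent_sum_right_difference[of b y i] unfolding L_def v_def by blast
  have w: "(\<Sum>\<^sub>\<infinity>\<alpha>\<in>grid r. ((a (\<alpha> + r *\<^sub>R axis i 1) - a \<alpha>) / r) * scaled (kuhn_edge i) r \<alpha> x) =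
      (b (v + axis i 1) - b v) / r"
    unfolding infsum_grid_scaled[OF r] sum_kuhn_edge by (simp add: b_def v_def y_def scaleR_add_right)
  have "\<forall>\<^sub>F n in sequentially. 0 < h n \<and> h n < h0 * r"
  proof (rule eventually_conj)
    have "h \<longlonglongrightarrow> 0" using h by (simp add: filterlim_at)
    from order_tendstoD(2)[OF this, of "h0 * r"] show "\<forall>\<^sub>F n in sequentially. h n < h0 * r"
      using h0(1) r by simp
    show "\<forall>\<^sub>F n in sequentially. 0 < h n"
      using h by (auto simp: filterlim_at elim: eventually_mono)
  qed
  \<comment> \<open>The interpolant is linear on a short segment to the right of \<open>x\<close>,
    so the quotients are eventually constant.\<close>
  then have "\<forall>\<^sub>F n in sequentially. (b (v + axis i 1) - b v) / r = (tent_sum r a (x + h n *\<^sub>R axis i 1) - tent_sum r a x) / h n"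
  proof eventually_elim
    case (elim n)
    then have "L (y + (h n / r) *\<^sub>R axis i 1) - L y = (h n / r) * (b (v + axis i 1) - b v)"
      using r by (intro h0(2)) (auto simp: field_simps)
    then show ?case unfolding sh tL[of x] using elim r by (simp add: y_def field_simps)
  qed
  then show "(\<lambda>n. (tent_sum r a (x + h n *\<^sub>R axis i 1) - tent_sum r a x) / h n) \<longlonglongrightarrow>
    (\<Sum>\<^sub>\<infinity>\<alpha>\<in>grid r. ((a (\<alpha> + r *\<^sub>R axis i 1) - a \<alpha>) / r) * scaled (kuhn_edge i) r \<alpha> x)"
    unfolding w by (rule Lim_transform_eventually[OF tendsto_const])
qed

section \<open>Norms and essential suprema\<close>

text \<open>For N = 0 a finite \<delta> forces A = 0, since A / 0 is infinite otherwise. The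
  excluded case is N = 0 with infinite \<delta>, where the quotient carries no information; this is
  the source of the degenerate fibres.\<close>

lemma ennreal_divide_leD:
  assumes "ennreal A / ennreal N \<le> \<delta>" "0 \<le> A" "0 \<le> N" "0 < N \<or> \<delta> < \<top>"
  shows "ennreal A \<le> \<delta> * ennreal N"
proof (cases "N = 0")
  case True
  with assms show ?thesis by (auto split: if_splits simp: top_unique)
next
  case False
  then have "ennreal A = ennreal A / ennreal N * ennreal N"
    using assms(2,3) by (simp add: divide_ennreal flip: ennreal_mult)
  then show ?thesis using assms(1) by (metis mult_right_mono zero_le)
qed

lemma ennreal_sqrt_mono: "a \<le> b \<Longrightarrow> ennreal_sqrt a \<le> ennreal_sqrt b"
  by (cases a; cases b) (auto simp: ennreal_sqrt_def top_unique)

lemma ennreal_sqrt_power2: "ennreal_sqrt (a\<^sup>2) = a"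
  by (cases a) (auto simp: ennreal_sqrt_def power2_eq_square simp flip: ennreal_mult)

lemma ennreal_sqrt_mult: "ennreal_sqrt (a * b) = ennreal_sqrt a * ennreal_sqrt b"
  by (cases a; cases b) (auto simp: ennreal_sqrt_def real_sqrt_mult ennreal_mult_top ennreal_top_mult ennreal_mult_eq_top_iff enn2real_mult ennreal_mult)

lemma ennreal_sqrt_ennreal: "0 \<le> x \<Longrightarrow> ennreal_sqrt (ennreal x) = ennreal (sqrt x)"
  by (simp add: ennreal_sqrt_def)

lemma nn_integral_mult_le_L2_norm:
  assumes "f \<in> borel_measurable M" "g \<in> borel_measurable M"
  shows "(\<integral>\<^sup>+x. f x * g x \<partial>M) \<le> L2_norm M f * L2_norm M g"
  using ennreal_sqrt_mono[OF Cauchy_Schwarz_nn_integral[OF assms]]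
  by (simp add: ennreal_sqrt_power2 ennreal_sqrt_mult L2_norm_def)

lemma L2_norm_one: "prob_space M \<Longrightarrow> L2_norm M (\<lambda>_. 1) = 1"
  by (simp add: L2_norm_def prob_space.emeasure_space_1 ennreal_sqrt_def)

text \<open>No measurability of \<open>\<delta>\<close> is available: the measurable function \<open>z\<close> is the least one that
  satisfies the pointwise bound, and it lies below \<open>\<delta>\<close>.\<close>

lemma nn_integral_le_L2_norms:
  fixes x \<epsilon> :: "'a \<Rightarrow> real" and a b :: real
  assumes M: "prob_space M"
    and [measurable]: "x \<in> borel_measurable M" "\<epsilon> \<in> borel_measurable M"
    and x: "\<And>s. 0 \<le> x s" and \<epsilon>: "\<And>s. 0 \<le> \<epsilon> s" and a: "0 \<le> a" and b: "0 \<le> b"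
    and le: "AE s in M. ennreal (x s) \<le> (ennreal a + ennreal b * \<delta> s) * ennreal (\<epsilon> s)"
  shows "(\<integral>\<^sup>+s. ennreal (x s) \<partial>M) \<le> (ennreal a + ennreal b * L2_norm M \<delta>) * L2_norm M (\<lambda>s. ennreal (\<epsilon> s))"
proof -
  define z where "z s = (if \<epsilon> s > 0 \<and> b > 0 then max 0 ((x s / \<epsilon> s - a) / b) else 0)" for s
  have [measurable]: "z \<in> borel_measurable M" unfolding z_def by measurable
  have z0: "0 \<le> z s" for s by (simp add: z_def)
  have xz: "x s \<le> (a + b * z s) * \<epsilon> s" and z\<delta>: "ennreal (z s) \<le> \<delta> s"
    if le: "ennreal (x s) \<le> (ennreal a + ennreal b * \<delta> s) * ennreal (\<epsilon> s)" for s
  proof -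
    show "x s \<le> (a + b * z s) * \<epsilon> s"
    proof (cases "\<epsilon> s > 0")
      case True
      show ?thesis
      proof (cases "b > 0")
        case bp: True
        have "x s / \<epsilon> s \<le> a + b * z s"
          using True bp by (auto simp: z_def max_def field_simps)
        then show ?thesis using True by (simp add: field_simps)
      next
        case False
        then have "b = 0" using b by simp
        with le have "ennreal (x s) \<le> ennreal (a * \<epsilon> s)" using a \<epsilon> by (simp add: ennreal_mult)
        then show ?thesis using \<open>b = 0\<close> a \<epsilon>[of s] by simp
      qed
    next
      case False
      then have "\<epsilon> s = 0" using \<epsilon>[of s] by simp
      with le have "ennreal (x s) \<le> 0" by simp
      then show ?thesis using x[of s] \<open>\<epsilon> s = 0\<close> by simp
    qed
    show "ennreal (z s) \<le> \<delta> s"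
    proof (cases "\<delta> s")
      case (real d)
      show ?thesis
      proof (cases "\<epsilon> s > 0 \<and> b > 0")
        case True
        have "ennreal (x s) \<le> ennreal ((a + b * d) * \<epsilon> s)"
          using le real a b \<epsilon>[of s] by (simp add: ennreal_mult ennreal_plus)
        then have "x s \<le> (a + b * d) * \<epsilon> s"
          using real a b \<epsilon>[of s] by simp
        then have "(x s / \<epsilon> s - a) / b \<le> d" using True by (simp add: field_simps)
        then show ?thesis using real by (simp add: z_def)
      qed (use real in \<open>auto simp: z_def\<close>)
    qed simp
  qed
  have "(\<integral>\<^sup>+s. ennreal (x s) \<partial>M) \<le> (\<integral>\<^sup>+s. ennreal a * (1 * ennreal (\<epsilon> s)) + ennreal b * (ennreal (z s) * ennreal (\<epsilon> s)) \<partial>M)"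
  proof (rule nn_integral_mono_AE)
    show "AE s in M. ennreal (x s) \<le> ennreal a * (1 * ennreal (\<epsilon> s)) + ennreal b * (ennreal (z s) * ennreal (\<epsilon> s))"
      using le
    proof eventually_elim
      case (elim s)
      have "ennreal (x s) \<le> ennreal (a * \<epsilon> s + b * (z s * \<epsilon> s))"
        using xz[OF elim] by (intro ennreal_leI) (simp add: algebra_simps)
      then show ?case
        using a b z0[of s] \<epsilon>[of s] by (simp add: ennreal_mult ennreal_plus)
    qed
  qed
  also have "\<dots> = ennreal a * (\<integral>\<^sup>+s. 1 * ennreal (\<epsilon> s) \<partial>M) + ennreal b * (\<integral>\<^sup>+s. ennreal (z s) * ennreal (\<epsilon> s) \<partial>M)"
    by (simp add: nn_integral_add nn_integral_cmult)
  also have "\<dots> \<le> ennreal a * (1 * L2_norm M (\<lambda>s. ennreal (\<epsilon> s))) + ennreal b * (L2_norm M \<delta> * L2_norm M (\<lambda>s. ennreal (\<epsilon> s)))"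
  proof (intro add_mono mult_left_mono)
    show "(\<integral>\<^sup>+s. 1 * ennreal (\<epsilon> s) \<partial>M) \<le> 1 * L2_norm M (\<lambda>s. ennreal (\<epsilon> s))"
      using nn_integral_mult_le_L2_norm[of "\<lambda>_. 1" M "\<lambda>s. ennreal (\<epsilon> s)"] L2_norm_one[OF M] by simp
    have "(\<integral>\<^sup>+s. (ennreal (z s))\<^sup>2 \<partial>M) \<le> (\<integral>\<^sup>+s. (\<delta> s)\<^sup>2 \<partial>M)"
      by (rule nn_integral_mono_AE) (use le in eventually_elim, intro power_mono z\<delta>, auto)
    then have "L2_norm M (\<lambda>s. ennreal (z s)) \<le> L2_norm M \<delta>"
      unfolding L2_norm_def by (rule ennreal_sqrt_mono)
    then have "L2_norm M (\<lambda>s. ennreal (z s)) * L2_norm M (\<lambda>s. ennreal (\<epsilon> s)) \<le> L2_norm M \<delta> * L2_norm M (\<lambda>s. ennreal (\<epsilon> s))"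
      by (rule mult_right_mono) simp
    then show "(\<integral>\<^sup>+s. ennreal (z s) * ennreal (\<epsilon> s) \<partial>M) \<le> L2_norm M \<delta> * L2_norm M (\<lambda>s. ennreal (\<epsilon> s))"
      by (rule order_trans[rotated]) (intro nn_integral_mult_le_L2_norm, measurable)
  qed auto
  also have "\<dots> = (ennreal a + ennreal b * L2_norm M \<delta>) * L2_norm M (\<lambda>s. ennreal (\<epsilon> s))"
    by (simp add: distrib_right mult.assoc)
  finally show ?thesis .
qed

text \<open>The infimum is attained: bounds that exceed it by arbitrarily little hold almost
  everywhere.\<close>

lemma AE_le_Linf_norm: "AE x in M. F x \<le> Linf_norm M F"
proof (rule AE_upper_bound_inf_ennreal)
  fix e :: real assume e: "e > 0"
  show "AE x in M. F x \<le> Linf_norm M F + ennreal e"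
  proof (cases "Linf_norm M F = \<top>")
    case False
    then have "Linf_norm M F < Linf_norm M F + ennreal e"
      using e by (cases "Linf_norm M F") (simp_all add: ennreal_less_iff flip: ennreal_plus)
    then obtain c where "c \<in> {c. AE x in M. F x \<le> c}" "c < Linf_norm M F + ennreal e"
      unfolding Linf_norm_def by (subst (asm) Inf_less_iff) auto
    then show ?thesis by (auto elim!: eventually_mono)
  qed simp
qed

section \<open>Averages and their differences\<close>

definition average :: "real \<Rightarrow> (real^'n \<Rightarrow> real) \<Rightarrow> (real^'n \<Rightarrow> real) \<Rightarrow> real^'n \<Rightarrow> real" where
  "average r \<eta> u \<alpha> = (1 / r ^ CARD('n)) * (\<integral>y. scaled \<eta> r \<alpha> y * u y \<partial>lborel)"

lemma I_op_eq_average: "I_op r \<phi> \<eta> w x = (\<Sum>\<^sub>\<infinity>\<alpha>\<in>grid r. average r \<eta> w \<alpha> * scaled \<phi> r \<alpha> x)"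
  by (simp add: I_op_def average_def)

lemma abs_average_le:
  fixes \<eta> u :: "real^'n \<Rightarrow> real"
  assumes "\<eta> \<in> primal" "0 < r" "u \<in> borel_measurable borel" "\<And>x. \<bar>u x\<bar> \<le> B"
  shows "\<bar>average r \<eta> u \<alpha>\<bar> \<le> B"
proof -
  have "\<bar>\<integral>y. scaled \<eta> r \<alpha> y * u y \<partial>lborel\<bar> \<le> (\<integral>y. \<bar>scaled \<eta> r \<alpha> y * u y\<bar> \<partial>lborel)"
    by (rule integral_abs_bound)
  also have "\<dots> \<le> (\<integral>y. B * scaled \<eta> r \<alpha> y \<partial>lborel)"
  proof (rule integral_mono)
    show "integrable lborel (\<lambda>y. \<bar>scaled \<eta> r \<alpha> y * u y\<bar>)" "integrable lborel (\<lambda>y. B * scaled \<eta> r \<alpha> y)"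
      using integrable_scaled_mult[OF assms] integral_scaled(2)[OF assms(1,2)] by auto
    show "\<bar>scaled \<eta> r \<alpha> y * u y\<bar> \<le> B * scaled \<eta> r \<alpha> y" for y
      using scaled_bounds[OF assms(1), of r \<alpha> y] mult_right_mono[OF assms(4)[of y], of "scaled \<eta> r \<alpha> y"]
      by (simp add: abs_mult mult.commute)
  qed
  also have "\<dots> = B * r ^ CARD('n)" using integral_scaled(1)[OF assms(1,2)] by simp
  finally show ?thesis using assms(2) by (simp add: average_def abs_mult field_simps)
qed

definition cell :: "(real \<Rightarrow> real) \<Rightarrow> real^'n \<Rightarrow> real" where
  "cell P = tensor (\<lambda>j. bump_of P)"

definition edge_cell :: "(real \<Rightarrow> real) \<Rightarrow> (real \<Rightarrow> real) \<Rightarrow> 'n \<Rightarrow> real^'n \<Rightarrow> real" where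
  "edge_cell P Q i = tensor (\<lambda>j. bump_of (if j = i then Q else P))"

lemma cell_primal: "transition P \<Longrightarrow> cell P \<in> primal"
  unfolding cell_def by (rule tensor_bump_primal)

lemma edge_cell_primal: "transition P \<Longrightarrow> transition Q \<Longrightarrow> edge_cell P Q i \<in> primal"
  unfolding edge_cell_def by (rule tensor_bump_primal) simp

lemma scaled_tensor: "scaled (tensor p) r \<alpha> = tensor (\<lambda>j t. p j ((1 / r) * t + (- \<alpha> $ j / r)))"
  by (simp add: scaled_def tensor_def fun_eq_iff diff_divide_distrib)

lemma scaled_tensor_bump_test_function:
  assumes "\<And>j. transition (P j)" "0 < r"
  shows "scaled (tensor (\<lambda>j. bump_of (P j))) r \<alpha> \<in> test_functions"
  unfolding scaled_tensor
proof (rule tensor_test_function)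
  show "smooth (\<lambda>t. bump_of (P j) ((1 / r) * t + (- \<alpha> $ j / r)))" for j
    by (rule smooth_affine[OF smooth_bump_of[OF assms(1)]])
  fix j t assume "t < (\<chi> j. \<alpha> $ j - r) $ j \<or> (\<chi> j. \<alpha> $ j + 2 * r) $ j < t"
  then have "(1 / r) * t + (- \<alpha> $ j / r) \<le> - 1 \<or> (1 / r) * t + (- \<alpha> $ j / r) \<ge> 2"
    using assms(2) by (auto simp: field_simps)
  then show "bump_of (P j) ((1 / r) * t + (- \<alpha> $ j / r)) = 0"
    by (rule bump_of_0[OF assms(1)])
qed

text \<open>The averaging functions are chosen such that \<open>edge_cell\<close> has the difference of two
  translates of \<open>cell\<close> as its derivative. Differences of averages of \<open>u\<close> are then averages of the
  weak derivative.\<close>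

lemma pderiv_edge_cell:
  assumes PQ: "transition P" "transition Q" "\<And>t. (Q has_real_derivative bump_of P t) (at t)" and r: "0 < r"
  shows "pderiv_at i (scaled (edge_cell P Q i) r \<alpha>) y =
    (scaled (cell P) r \<alpha> y - scaled (cell P) r (\<alpha> + r *\<^sub>R axis i 1) y) / r"
proof -
  define h where "h j t = bump_of (if j = i then Q else P) ((1 / r) * t + (- \<alpha> $ j / r))" for j t
  have sm: "smooth (h j)" for j
    unfolding h_def using PQ by (intro smooth_affine smooth_bump_of) simp
  have h: "scaled (edge_cell P Q i) r \<alpha> = tensor h"
    unfolding edge_cell_def scaled_tensor h_def ..
  have "(bump_of Q has_real_derivative bump_of P t - bump_of P (t - 1)) (at t)" for t
  proof -
    have "((\<lambda>t. Q (t - 1)) has_real_derivative bump_of P (t - 1) * 1) (at t)"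
      by (rule DERIV_chain'[where f = "\<lambda>x. x - 1" and g = Q, of 1 t UNIV]) (auto intro!: derivative_eq_intros PQ)
    then show ?thesis
      unfolding bump_of_def[of Q, abs_def] by (auto intro!: derivative_eq_intros PQ)
  qed
  note dQ = this
  have "((\<lambda>t. bump_of Q ((1 / r) * t + c)) has_real_derivative
      (bump_of P ((1 / r) * t + c) - bump_of P ((1 / r) * t + c - 1)) * (1 / r)) (at t)" for t c
    by (rule DERIV_chain'[where f = "\<lambda>t. (1 / r) * t + c" and g = "bump_of Q", of "1 / r" t UNIV])
       (use r in \<open>auto intro!: derivative_eq_intros dQ\<close>)
  from this[of "- \<alpha> $ i / r"]
  have "(h i has_real_derivative (bump_of P ((1 / r) * t + (- \<alpha> $ i / r)) - bump_of P ((1 / r) * t + (- \<alpha> $ i / r) - 1)) * (1 / r)) (at t)" for t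
    using r by (simp add: h_def[abs_def])
  then have dh: "deriv (h i) t = (bump_of P ((1 / r) * t + (- \<alpha> $ i / r)) - bump_of P ((1 / r) * t + (- \<alpha> $ i / r) - 1)) * (1 / r)" for t
    by (rule DERIV_imp_deriv)
  define R where "R = (\<Prod>j\<in>UNIV - {i}. bump_of P ((1 / r) * y $ j + (- \<alpha> $ j / r)))"
  have split: "tensor k y = k i (y $ i) * (\<Prod>j\<in>UNIV - {i}. k j (y $ j))" for k
    unfolding tensor_def by (rule prod.remove) auto
  have 1: "pderiv_at i (scaled (edge_cell P Q i) r \<alpha>) y = deriv (h i) (y $ i) * R"
    unfolding h pderiv_tensor[OF sm] split R_def by (auto simp: h_def intro!: prod.cong)
  have 2: "scaled (cell P) r \<alpha> y = bump_of P ((1 / r) * y $ i + (- \<alpha> $ i / r)) * R"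
    unfolding cell_def scaled_tensor split R_def ..
  have 3: "scaled (cell P) r (\<alpha> + r *\<^sub>R axis i 1) y = bump_of P ((1 / r) * y $ i + (- \<alpha> $ i / r) - 1) * R"
  proof -
    have "(1 / r) * y $ i + (- (\<alpha> + r *\<^sub>R axis i 1) $ i / r) = (1 / r) * y $ i + (- \<alpha> $ i / r) - 1"
      using r by (simp add: field_simps)
    moreover have "(\<Prod>j\<in>UNIV - {i}. bump_of P ((1 / r) * y $ j + (- (\<alpha> + r *\<^sub>R axis i 1) $ j / r))) = R"
      unfolding R_def by (intro prod.cong) (auto simp: axis_def)
    ultimately show ?thesis unfolding cell_def scaled_tensor split by (simp only:)
  qed
  show ?thesis unfolding 1 2 3 dh by (simp add: field_simps)
qed

text \<open>\<open>edge_cell\<close> is the test function in the defining identity of the weak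
  derivative. The minus sign of that identity turns the backward difference of cells into the
  forward difference of averages, and the scale r cancels.\<close>

lemma average_difference:
  fixes u w :: "real^'n \<Rightarrow> real"
  assumes PQ: "transition P" "transition Q" "\<And>t. (Q has_real_derivative bump_of P t) (at t)" and r: "0 < r"
    and w: "is_weak_pderiv i u w"
  shows "(average r (cell P) u (\<alpha> + r *\<^sub>R axis i 1) - average r (cell P) u \<alpha>) / r = average r (edge_cell P Q i) w \<alpha>"
proof -
  define \<psi> where "\<psi> = scaled (edge_cell P Q i) r \<alpha>"
  have \<psi>: "\<psi> \<in> test_functions"
    unfolding \<psi>_def edge_cell_def by (rule scaled_tensor_bump_test_function) (use PQ r in auto)
  have c: "scaled (cell P) r \<beta> \<in> test_functions" for \<beta> :: "real^'n"
    unfolding cell_def by (rule scaled_tensor_bump_test_function) (use PQ r in auto)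
  have lu: "locally_integrable u" using w by (simp add: is_weak_pderiv_def)
  have i: "integrable lborel (\<lambda>y. u y * scaled (cell P) r \<beta> y)" for \<beta>
    by (rule integrable_mult_compact_support[OF lu test_functionD(1,2)[OF c]])
  have "(\<integral>y. u y * scaled (cell P) r \<alpha> y \<partial>lborel) - (\<integral>y. u y * scaled (cell P) r (\<alpha> + r *\<^sub>R axis i 1) y \<partial>lborel) =
      (\<integral>y. r * (u y * pderiv_at i \<psi> y) \<partial>lborel)"
  proof -
    have "(\<lambda>y. r * (u y * pderiv_at i \<psi> y)) =
        (\<lambda>y. u y * scaled (cell P) r \<alpha> y - u y * scaled (cell P) r (\<alpha> + r *\<^sub>R axis i 1) y)"
      unfolding \<psi>_def pderiv_edge_cell[OF PQ r] using r by (auto simp: field_simps)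
    then show ?thesis using Bochner_Integration.integral_diff[OF i i] by simp
  qed
  also have "\<dots> = - r * (\<integral>y. w y * \<psi> y \<partial>lborel)"
    using w \<psi> by (simp add: is_weak_pderiv_def)
  finally have "(\<integral>y. u y * scaled (cell P) r (\<alpha> + r *\<^sub>R axis i 1) y \<partial>lborel) - (\<integral>y. u y * scaled (cell P) r \<alpha> y \<partial>lborel)
      = r * (\<integral>y. w y * \<psi> y \<partial>lborel)" by simp
  then show ?thesis
    using r unfolding average_def \<psi>_def by (simp add: mult.commute[of "scaled _ _ _ _"] field_simps)
qed

section \<open>Estimates in a single fibre\<close>

text \<open>\<open>energy\<close> uses a chosen representative; by uniqueness almost everywhere it
  can be computed with any other weak derivative.\<close>

lemma energy_eq:
  assumes "\<And>i. is_weak_pderiv i f (w i)" "\<And>i. is_weak_pderiv i f' (w' i)" and [measurable]: "\<rho> \<in> borel_measurable borel"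
  shows "energy \<rho> f f' = (\<Sum>i\<in>UNIV. \<integral>x. w i x * w' i x * \<rho> x \<partial>lborel)"
  unfolding energy_def
proof (rule sum.cong[OF refl])
  fix i
  have [measurable]: "w i \<in> borel_measurable borel" "w' i \<in> borel_measurable borel"
    "weak_pderiv i f \<in> borel_measurable borel" "weak_pderiv i f' \<in> borel_measurable borel"
    using assms(1,2)[of i] is_weak_pderiv_weak_pderiv[OF assms(1)[of i]] is_weak_pderiv_weak_pderiv[OF assms(2)[of i]]
    by (auto simp: is_weak_pderiv_def locally_integrable_def)
  show "(\<integral>x. weak_pderiv i f x * weak_pderiv i f' x * \<rho> x \<partial>lborel) = (\<integral>x. w i x * w' i x * \<rho> x \<partial>lborel)"
    by (rule integral_cong_AE)
       (use weak_pderiv_AE[OF assms(1)[of i]] weak_pderiv_AE[OF assms(2)[of i]] in \<open>auto elim: eventually_elim2\<close>)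
qed

definition tent_grad :: "real \<Rightarrow> (real^'n \<Rightarrow> real) \<Rightarrow> 'n \<Rightarrow> real^'n \<Rightarrow> real" where
  "tent_grad r a i x = (\<Sum>\<^sub>\<infinity>\<alpha>\<in>grid r. ((a (\<alpha> + r *\<^sub>R axis i 1) - a \<alpha>) / r) * scaled (kuhn_edge i) r \<alpha> x)"

definition grad_energy :: "real \<Rightarrow> (real^'n \<Rightarrow> real) \<Rightarrow> (real^'n \<Rightarrow> real) \<Rightarrow> real" where
  "grad_energy r h a = (\<Sum>i\<in>UNIV. \<integral>x. (tent_grad r a i x)\<^sup>2 * h x \<partial>lborel)"

lemma tent_sum_zero: "tent_sum r (\<lambda>_. 0) = (\<lambda>_. 0)"
  by (simp add: tent_sum_def fun_eq_iff)

lemma sup_norm_real: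
  assumes "\<And>x. \<bar>g x\<bar> \<le> B"
  shows "ennreal (enn2real (sup_norm g)) = sup_norm g" "\<bar>g x\<bar> \<le> enn2real (sup_norm g)"
proof -
  have "sup_norm g \<le> ennreal B"
    unfolding sup_norm_def by (intro SUP_least ennreal_leI assms)
  then show 1: "ennreal (enn2real (sup_norm g)) = sup_norm g"
    by (simp add: le_less_trans[of _ "ennreal B"])
  have "ennreal \<bar>g x\<bar> \<le> sup_norm g" unfolding sup_norm_def by (rule SUP_upper) simp
  then show "\<bar>g x\<bar> \<le> enn2real (sup_norm g)" by (subst (asm) 1[symmetric]) simp
qed

lemma osc_real:
  assumes "\<And>x. \<bar>g x\<bar> \<le> B"
  shows "ennreal (enn2real (osc r g)) = osc r g"
    "(\<And>j. \<bar>x $ j - y $ j\<bar> \<le> 4 * r) \<Longrightarrow> \<bar>g x - g y\<bar> \<le> enn2real (osc r g)"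
proof -
  have "\<bar>g x - g y\<bar> \<le> 2 * B" for x y using assms[of x] assms[of y] by linarith
  then have "osc r g \<le> ennreal (2 * B)"
    unfolding osc_def by (intro SUP_least) (auto intro: ennreal_leI)
  then show 1: "ennreal (enn2real (osc r g)) = osc r g"
    by (simp add: le_less_trans[of _ "ennreal (2 * B)"])
  assume "\<And>j. \<bar>x $ j - y $ j\<bar> \<le> 4 * r"
  then have "ennreal \<bar>g x - g y\<bar> \<le> osc r g"
    unfolding osc_def by (intro SUP_upper2[of "(x, y)"]) auto
  then show "\<bar>g x - g y\<bar> \<le> enn2real (osc r g)" by (subst (asm) 1[symmetric]) simp
qed

text \<open>All these norms and moduli are finite, so \<open>enn2real\<close> loses nothing and the
  estimates can be carried out with real numbers.\<close>

lemma Cc1_bounds: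
  assumes "g \<in> Cc1"
  shows "ennreal (enn2real (sup_norm g)) = sup_norm g" "\<And>x. \<bar>g x\<bar> \<le> enn2real (sup_norm g)"
    "ennreal (enn2real (osc r g)) = osc r g"
    "\<And>x y. (\<And>j. \<bar>x $ j - y $ j\<bar> \<le> 4 * r) \<Longrightarrow> \<bar>g x - g y\<bar> \<le> enn2real (osc r g)"
    "ennreal (enn2real (grad_sup_norm g)) = grad_sup_norm g"
    "\<And>i x. \<bar>pderiv_at i g x\<bar> \<le> enn2real (grad_sup_norm g)"
    "ennreal (enn2real (grad_osc r g)) = grad_osc r g"
    "\<And>i x y. (\<And>j. \<bar>x $ j - y $ j\<bar> \<le> 4 * r) \<Longrightarrow> \<bar>pderiv_at i g x - pderiv_at i g y\<bar> \<le> enn2real (grad_osc r g)"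
proof -
  obtain B where B: "\<And>x. \<bar>g x\<bar> \<le> B"
    using continuous_compact_support_bounded Cc1D(2,4)[OF assms] by metis
  have "\<exists>B. \<forall>x. \<bar>pderiv_at i g x\<bar> \<le> B" for i
    using continuous_compact_support_bounded Cc1D(3,5)[OF assms] by metis
  then obtain B' where B': "\<And>i x. \<bar>pderiv_at i g x\<bar> \<le> B' i" by metis
  show "ennreal (enn2real (sup_norm g)) = sup_norm g" "\<And>x. \<bar>g x\<bar> \<le> enn2real (sup_norm g)"
    using sup_norm_real[of g B] B by blast+
  show "ennreal (enn2real (osc r g)) = osc r g"
    "\<And>x y. (\<And>j. \<bar>x $ j - y $ j\<bar> \<le> 4 * r) \<Longrightarrow> \<bar>g x - g y\<bar> \<le> enn2real (osc r g)"
    using osc_real[of g B] B by blast+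
  have "grad_sup_norm g \<in> range (\<lambda>i. sup_norm (pderiv_at i g))"
    unfolding grad_sup_norm_def by (intro Max_in) auto
  then show 1: "ennreal (enn2real (grad_sup_norm g)) = grad_sup_norm g"
    using sup_norm_real(1)[OF B'] by auto
  have "grad_osc r g \<in> range (\<lambda>i. osc r (pderiv_at i g))"
    unfolding grad_osc_def by (intro Max_in) auto
  then show 2: "ennreal (enn2real (grad_osc r g)) = grad_osc r g"
    using osc_real(1)[OF B'] by auto
  fix i
  have "sup_norm (pderiv_at i g) \<le> grad_sup_norm g"
    unfolding grad_sup_norm_def by (intro Max_ge) auto
  then have **: "enn2real (sup_norm (pderiv_at i g)) \<le> enn2real (grad_sup_norm g)"
    by (subst (asm) 1[symmetric], subst (asm) sup_norm_real(1)[OF B', symmetric]) simp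
  then show "\<bar>pderiv_at i g x\<bar> \<le> enn2real (grad_sup_norm g)" for x
    using sup_norm_real(2)[of "pderiv_at i g" "B' i" x] B' ** by (meson order_trans)
  have "osc r (pderiv_at i g) \<le> grad_osc r g"
    unfolding grad_osc_def by (intro Max_ge) auto
  then have *: "enn2real (osc r (pderiv_at i g)) \<le> enn2real (grad_osc r g)"
    by (subst (asm) 2[symmetric], subst (asm) osc_real(1)[OF B', symmetric]) simp
  then show "\<bar>pderiv_at i g x - pderiv_at i g y\<bar> \<le> enn2real (grad_osc r g)"
    if "\<And>j. \<bar>x $ j - y $ j\<bar> \<le> 4 * r" for x y
  proof -
    have "\<bar>pderiv_at i g x - pderiv_at i g y\<bar> \<le> enn2real (osc r (pderiv_at i g))"
      by (rule osc_real(2)[of "pderiv_at i g" "B' i"]) (use B' that in blast)+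
    with * show ?thesis by linarith
  qed
qed

section \<open>Norms and constants in a fibre\<close>

text \<open>The data at a fixed s. The transitions are parameters, so that all fibres share the same
  averaging functions and the coefficients depend measurably on s.\<close>

locale fibre =
  fixes r :: real and \<rho> \<kappa> u g :: "real^'n \<Rightarrow> real" and P Q :: "real \<Rightarrow> real"
  assumes r: "0 < r" and measurable_\<rho>[measurable]: "\<rho> \<in> borel_measurable borel" and \<rho>0: "\<And>x. 0 \<le> \<rho> x"
    and prob: "prob_space (density_measure \<rho>)"
    and measurable_\<kappa>[measurable]: "\<kappa> \<in> borel_measurable borel" and \<kappa>: "\<And>x. 0 \<le> \<kappa> x \<and> \<kappa> x \<le> 1"
    and u: "u \<in> form_core" "\<And>x. \<bar>u x\<bar> \<le> 1" and g: "g \<in> Cc1"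
    and P: "transition P" and Q: "transition Q" and PQ: "\<And>t. (Q has_real_derivative bump_of P t) (at t)"
begin

definition "h x = \<kappa> x * \<rho> x"

definition "w i = (SOME w. is_weak_pderiv i u w \<and> w \<in> borel_measurable borel \<and> (\<exists>B. \<forall>x. \<bar>w x\<bar> \<le> B))"

lemma weak_w: "is_weak_pderiv i u (w i)" "w i \<in> borel_measurable borel" "\<exists>B. \<forall>x. \<bar>w i x\<bar> \<le> B"
proof -
  obtain w' B where "is_weak_pderiv i u w'" "\<And>x. \<bar>w' x\<bar> \<le> B" "w' \<in> borel_measurable borel"
    using form_core_bounded_weak_pderiv[OF u(1), of i] by blast
  then have "\<exists>w. is_weak_pderiv i u w \<and> w \<in> borel_measurable borel \<and> (\<exists>B. \<forall>x. \<bar>w x\<bar> \<le> B)" by blast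
  from someI_ex[OF this]
  show "is_weak_pderiv i u (w i)" "w i \<in> borel_measurable borel" "\<exists>B. \<forall>x. \<bar>w i x\<bar> \<le> B"
    unfolding w_def by blast+
qed

lemma measurable_u[measurable]: "u \<in> borel_measurable borel"
  using u(1) by (auto simp: form_core_def intro: borel_measurable_continuous_onI)

lemma measurable_h[measurable]: "h \<in> borel_measurable borel"
  unfolding h_def by measurable

lemma h_bounds: "0 \<le> h x" "h x \<le> \<rho> x"
  using \<kappa>[of x] \<rho>0[of x] by (auto simp: h_def mult_left_le_one_le)

lemma
  shows integrable_\<rho>: "integrable lborel \<rho>" and integral_\<rho>: "(\<integral>x. \<rho> x \<partial>lborel) = 1"
proof -
  have "(\<integral>\<^sup>+x. ennreal (\<rho> x) \<partial>lborel) = 1"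
    using prob_space.emeasure_space_1[OF prob] by (simp add: density_measure_def emeasure_density)
  then show "integrable lborel \<rho>" "(\<integral>x. \<rho> x \<partial>lborel) = 1"
    using \<rho>0 by (auto intro!: integrableI_nonneg simp: integral_eq_nn_integral)
qed

lemma integrable_h: "integrable lborel h"
  by (rule Bochner_Integration.integrable_bound[OF integrable_\<rho>]) (use h_bounds \<rho>0 in auto)

lemma integrable_bounded_mult:
  assumes [measurable]: "v \<in> borel_measurable borel" and v: "\<And>x. \<bar>v x\<bar> \<le> B"
  shows "integrable lborel (\<lambda>x. v x * \<rho> x)" "integrable lborel (\<lambda>x. v x * h x)"
proof -
  show 1: "integrable lborel (\<lambda>x. v x * \<rho> x)"
  proof (rule Bochner_Integration.integrable_bound[OF integrable_mult_right[OF integrable_\<rho>, of B]])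
    show "AE x in lborel. norm (v x * \<rho> x) \<le> norm (B * \<rho> x)"
      using v \<rho>0 order_trans[OF abs_ge_zero v] by (auto simp: abs_mult intro!: mult_right_mono)
  qed simp
  show "integrable lborel (\<lambda>x. v x * h x)"
  proof (rule Bochner_Integration.integrable_bound[OF 1])
    show "AE x in lborel. norm (v x * h x) \<le> norm (v x * \<rho> x)"
      using h_bounds \<rho>0 by (auto simp: abs_mult intro!: mult_left_mono)
  qed simp
qed

lemma abs_power2_le: "\<bar>v :: real\<bar> \<le> B \<Longrightarrow> \<bar>v\<^sup>2\<bar> \<le> B\<^sup>2"
  by (metis abs_ge_zero abs_power2 power2_abs power_mono)

definition "N v = sqrt (\<integral>x. (v x)\<^sup>2 * \<rho> x \<partial>lborel)"

lemma N_nonneg: "0 \<le> N v"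
  unfolding N_def using \<rho>0 by (auto intro!: integral_nonneg_AE)

lemma N_power2: "(N v)\<^sup>2 = (\<integral>x. (v x)\<^sup>2 * \<rho> x \<partial>lborel)"
  unfolding N_def using \<rho>0 by (auto intro!: integral_nonneg_AE real_sqrt_pow2)

lemma nn_integral_density_measure:
  assumes [measurable]: "v \<in> borel_measurable borel" and v: "\<And>x. \<bar>v x\<bar> \<le> B"
  shows "(\<integral>\<^sup>+x. ennreal \<bar>(v x)\<^sup>2\<bar> \<partial>density_measure \<rho>) = ennreal ((N v)\<^sup>2)"
proof -
  have "(\<integral>\<^sup>+x. ennreal \<bar>(v x)\<^sup>2\<bar> \<partial>density_measure \<rho>) = (\<integral>\<^sup>+x. ennreal (\<rho> x) * ennreal \<bar>(v x)\<^sup>2\<bar> \<partial>lborel)"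
    unfolding density_measure_def by (rule nn_integral_density) measurable
  also have "\<dots> = (\<integral>\<^sup>+x. ennreal ((v x)\<^sup>2 * \<rho> x) \<partial>lborel)"
    using \<rho>0 by (simp add: ennreal_mult mult.commute)
  also have "\<dots> = ennreal (\<integral>x. (v x)\<^sup>2 * \<rho> x \<partial>lborel)"
    using integrable_bounded_mult(1)[OF _ abs_power2_le[OF v]] \<rho>0 by (intro nn_integral_eq_integral) auto
  finally show ?thesis by (simp add: N_power2)
qed

lemma L2_norm_eq_N:
  assumes "v \<in> borel_measurable borel" "\<And>x. \<bar>v x\<bar> \<le> B"
  shows "L2_norm (density_measure \<rho>) (\<lambda>x. ennreal \<bar>v x\<bar>) = ennreal (N v)"
proof -
  have "(ennreal \<bar>v x\<bar>)\<^sup>2 = ennreal \<bar>(v x)\<^sup>2\<bar>" for x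
    by (simp add: ennreal_power)
  then have "L2_norm (density_measure \<rho>) (\<lambda>x. ennreal \<bar>v x\<bar>) = ennreal_sqrt (ennreal ((N v)\<^sup>2))"
    unfolding L2_norm_def by (simp only: nn_integral_density_measure[OF assms])
  then show ?thesis using N_nonneg by (simp add: ennreal_sqrt_ennreal)
qed

text \<open>\<rho> is a probability density, so the variance of |v| is nonnegative; moreover
  \<open>h\<close> lies below \<rho>.\<close>

lemma L1_le_N:
  assumes [measurable]: "v \<in> borel_measurable borel" and v: "\<And>x. \<bar>v x\<bar> \<le> B"
  shows "(\<integral>x. \<bar>v x\<bar> * h x \<partial>lborel) \<le> N v"
proof -
  have va: "\<bar>\<bar>v x\<bar>\<bar> \<le> B" for x using v by simp
  note i = integrable_bounded_mult[OF _ va] integrable_bounded_mult[OF _ abs_power2_le[OF v]]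
  define m where "m = (\<integral>x. \<bar>v x\<bar> * \<rho> x \<partial>lborel)"
  have "0 \<le> (\<integral>x. (\<bar>v x\<bar> - m)\<^sup>2 * \<rho> x \<partial>lborel)"
    using \<rho>0 by (intro integral_nonneg_AE) auto
  also have "\<dots> = (\<integral>x. (v x)\<^sup>2 * \<rho> x - (2 * m) * (\<bar>v x\<bar> * \<rho> x) + m\<^sup>2 * \<rho> x \<partial>lborel)"
    by (intro Bochner_Integration.integral_cong) (auto simp: power2_diff algebra_simps)
  also have "\<dots> = (N v)\<^sup>2 - (2 * m) * m + m\<^sup>2 * 1"
    using i integrable_\<rho> integral_\<rho> by (simp add: N_power2 m_def)
  finally have "m\<^sup>2 \<le> (N v)\<^sup>2"
    using power2_eq_square[of m] by linarith
  then have "m \<le> N v"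
    by (rule power2_le_imp_le[OF _ N_nonneg])
  moreover have "(\<integral>x. \<bar>v x\<bar> * h x \<partial>lborel) \<le> m"
    unfolding m_def using i h_bounds by (intro integral_mono mult_left_mono) auto
  ultimately show ?thesis by simp
qed

abbreviation "\<delta> \<equiv> delta_const r \<kappa> \<rho>"
abbreviation "C \<equiv> C_const r \<kappa> \<rho>"

lemma averaging_kernelI:
  assumes "\<phi> \<in> primal" "\<eta> \<in> primal" "v \<in> borel_measurable borel" "\<And>x. \<bar>v x\<bar> \<le> B"
  shows "averaging_kernel r \<phi> \<eta> h v B"
  using assms r integrable_h h_bounds by unfold_locales auto

text \<open>The supremum is tested at |v|. The quotient is kept because \<open>N v\<close> may be
  0.\<close>

lemma delta_bound:
  assumes "\<phi> \<in> primal" "\<eta> \<in> primal" and v: "v \<in> borel_measurable borel" "\<And>x. \<bar>v x\<bar> \<le> B"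
  shows "ennreal (\<integral>y. \<bar>v y\<bar> * R_op r \<eta> \<phi> h y \<partial>lborel) / ennreal (N v) \<le> \<delta>"
proof -
  interpret averaging_kernel r \<phi> \<eta> h v B by (rule averaging_kernelI[OF assms])
  have "(\<lambda>x. \<bar>v x\<bar>) \<in> bounded_measurable"
    using v by (auto simp: bounded_measurable_def bounded_iff)
  then have "ennreal \<bar>\<integral>x. \<bar>v x\<bar> * R_op r \<eta> \<phi> (\<lambda>x. \<kappa> x * \<rho> x) x \<partial>lborel\<bar>
       / L2_norm (density_measure \<rho>) (\<lambda>x. ennreal \<bar>\<bar>v x\<bar>\<bar>) \<le> \<delta>"
    unfolding delta_const_def by (rule SUP_upper2[OF assms(2) SUP_upper2[OF assms(1) SUP_upper]])
  moreover have "0 \<le> (\<integral>y. \<bar>v y\<bar> * R_op r \<eta> \<phi> h y \<partial>lborel)"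
    using R_h_nonneg by (intro integral_nonneg_AE) auto
  ultimately show ?thesis
    using L2_norm_eq_N[OF v] by (simp add: h_def[abs_def])
qed

text \<open>Tested at v^2, whose L^1 norm is the square of \<open>N v\<close>.\<close>

lemma C_bound:
  assumes "\<phi> \<in> primal" "\<eta> \<in> primal" and v: "v \<in> borel_measurable borel" "\<And>x. \<bar>v x\<bar> \<le> B"
  shows "ennreal (\<integral>y. (v y)\<^sup>2 * I_op r \<eta> \<phi> h y \<partial>lborel) / ennreal ((N v)\<^sup>2) \<le> C"
proof -
  interpret averaging_kernel r \<phi> \<eta> h v B by (rule averaging_kernelI[OF assms])
  have "(\<lambda>x. (v x)\<^sup>2) \<in> bounded_measurable"
    using v abs_power2_le[OF v(2)] by (auto simp: bounded_measurable_def bounded_iff)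
  then have "ennreal \<bar>\<integral>x. (v x)\<^sup>2 * I_op r \<eta> \<phi> (\<lambda>x. \<kappa> x * \<rho> x) x \<partial>lborel\<bar>
       / (\<integral>\<^sup>+ x. ennreal \<bar>(v x)\<^sup>2\<bar> \<partial>density_measure \<rho>) \<le> C"
    unfolding C_const_def by (rule SUP_upper2[OF assms(2) SUP_upper2[OF assms(1) SUP_upper]])
  moreover have "0 \<le> (\<integral>y. (v y)\<^sup>2 * I_op r \<eta> \<phi> h y \<partial>lborel)"
    using I_h_nonneg by (intro integral_nonneg_AE) auto
  ultimately show ?thesis
    unfolding nn_integral_density_measure[OF v] by (simp add: h_def[abs_def])
qed

section \<open>The interpolant in a fibre\<close>

definition "c = average r (cell P) u"
definition "e = energy \<rho> u u"
definition "A i = (\<integral>y. \<bar>w i y\<bar> * R_op r (edge_cell P Q i) (kuhn_edge i) h y \<partial>lborel)"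
text \<open>The condition is phrased with two energies, which depend measurably on s, instead of
  with the value of \<delta>; thus the modified coefficients remain measurable.\<close>

definition "degenerate \<longleftrightarrow> e = 0 \<and> grad_energy r h c \<noteq> 0"
definition "lam = tent_sum r (\<lambda>\<alpha>. if degenerate then 0 else c \<alpha>)"

lemma c_bound: "\<bar>c \<alpha>\<bar> \<le> 1"
  unfolding c_def by (rule abs_average_le[OF cell_primal[OF P] r]) (use u in auto)

text \<open>The gradient of the interpolant is an interpolation of the gradient, but with a pair of
  primal functions that depends on i. This is why \<delta> and C contain a supremum over all
  pairs.\<close>

lemma tent_grad_eq: "tent_grad r c i = I_op r (kuhn_edge i) (edge_cell P Q i) (w i)"
  unfolding tent_grad_def[abs_def] I_op_eq_average[abs_def] c_def average_difference[OF P Q PQ r weak_w(1)] ..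

lemma weak_pderiv_lam: "\<not> degenerate \<Longrightarrow> is_weak_pderiv i lam (tent_grad r c i)"
  unfolding lam_def tent_grad_def[abs_def] using is_weak_pderiv_tent_sum[OF r c_bound, of i] by simp

lemma weak_pderiv_zero: "is_weak_pderiv i (\<lambda>_. 0) (\<lambda>_. 0 :: real)"
  by (rule weak_pderivI[where M = 0 and L = 0]) auto

lemma lam_degenerate: "degenerate \<Longrightarrow> lam = (\<lambda>_. 0)"
  by (simp add: lam_def tent_sum_zero)

lemma e_eq: "e = (\<Sum>i\<in>UNIV. (N (w i))\<^sup>2)"
  unfolding e_def N_power2 using energy_eq[OF weak_w(1) weak_w(1) measurable_\<rho>] by (simp add: power2_eq_square)

lemma e_nonneg: "0 \<le> e" unfolding e_eq by (intro sum_nonneg) auto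

lemma e_zero: "e = 0 \<Longrightarrow> N (w i) = 0"
  unfolding e_eq by (subst (asm) sum_nonneg_eq_0_iff) auto

lemma w_averaging:
  obtains B where "averaging_kernel r (kuhn_edge i) (edge_cell P Q i) h (w i) B" "\<And>x. \<bar>w i x\<bar> \<le> B"
  using weak_w(3)[of i] averaging_kernelI[OF kuhn_edge_primal edge_cell_primal[OF P Q] weak_w(2)] by blast

lemma A_nonneg: "0 \<le> A i"
proof -
  obtain B where "averaging_kernel r (kuhn_edge i) (edge_cell P Q i) h (w i) B" using w_averaging[of i] by blast
  then interpret averaging_kernel r "kuhn_edge i" "edge_cell P Q i" h "w i" B .
  show ?thesis unfolding A_def using R_h_nonneg by (intro integral_nonneg_AE) auto
qed

lemma A_delta: "ennreal (A i) / ennreal (N (w i)) \<le> \<delta>"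
proof -
  obtain B where "\<And>x. \<bar>w i x\<bar> \<le> B" using w_averaging[of i] by blast
  then show ?thesis
    unfolding A_def by (rule delta_bound[OF kuhn_edge_primal edge_cell_primal[OF P Q] weak_w(2)])
qed

lemma measurable_w[measurable]: "w i \<in> borel_measurable borel" by (rule weak_w(2))

lemma measurable_tent_grad[measurable]: "tent_grad r c i \<in> borel_measurable borel"
  unfolding tent_grad_def[abs_def] by (rule measurable_grid_sum[OF kuhn_edge_primal r])

lemma tent_grad_bound: "\<exists>B. \<forall>x. \<bar>tent_grad r c i x\<bar> \<le> B"
proof -
  obtain B where "averaging_kernel r (kuhn_edge i) (edge_cell P Q i) h (w i) B" using w_averaging[of i] by blast
  then interpret averaging_kernel r "kuhn_edge i" "edge_cell P Q i" h "w i" B .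
  show ?thesis unfolding tent_grad_eq using I_w_bound by blast
qed

text \<open>If \<delta> were finite, then \<open>N (w i) = 0\<close> would force
  \<open>A i = 0\<close>, and \<open>interpolation_zero\<close> would make the gradient of the
  interpolant vanish where \<open>h\<close> is positive. Resetting the coefficients therefore costs
  nothing in the bound for the values.\<close>

lemma degenerate_delta:
  assumes degenerate
  shows "\<delta> = \<top>"
proof (rule ccontr)
  assume "\<delta> \<noteq> \<top>"
  then have \<delta>: "\<delta> < \<top>" by (simp add: less_top)
  have e0: "e = 0" using assms by (simp add: degenerate_def)
  have "(\<integral>x. (tent_grad r c i x)\<^sup>2 * h x \<partial>lborel) = 0" for i
  proof -
    obtain B where B: "averaging_kernel r (kuhn_edge i) (edge_cell P Q i) h (w i) B" "\<And>x. \<bar>w i x\<bar> \<le> B"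
      using w_averaging[of i] by blast
    then interpret averaging_kernel r "kuhn_edge i" "edge_cell P Q i" h "w i" B by simp
    have "A i = 0"
      using ennreal_divide_leD[OF A_delta A_nonneg N_nonneg, of i] \<delta> e_zero[OF e0] A_nonneg[of i] by simp
    moreover have "(\<integral>y. \<bar>w i y\<bar> * h y \<partial>lborel) = 0"
      using L1_le_N[OF weak_w(2) B(2)] e_zero[OF e0, of i] h_bounds
      by (intro antisym integral_nonneg_AE) auto
    ultimately have z: "AE x in lborel. tent_grad r c i x * h x = 0"
      using interpolation_zero unfolding A_def tent_grad_eq by blast
    have "(\<integral>x. (tent_grad r c i x)\<^sup>2 * h x \<partial>lborel) = (\<integral>x. 0 \<partial>(lborel :: (real^'n) measure))"
      by (rule integral_cong_AE) (use z in \<open>auto elim!: eventually_mono\<close>)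
    then show ?thesis by simp
  qed
  then have "grad_energy r h c = 0" by (simp add: grad_energy_def)
  with assms show False by (simp add: degenerate_def)
qed

section \<open>The three estimates in a fibre\<close>

lemma fibre_value:
  "ennreal \<bar>\<integral>x. g x * (u x - lam x) * h x \<partial>lborel\<bar> \<le> osc r g + sup_norm g * \<delta>"
proof -
  note b = Cc1_bounds[OF g]
  define D where "D = enn2real (sup_norm g)"
  define \<omega> where "\<omega> = enn2real (osc r g)"
  have D: "0 \<le> D" "ennreal D = sup_norm g" "\<And>x. \<bar>g x\<bar> \<le> D" using b(1,2) by (simp_all add: D_def)
  have \<omega>: "0 \<le> \<omega>" "ennreal \<omega> = osc r g" using b(3) by (simp_all add: \<omega>_def)
  have [measurable]: "g \<in> borel_measurable borel"
    using Cc1D(2)[OF g] by (rule borel_measurable_continuous_onI)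
  show ?thesis
  \<comment> \<open>With infinite \<delta> the right side is infinite, unless g = 0 and the left
    side vanishes. This disposes of the degenerate fibres too.\<close>
  proof (cases "\<delta> = \<top>")
    case True
    show ?thesis
    proof (cases "D = 0")
      case True
      then have "g = (\<lambda>_. 0)" using D(3) by (auto simp: fun_eq_iff)
      then show ?thesis by simp
    next
      case False
      then have "sup_norm g \<noteq> 0" unfolding D(2)[symmetric] using D(1) by simp
      then have "sup_norm g * \<delta> = \<top>" using True by (simp add: ennreal_mult_top)
      then show ?thesis by simp
    qed
  next
    case False
    then have nd: "\<not> degenerate" using degenerate_delta by blast
    interpret averaging_kernel r tent "cell P" h u 1
      by (rule averaging_kernelI[OF tent_primal cell_primal[OF P]]) (use u in auto)
    have lam: "lam x = I_op r tent (cell P) u x" for x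
      using nd by (simp add: lam_def tent_sum_def I_op_eq_average c_def)
    define a where "a = (\<integral>y. \<bar>u y\<bar> * R_op r (cell P) tent h y \<partial>lborel)"
    have a0: "0 \<le> a" unfolding a_def using R_h_nonneg by (intro integral_nonneg_AE) auto
    \<comment> \<open>Since |u| is at most 1 and \<rho> is a probability density; this is why no
      norm of \<open>u\<close> appears in the bound.\<close>
    have N1: "N u \<le> 1"
    proof -
      have "(\<integral>x. (u x)\<^sup>2 * \<rho> x \<partial>lborel) \<le> (\<integral>x. 1 * \<rho> x \<partial>lborel)"
        using integrable_bounded_mult(1)[OF _ abs_power2_le[OF u(2)]] integrable_\<rho> \<rho>0 abs_power2_le[OF u(2)]
        by (intro integral_mono mult_right_mono) auto
      then show ?thesis using integral_\<rho> by (simp add: N_def)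
    qed
    have "ennreal a \<le> \<delta> * ennreal (N u)"
      unfolding a_def
      by (rule ennreal_divide_leD[OF delta_bound[OF tent_primal cell_primal[OF P] measurable_u u(2)]])
         (use a0 False N_nonneg in \<open>auto simp: a_def less_top\<close>)
    also have "\<dots> \<le> \<delta> * 1" using N1 by (intro mult_left_mono) auto
    finally have a\<delta>: "ennreal a \<le> \<delta>" by simp
    have "\<bar>\<integral>x. g x * (u x - lam x) * h x \<partial>lborel\<bar> \<le> \<omega> * (\<integral>y. \<bar>u y\<bar> * h y \<partial>lborel) + D * a"
      unfolding lam a_def \<omega>_def by (rule interpolation_error) (use D b(4) in auto)
    also have "\<dots> \<le> \<omega> * 1 + D * a"
      using L1_le_N[OF measurable_u u(2)] N1 \<omega> D a0 by (intro add_mono mult_left_mono) auto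
    finally have "ennreal \<bar>\<integral>x. g x * (u x - lam x) * h x \<partial>lborel\<bar> \<le> ennreal (\<omega> + D * a)"
      by (intro ennreal_leI) simp
    also have "\<dots> = osc r g + sup_norm g * ennreal a"
      using D \<omega> a0 by (simp add: ennreal_plus ennreal_mult)
    also have "\<dots> \<le> osc r g + sup_norm g * \<delta>"
      using a\<delta> by (intro add_left_mono mult_left_mono) auto
    finally show ?thesis .
  qed
qed

lemma energy_g_lam:
  assumes "\<not> degenerate"
  shows "energy h g (\<lambda>x. u x - lam x) = (\<Sum>i\<in>UNIV. \<integral>x. pderiv_at i g x * (w i x - tent_grad r c i x) * h x \<partial>lborel)"
  by (rule energy_eq[OF is_weak_pderiv_Cc1[OF g] is_weak_pderiv_diff[OF weak_w(1) weak_pderiv_lam[OF assms]]]) simp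

lemma energy_g_u: "energy h g u = (\<Sum>i\<in>UNIV. \<integral>x. pderiv_at i g x * w i x * h x \<partial>lborel)"
  by (rule energy_eq[OF is_weak_pderiv_Cc1[OF g] weak_w(1)]) simp

lemma AE_zero_of_N_zero:
  assumes [measurable]: "v \<in> borel_measurable borel" and v: "\<And>x. \<bar>v x\<bar> \<le> B" and "N v = 0"
  shows "AE x in lborel. v x * h x = 0"
proof -
  have "(\<integral>x. (v x)\<^sup>2 * \<rho> x \<partial>lborel) = 0"
    using assms(3) N_power2[of v] by simp
  then have "AE x in lborel. (v x)\<^sup>2 * \<rho> x = 0"
    using integrable_bounded_mult(1)[OF _ abs_power2_le[OF v]] \<rho>0
    by (subst (asm) integral_nonneg_eq_0_iff_AE) auto
  then show ?thesis by (auto simp: h_def elim!: eventually_mono)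
qed

lemma AE_w_zero:
  assumes "e = 0"
  shows "AE x in lborel. w i x * h x = 0"
proof -
  obtain B where "\<And>x. \<bar>w i x\<bar> \<le> B" using weak_w(3) by blast
  then show ?thesis by (rule AE_zero_of_N_zero[OF weak_w(2) _ e_zero[OF assms]])
qed

lemma AE_tent_grad_zero:
  assumes "grad_energy r h c = 0"
  shows "AE x in lborel. tent_grad r c i x * h x = 0"
proof -
  have "(\<integral>x. (tent_grad r c i x)\<^sup>2 * h x \<partial>lborel) = 0"
    using assms h_bounds unfolding grad_energy_def
    by (subst (asm) sum_nonneg_eq_0_iff) (auto intro!: integral_nonneg_AE)
  moreover obtain B where "\<And>x. \<bar>tent_grad r c i x\<bar> \<le> B" using tent_grad_bound by blast
  note integrable_bounded_mult(2)[OF _ abs_power2_le[OF this]]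
  ultimately have "AE x in lborel. (tent_grad r c i x)\<^sup>2 * h x = 0"
    using h_bounds by (subst (asm) integral_nonneg_eq_0_iff_AE) auto
  then show ?thesis by (auto elim!: eventually_mono)
qed

lemma fibre_gradient:
  "ennreal \<bar>energy h g (\<lambda>x. u x - lam x)\<bar> \<le>
    (ennreal (sqrt CARD('n) * enn2real (grad_osc r g)) + ennreal (sqrt CARD('n) * enn2real (grad_sup_norm g)) * \<delta>) * ennreal (sqrt e)"
proof -
  note b = Cc1_bounds[OF g]
  define D where "D = enn2real (grad_sup_norm g)"
  define \<omega> where "\<omega> = enn2real (grad_osc r g)"
  have D: "0 \<le> D" "\<And>i x. \<bar>pderiv_at i g x\<bar> \<le> D" using b(6) by (simp_all add: D_def)
  have \<omega>: "0 \<le> \<omega>" by (simp add: \<omega>_def)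
  have [measurable]: "pderiv_at i g \<in> borel_measurable borel" for i
    using Cc1D(3)[OF g] by (rule borel_measurable_continuous_onI)
  \<comment> \<open>For e = 0 the right side is 0 even if \<delta> is infinite, so the left side has
    to vanish: either the interpolant was reset to 0, or its gradient is null with respect to
    \<open>h\<close>. For e > 0 the bound is trivial if \<delta> is infinite and D is positive; the
    kernel estimate is used in the last case.\<close>
  consider "degenerate" | "\<not> degenerate" "e = 0" | "\<not> degenerate" "e > 0" "\<delta> = \<top>" "D > 0"
    | "\<not> degenerate" "e > 0" "\<delta> < \<top> \<or> D = 0"
    using e_nonneg D(1) by (fastforce simp: less_top)
  then show ?thesis
  proof cases
    case 1
    then have "e = 0" by (simp add: degenerate_def)
    have "(\<integral>x. pderiv_at i g x * w i x * h x \<partial>lborel) = (\<integral>x. 0 \<partial>(lborel :: (real^'n) measure))" for i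
      by (rule integral_cong_AE) (use AE_w_zero[OF \<open>e = 0\<close>, of i] in \<open>auto elim: eventually_mono\<close>)
    then have "energy h g (\<lambda>x. u x - lam x) = 0"
      using energy_g_u by (simp add: lam_degenerate[OF 1])
    then show ?thesis by simp
  next
    case 2
    then have "grad_energy r h c = 0" by (simp add: degenerate_def)
    have "(\<integral>x. pderiv_at i g x * (w i x - tent_grad r c i x) * h x \<partial>lborel) = (\<integral>x. 0 \<partial>(lborel :: (real^'n) measure))" for i
    proof (intro integral_cong_AE)
      show "AE x in lborel. pderiv_at i g x * (w i x - tent_grad r c i x) * h x = 0"
        using AE_w_zero[OF 2(2), of i] AE_tent_grad_zero[OF \<open>grad_energy r h c = 0\<close>, of i]
        by eventually_elim auto
    qed auto
    then have "energy h g (\<lambda>x. u x - lam x) = 0"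
      unfolding energy_g_lam[OF 2(1)] by simp
    then show ?thesis by simp
  next
    case 3
    then have "ennreal (sqrt CARD('n) * D) * \<delta> = \<top>" by (simp add: ennreal_mult_top)
    then have "(ennreal (sqrt CARD('n) * \<omega>) + ennreal (sqrt CARD('n) * D) * \<delta>) * ennreal (sqrt e) = \<top>"
      using 3 by (simp add: ennreal_top_mult)
    then show ?thesis by (simp add: D_def \<omega>_def)
  next
    case 4
    \<comment> \<open>The default 0 for infinite \<delta> is harmless, because D = 0 in that
      case.\<close>
    define d where "d = (if \<delta> < \<top> then enn2real \<delta> else 0)"
    have d0: "0 \<le> d" by (simp add: d_def)
    have d\<delta>: "ennreal d \<le> \<delta>" by (auto simp: d_def less_top)
    have Ad: "D * A i \<le> D * (d * N (w i))" for i
    proof (cases "\<delta> < \<top>")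
      case True
      then have "ennreal (A i) \<le> \<delta> * ennreal (N (w i))"
        by (intro ennreal_divide_leD A_delta A_nonneg N_nonneg) auto
      also have "\<dots> = ennreal (d * N (w i))"
        using True N_nonneg by (simp add: d_def ennreal_mult)
      finally have "A i \<le> d * N (w i)" using d0 N_nonneg by (simp add: ennreal_le_iff)
      then show ?thesis using D(1) by (rule mult_left_mono)
    qed (use 4 in auto)
    have summand: "\<bar>\<integral>x. pderiv_at i g x * (w i x - tent_grad r c i x) * h x \<partial>lborel\<bar> \<le> (\<omega> + D * d) * N (w i)" for i
    proof -
      obtain B where B: "averaging_kernel r (kuhn_edge i) (edge_cell P Q i) h (w i) B" "\<And>x. \<bar>w i x\<bar> \<le> B"
        using w_averaging[of i] by blast
      then interpret averaging_kernel r "kuhn_edge i" "edge_cell P Q i" h "w i" B by simp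
      have "\<bar>\<integral>x. pderiv_at i g x * (w i x - tent_grad r c i x) * h x \<partial>lborel\<bar>
          \<le> \<omega> * (\<integral>y. \<bar>w i y\<bar> * h y \<partial>lborel) + D * A i"
        unfolding tent_grad_eq A_def \<omega>_def by (rule interpolation_error) (use D b(8) in auto)
      also have "\<dots> \<le> \<omega> * N (w i) + D * (d * N (w i))"
        by (intro add_mono mult_left_mono[OF L1_le_N[OF weak_w(2) B(2)]] \<omega> Ad)
      finally show ?thesis by (simp add: algebra_simps)
    qed
    \<comment> \<open>Cauchy-Schwarz over the d directions produces the factor sqrt d.\<close>
    have "(\<Sum>i\<in>UNIV. N (w i)) \<le> sqrt (CARD('n) * e)"
      using sum_squared_le_sum_of_squares[of "\<lambda>i. N (w i)" "UNIV :: 'n set"]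
      by (intro real_le_rsqrt) (simp add: e_eq mult.commute)
    then have sN: "(\<Sum>i\<in>UNIV. N (w i)) \<le> sqrt CARD('n) * sqrt e" by (simp add: real_sqrt_mult)
    have "\<bar>energy h g (\<lambda>x. u x - lam x)\<bar> \<le> (\<Sum>i\<in>UNIV. (\<omega> + D * d) * N (w i))"
      unfolding energy_g_lam[OF 4(1)] by (rule order_trans[OF sum_abs sum_mono[OF summand]])
    also have "\<dots> \<le> (\<omega> + D * d) * (sqrt CARD('n) * sqrt e)"
      unfolding sum_distrib_left[symmetric] using sN \<omega> D d0 by (intro mult_left_mono) auto
    finally have "ennreal \<bar>energy h g (\<lambda>x. u x - lam x)\<bar> \<le>
        ennreal ((sqrt CARD('n) * \<omega> + sqrt CARD('n) * D * d) * sqrt e)"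
      by (intro ennreal_leI) (simp add: algebra_simps)
    also have "\<dots> = (ennreal (sqrt CARD('n) * \<omega>) + ennreal (sqrt CARD('n) * D) * ennreal d) * ennreal (sqrt e)"
      using \<omega> D d0 e_nonneg by (simp add: ennreal_mult ennreal_plus)
    also have "\<dots> \<le> (ennreal (sqrt CARD('n) * \<omega>) + ennreal (sqrt CARD('n) * D) * \<delta>) * ennreal (sqrt e)"
      using d\<delta> by (intro mult_right_mono add_left_mono mult_left_mono) auto
    finally show ?thesis by (simp add: D_def \<omega>_def)
  qed
qed

text \<open>For e = 0 the right side is 0 even if C is infinite. This is where the reset of the
  coefficients is indispensable: either the fibre is degenerate and the interpolant is 0, or its
  energy vanishes by the definition of \<open>degenerate\<close>.\<close>

lemma fibre_energy: "ennreal (energy h lam lam) \<le> C * ennreal e"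
proof -
  have "energy h (\<lambda>_. 0) (\<lambda>_. 0 :: real) = 0"
    using energy_eq[OF weak_pderiv_zero weak_pderiv_zero measurable_h] by simp
  moreover have E: "energy h lam lam = grad_energy r h c" if "\<not> degenerate"
    unfolding grad_energy_def power2_eq_square by (rule energy_eq[OF weak_pderiv_lam weak_pderiv_lam]) (use that in auto)
  ultimately consider "energy h lam lam = 0" | "\<not> degenerate" "e > 0" "C = \<top>" | "\<not> degenerate" "e > 0" "C < \<top>"
    using e_nonneg lam_degenerate by (cases degenerate; cases "e = 0"; cases "C = \<top>") (auto simp: degenerate_def less_top)
  then show ?thesis
  proof cases
    case 3
    define B where "B i = (\<integral>y. (w i y)\<^sup>2 * I_op r (edge_cell P Q i) (kuhn_edge i) h y \<partial>lborel)" for i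
    have summand: "(\<integral>x. (tent_grad r c i x)\<^sup>2 * h x \<partial>lborel) \<le> B i"
      and B0: "0 \<le> B i" and BC: "ennreal (B i) \<le> C * ennreal ((N (w i))\<^sup>2)" for i
    proof -
      obtain b where b: "averaging_kernel r (kuhn_edge i) (edge_cell P Q i) h (w i) b" "\<And>x. \<bar>w i x\<bar> \<le> b"
        using w_averaging[of i] by blast
      then interpret averaging_kernel r "kuhn_edge i" "edge_cell P Q i" h "w i" b by simp
      show "(\<integral>x. (tent_grad r c i x)\<^sup>2 * h x \<partial>lborel) \<le> B i"
        unfolding tent_grad_eq B_def by (rule interpolation_energy)
      show B0: "0 \<le> B i" unfolding B_def using I_h_nonneg by (intro integral_nonneg_AE) auto
      show "ennreal (B i) \<le> C * ennreal ((N (w i))\<^sup>2)"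
        unfolding B_def
        by (rule ennreal_divide_leD[OF C_bound[OF kuhn_edge_primal edge_cell_primal[OF P Q] weak_w(2) b(2)]])
           (use B0 3 in \<open>auto simp: B_def\<close>)
    qed
    have "ennreal (energy h lam lam) \<le> ennreal (\<Sum>i\<in>UNIV. B i)"
      unfolding E[OF 3(1)] grad_energy_def by (intro ennreal_leI sum_mono summand)
    also have "\<dots> = (\<Sum>i\<in>UNIV. ennreal (B i))" using B0 by (simp add: sum_ennreal)
    also have "\<dots> \<le> (\<Sum>i\<in>UNIV. C * ennreal ((N (w i))\<^sup>2))" by (rule sum_mono[OF BC])
    also have "\<dots> = C * ennreal e" by (simp add: e_eq sum_ennreal flip: sum_distrib_left)
    finally show ?thesis .
  qed (auto simp: ennreal_top_mult)
qed

end

section \<open>The direct integral\<close>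

text \<open>If \<open>X\<close> is not integrable, its Bochner integral is 0 by convention and the
  bound is trivial. So no measurability in s has to be shown for the fibre integrals that are put in
  for \<open>X\<close>.\<close>

lemma abs_integral_le_L2_norms:
  fixes X \<epsilon> :: "'a \<Rightarrow> real" and a b :: real
  assumes M: "prob_space M" and [measurable]: "\<epsilon> \<in> borel_measurable M"
    and \<epsilon>: "\<And>s. 0 \<le> \<epsilon> s" and a: "0 \<le> a" and b: "0 \<le> b"
    and le: "AE s in M. ennreal \<bar>X s\<bar> \<le> (ennreal a + ennreal b * \<delta> s) * ennreal (\<epsilon> s)"
  shows "ennreal \<bar>\<integral>s. X s \<partial>M\<bar> \<le> (ennreal a + ennreal b * L2_norm M \<delta>) * L2_norm M (\<lambda>s. ennreal (\<epsilon> s))"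
proof (cases "integrable M X")
  case True
  then have [measurable]: "X \<in> borel_measurable M" by auto
  have "ennreal \<bar>\<integral>s. X s \<partial>M\<bar> \<le> ennreal (\<integral>s. \<bar>X s\<bar> \<partial>M)"
    by (intro ennreal_leI integral_abs_bound)
  also have "\<dots> = (\<integral>\<^sup>+s. ennreal \<bar>X s\<bar> \<partial>M)"
    using True by (intro nn_integral_eq_integral[symmetric]) auto
  also have "\<dots> \<le> (ennreal a + ennreal b * L2_norm M \<delta>) * L2_norm M (\<lambda>s. ennreal (\<epsilon> s))"
    by (rule nn_integral_le_L2_norms[OF M _ _ _ \<epsilon> a b le]) auto
  finally show ?thesis .
qed (simp add: not_integrable_integral_eq)

lemma ennreal_integral_le:
  fixes X E :: "'a \<Rightarrow> real"
  assumes E: "integrable M E" "\<And>s. 0 \<le> E s" and X: "\<And>s. 0 \<le> X s"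
    and le: "\<And>s. s \<in> space M \<Longrightarrow> ennreal (X s) \<le> C s * ennreal (E s)"
  shows "ennreal (\<integral>s. X s \<partial>M) \<le> Linf_norm M C * ennreal (\<integral>s. E s \<partial>M)"
proof (cases "integrable M X")
  case True
  then have "ennreal (\<integral>s. X s \<partial>M) = (\<integral>\<^sup>+s. ennreal (X s) \<partial>M)"
    using X by (intro nn_integral_eq_integral[symmetric]) auto
  also have "\<dots> \<le> (\<integral>\<^sup>+s. Linf_norm M C * ennreal (E s) \<partial>M)"
  proof (rule nn_integral_mono_AE)
    show "AE s in M. ennreal (X s) \<le> Linf_norm M C * ennreal (E s)"
      using AE_le_Linf_norm[where M = M and F = C] AE_space
      by eventually_elim (blast intro: order_trans[OF le] mult_right_mono zero_le)
  qed
  also have "\<dots> = Linf_norm M C * (\<integral>\<^sup>+s. ennreal (E s) \<partial>M)"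
    using E by (intro nn_integral_cmult) auto
  also have "(\<integral>\<^sup>+s. ennreal (E s) \<partial>M) = ennreal (\<integral>s. E s \<partial>M)"
    using E by (intro nn_integral_eq_integral) auto
  finally show ?thesis .
qed (simp add: not_integrable_integral_eq)

section \<open>Measurability in the parameter s\<close>

lemma density_measure_kernel:
  fixes \<rho> :: "'s \<Rightarrow> real^'n \<Rightarrow> real"
  assumes "\<And>s. prob_space (density_measure (\<rho> s))"
    and "\<And>A. A \<in> sets borel \<Longrightarrow> (\<lambda>s. measure (density_measure (\<rho> s)) A) \<in> borel_measurable M"
  shows "(\<lambda>s. density_measure (\<rho> s)) \<in> measurable M (subprob_algebra borel)"
proof (rule measurable_subprob_algebra)
  show "subprob_space (density_measure (\<rho> s))" for s
    using assms(1) by (rule prob_space_imp_subprob_space)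
  show "sets (density_measure (\<rho> s)) = sets borel" for s by (simp add: density_measure_def)
  fix A :: "(real^'n) set" assume A: "A \<in> sets borel"
  have "emeasure (density_measure (\<rho> s)) A = ennreal (measure (density_measure (\<rho> s)) A)" for s
    using finite_measure.emeasure_eq_measure[OF prob_space.finite_measure[OF assms(1)]] .
  then show "(\<lambda>s. emeasure (density_measure (\<rho> s)) A) \<in> borel_measurable M"
    using assms(2)[OF A] by simp
qed

lemma measurable_integral_density_kernel:
  fixes \<rho> F :: "'s \<Rightarrow> real^'n \<Rightarrow> real"
  assumes K: "(\<lambda>s. density_measure (\<rho> s)) \<in> measurable M (subprob_algebra borel)"
    and \<rho>: "\<And>s. \<rho> s \<in> borel_measurable borel" "\<And>s x. 0 \<le> \<rho> s x"
    and F: "case_prod F \<in> borel_measurable (M \<Otimes>\<^sub>M borel)" "\<And>s x. 0 \<le> F s x"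
  shows "(\<lambda>s. \<integral>x. F s x * \<rho> s x \<partial>lborel) \<in> borel_measurable M"
proof -
  have "(\<lambda>(s, x). ennreal (F s x)) \<in> borel_measurable (M \<Otimes>\<^sub>M borel)"
    using F(1) by (simp add: split_def)
  from nn_integral_measurable_subprob_algebra2[OF this K]
  have "(\<lambda>s. enn2real (\<integral>\<^sup>+x. ennreal (F s x) \<partial>density_measure (\<rho> s))) \<in> borel_measurable M" by simp
  moreover have "(\<integral>x. F s x * \<rho> s x \<partial>lborel) = enn2real (\<integral>\<^sup>+x. ennreal (F s x) \<partial>density_measure (\<rho> s))"
    if s: "s \<in> space M" for s
  proof -
    have [measurable]: "F s \<in> borel_measurable borel" "\<rho> s \<in> borel_measurable borel"
      using measurable_compose_Pair1[OF s F(1)] \<rho> by auto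
    have "(\<integral>\<^sup>+x. ennreal (F s x) \<partial>density_measure (\<rho> s)) = (\<integral>\<^sup>+x. ennreal (\<rho> s x) * ennreal (F s x) \<partial>lborel)"
      unfolding density_measure_def by (rule nn_integral_density) auto
    also have "\<dots> = (\<integral>\<^sup>+x. ennreal (F s x * \<rho> s x) \<partial>lborel)"
      using F(2) \<rho>(2) by (simp add: ennreal_mult mult.commute)
    finally show ?thesis
      using F(2) \<rho>(2) by (simp add: integral_eq_nn_integral)
  qed
  ultimately show ?thesis by (simp cong: measurable_cong)
qed

lemma measurable_average:
  fixes u :: "'s \<Rightarrow> real^'n \<Rightarrow> real"
  assumes u: "case_prod u \<in> borel_measurable (M \<Otimes>\<^sub>M borel)" and [measurable]: "\<eta> \<in> borel_measurable borel"
  shows "(\<lambda>s. average r \<eta> (u s) \<alpha>) \<in> borel_measurable M"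
proof -
  have [measurable]: "(\<lambda>p. u (fst p) (snd p)) \<in> borel_measurable (M \<Otimes>\<^sub>M lborel)"
    using u unfolding measurable_cong_sets[OF sets_pair_measure_cong[OF refl sets_lborel] refl] by (simp add: split_def)
  have "(\<lambda>(s, y). scaled \<eta> r \<alpha> y * u s y) \<in> borel_measurable (M \<Otimes>\<^sub>M lborel)"
    unfolding split_def by measurable
  from lborel.borel_measurable_lebesgue_integral[OF this] show ?thesis
    unfolding average_def by simp
qed

lemma measurable_tent_grad_joint:
  fixes a :: "'s \<Rightarrow> real^'n \<Rightarrow> real"
  assumes "0 < r" and [measurable]: "\<And>\<alpha>. (\<lambda>s. a s \<alpha>) \<in> borel_measurable M"
  shows "(\<lambda>(s, x). tent_grad r (a s) i x) \<in> borel_measurable (M \<Otimes>\<^sub>M borel)"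
proof -
  have [measurable]: "(kuhn_edge i :: real^'n \<Rightarrow> real) \<in> borel_measurable borel"
    by (rule primalD[OF kuhn_edge_primal])
  have "(\<lambda>p. \<Sum>\<^sub>\<infinity>\<alpha>\<in>grid r. ((a (fst p) (\<alpha> + r *\<^sub>R axis i 1) - a (fst p) \<alpha>) / r) * scaled (kuhn_edge i) r \<alpha> (snd p))
      \<in> borel_measurable (M \<Otimes>\<^sub>M borel)"
  proof (rule borel_measurable_infsum_finite_support[OF countable_grid])
    fix p :: "'s \<times> (real^'n)"
    show "finite {\<alpha> \<in> grid r. ((a (fst p) (\<alpha> + r *\<^sub>R axis i 1) - a (fst p) \<alpha>) / r) * scaled (kuhn_edge i) r \<alpha> (snd p) \<noteq> 0}"
      by (rule finite_subset[OF _ finite_scaled_support[OF kuhn_edge_primal assms(1), of i "snd p"]]) auto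
  qed measurable
  then show ?thesis by (simp add: tent_grad_def split_def)
qed

theorem lemma2p3:
  fixes \<nu> :: "'s::polish_space measure"
    and \<rho> \<kappa> u :: "'s \<Rightarrow> real^'n \<Rightarrow> real"
    and f :: "'s \<Rightarrow> real"
    and g :: "real^'n \<Rightarrow> real"
    and r :: real
  assumes "CARD('n) \<ge> 2"
    and "prob_space \<nu>" and "sets \<nu> = sets borel"
    and "\<And>s. \<rho> s \<in> borel_measurable borel" and "\<And>s x. 0 \<le> \<rho> s x"
    and "\<And>s. prob_space (density_measure (\<rho> s))"
    and "\<And>A. A \<in> sets borel \<Longrightarrow>
           (\<lambda>s. measure (density_measure (\<rho> s)) A) \<in> borel_measurable \<nu>"
    and "f \<in> borel_measurable \<nu>" and "bounded (range f)"
    and "g \<in> Cc1"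
    and "case_prod \<kappa> \<in> borel_measurable (\<nu> \<Otimes>\<^sub>M borel)"
    and "\<And>s x. 0 \<le> \<kappa> s x \<and> \<kappa> s x \<le> 1"
    and "u \<in> direct_integral_domain \<nu> \<rho>"
    and "\<And>s x. - 1 \<le> u s x \<and> u s x \<le> 1"
    and "0 < r"
  shows "\<exists>lam\<in>tent_space \<nu> r.
    (\<exists>c. tent_expansion \<nu> r lam c \<and> (\<forall>\<alpha>\<in>grid r. \<forall>s. \<bar>c \<alpha> s\<bar> \<le> 1)) \<and>
    ennreal \<bar>\<integral>s. (\<integral>x. f s * g x * (u s x - lam s x) * \<kappa> s x \<partial>density_measure (\<rho> s)) \<partial>\<nu>\<bar>
      \<le> Linf_norm \<nu> (\<lambda>s. ennreal \<bar>f s\<bar>)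
         * (osc r g + sup_norm g * L2_norm \<nu> (\<lambda>s. delta_const r (\<kappa> s) (\<rho> s))) \<and>
    ennreal \<bar>\<integral>s. f s * energy (\<lambda>x. \<kappa> s x * \<rho> s x) g (\<lambda>x. u s x - lam s x) \<partial>\<nu>\<bar>
      \<le> ennreal (sqrt (real CARD('n))) * Linf_norm \<nu> (\<lambda>s. ennreal \<bar>f s\<bar>)
         * (grad_osc r g + grad_sup_norm g * L2_norm \<nu> (\<lambda>s. delta_const r (\<kappa> s) (\<rho> s)))
         * ennreal (sqrt (\<integral>s. energy (\<rho> s) (u s) (u s) \<partial>\<nu>)) \<and>
    ennreal (\<integral>s. energy (\<lambda>x. \<kappa> s x * \<rho> s x) (lam s) (lam s) \<partial>\<nu>)
      \<le> Linf_norm \<nu> (\<lambda>s. C_const r (\<kappa> s) (\<rho> s))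
         * ennreal (\<integral>s. energy (\<rho> s) (u s) (u s) \<partial>\<nu>)"
proof -
  note r = \<open>0 < r\<close>
  have sp: "space \<nu> = UNIV" using sets_eq_imp_space_eq[OF \<open>sets \<nu> = sets borel\<close>] by simp
  obtain P Q where PQ: "transition P" "transition Q" "\<And>t. (Q has_real_derivative bump_of P t) (at t)"
    using transition_pair by blast
  have u: "case_prod u \<in> borel_measurable (\<nu> \<Otimes>\<^sub>M borel)" "\<And>s. u s \<in> form_core"
    and Ei: "integrable \<nu> (\<lambda>s. energy (\<rho> s) (u s) (u s))"
    using assms(13) by (auto simp: direct_integral_domain_def sp)
  have \<kappa>s: "\<kappa> s \<in> borel_measurable borel" for s
    using measurable_compose_Pair1[OF _ assms(11), of s] by (simp add: sp)
  have fib: "fibre r (\<rho> s) (\<kappa> s) (u s) g P Q" for s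
  proof (rule fibre.intro[OF r assms(4-6) \<kappa>s assms(12) u(2) _ assms(10) PQ])
    show "\<bar>u s x\<bar> \<le> 1" for x using assms(14)[of s x] by linarith
  qed
  define E where "E s = energy (\<rho> s) (u s) (u s)" for s
  define c0 where "c0 s = average r (cell P) (u s)" for s
  define G where "G s = grad_energy r (\<lambda>x. \<kappa> s x * \<rho> s x) (c0 s)" for s
  \<comment> \<open>The coefficients of the locale, written as functions of s so that their
    measurability can be shown.\<close>
  define c where "c \<alpha> s = (if E s = 0 \<and> G s \<noteq> 0 then 0 else c0 s \<alpha>)" for \<alpha> s
  define lam where "lam s = tent_sum r (\<lambda>\<alpha>. c \<alpha> s)" for s
  define \<delta> where "\<delta> s = delta_const r (\<kappa> s) (\<rho> s)" for s
  have E0: "0 \<le> E s" for s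
    using fibre.e_nonneg[OF fib, of s] by (simp add: fibre.e_def[OF fib] E_def)
  have [measurable]: "E \<in> borel_measurable \<nu>" using Ei unfolding E_def by auto
  have c0m[measurable]: "(\<lambda>s. c0 s \<alpha>) \<in> borel_measurable \<nu>" for \<alpha>
    unfolding c0_def by (rule measurable_average[OF u(1) primalD(1)[OF cell_primal[OF PQ(1)]]])
  \<comment> \<open>This makes the set of degenerate fibres measurable, as the coefficients
    require.\<close>
  have [measurable]: "G \<in> borel_measurable \<nu>"
  proof -
    have K: "(\<lambda>s. density_measure (\<rho> s)) \<in> measurable \<nu> (subprob_algebra borel)"
      by (rule density_measure_kernel[OF assms(6,7)])
    have "(\<lambda>s. \<integral>x. ((tent_grad r (c0 s) i x)\<^sup>2 * \<kappa> s x) * \<rho> s x \<partial>lborel) \<in> borel_measurable \<nu>" for i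
    proof (rule measurable_integral_density_kernel[OF K assms(4,5)])
      have [measurable]: "(\<lambda>p. tent_grad r (c0 (fst p)) i (snd p)) \<in> borel_measurable (\<nu> \<Otimes>\<^sub>M borel)"
        "(\<lambda>p. \<kappa> (fst p) (snd p)) \<in> borel_measurable (\<nu> \<Otimes>\<^sub>M borel)"
        using measurable_tent_grad_joint[where a = c0 and i = i, OF r c0m] assms(11) by (simp_all add: split_def)
      show "(\<lambda>(s, x). (tent_grad r (c0 s) i x)\<^sup>2 * \<kappa> s x) \<in> borel_measurable (\<nu> \<Otimes>\<^sub>M borel)"
        unfolding split_def by measurable
    qed (use assms(12) in auto)
    then show ?thesis unfolding G_def grad_energy_def by (simp add: mult.assoc)
  qed
  have lam: "lam s = fibre.lam r (\<rho> s) (\<kappa> s) (u s) P" for s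
    unfolding lam_def fibre.lam_def[OF fib] c_def fibre.degenerate_def[OF fib] fibre.e_def[OF fib]
      fibre.c_def[OF fib] fibre.h_def[OF fib, abs_def] E_def G_def c0_def ..
  have h: "fibre.h (\<rho> s) (\<kappa> s) = (\<lambda>x. \<kappa> s x * \<rho> s x)" for s
    by (simp add: fibre.h_def[OF fib] fun_eq_iff)
  note fvalue = fibre.fibre_value[OF fib, folded lam \<delta>_def, unfolded h]
    and gradient = fibre.fibre_gradient[OF fib, folded lam \<delta>_def, unfolded h fibre.e_def[OF fib], folded E_def]
    and en = fibre.fibre_energy[OF fib, folded lam, unfolded h fibre.e_def[OF fib], folded E_def]
  have c1: "\<bar>c \<alpha> s\<bar> \<le> 1" for \<alpha> s
    using fibre.c_bound[OF fib, of s \<alpha>] by (simp add: c_def c0_def fibre.c_def[OF fib])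
  have exp: "tent_expansion \<nu> r lam c"
    unfolding tent_expansion_def
  proof (intro conjI exI[of _ 1] ballI allI)
    show "c \<alpha> \<in> borel_measurable \<nu>" for \<alpha>
      unfolding c_def[abs_def] by measurable
  qed (auto simp: c1 lam_def tent_sum_def)
  define F where "F = enn2real (Linf_norm \<nu> (\<lambda>s. ennreal \<bar>f s\<bar>))"
  have F: "ennreal F = Linf_norm \<nu> (\<lambda>s. ennreal \<bar>f s\<bar>)"
  proof -
    obtain B where "\<And>s. \<bar>f s\<bar> \<le> B" using assms(9) by (auto simp: bounded_iff)
    then have "Linf_norm \<nu> (\<lambda>s. ennreal \<bar>f s\<bar>) \<le> ennreal B"
      unfolding Linf_norm_def by (intro Inf_lower) (auto intro: ennreal_leI)
    then show ?thesis by (simp add: F_def le_less_trans[of _ "ennreal B"])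
  qed
  have F0: "0 \<le> F" by (simp add: F_def)
  have fF: "AE s in \<nu>. ennreal \<bar>f s\<bar> \<le> ennreal F"
    unfolding F by (rule AE_le_Linf_norm)
  note b = Cc1_bounds[OF \<open>g \<in> Cc1\<close>]
  define L where "L s = (\<integral>x. g x * (u s x - lam s x) * (\<kappa> s x * \<rho> s x) \<partial>lborel)" for s
  have inner: "(\<integral>x. f s * g x * (u s x - lam s x) * \<kappa> s x \<partial>density_measure (\<rho> s)) = f s * L s" for s
  proof -
    have [measurable]: "g \<in> borel_measurable borel" "u s \<in> borel_measurable borel" "lam s \<in> borel_measurable borel"
      "\<rho> s \<in> borel_measurable borel"
      using Cc1D(2)[OF \<open>g \<in> Cc1\<close>] fibre.measurable_u[OF fib] assms(4) measurable_grid_sum[OF tent_primal r]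
      by (auto simp: lam_def tent_sum_def[abs_def] intro: borel_measurable_continuous_onI)
    note [measurable] = \<kappa>s
    have "(\<integral>x. f s * g x * (u s x - lam s x) * \<kappa> s x \<partial>density_measure (\<rho> s)) =
        (\<integral>x. \<rho> s x *\<^sub>R (f s * g x * (u s x - lam s x) * \<kappa> s x) \<partial>lborel)"
      unfolding density_measure_def using assms(5) by (intro integral_density) auto
    also have "\<dots> = (\<integral>x. f s * (g x * (u s x - lam s x) * (\<kappa> s x * \<rho> s x)) \<partial>lborel)"
      by (simp add: ac_simps)
    finally show ?thesis by (simp add: L_def)
  qed
  define \<omega>0 where "\<omega>0 = enn2real (osc r g)"
  define D0 where "D0 = enn2real (sup_norm g)"
  define \<omega>1 where "\<omega>1 = enn2real (grad_osc r g)"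
  define D1 where "D1 = enn2real (grad_sup_norm g)"
  note defs = \<omega>0_def D0_def \<omega>1_def D1_def
  have nn: "0 \<le> \<omega>0" "0 \<le> D0" "0 \<le> \<omega>1" "0 \<le> D1" by (simp_all add: defs)
  have ii: "ennreal \<bar>\<integral>s. f s * L s \<partial>\<nu>\<bar> \<le> ennreal F * (osc r g + sup_norm g * L2_norm \<nu> \<delta>)"
  proof -
    \<comment> \<open>The weight is the constant 1, whose L^2 norm is 1 under a probability
      measure.\<close>
    have "ennreal \<bar>\<integral>s. f s * L s \<partial>\<nu>\<bar> \<le>
        (ennreal (F * \<omega>0) + ennreal (F * D0) * L2_norm \<nu> \<delta>) * L2_norm \<nu> (\<lambda>s. ennreal 1)"
    proof (rule abs_integral_le_L2_norms[OF assms(2)])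
      show "AE s in \<nu>. ennreal \<bar>f s * L s\<bar> \<le> (ennreal (F * \<omega>0) + ennreal (F * D0) * \<delta> s) * ennreal 1"
        using fF
      proof eventually_elim
        case (elim s)
        have "ennreal \<bar>f s * L s\<bar> = ennreal \<bar>f s\<bar> * ennreal \<bar>L s\<bar>" by (simp add: abs_mult ennreal_mult)
        also have "\<dots> \<le> ennreal F * (osc r g + sup_norm g * \<delta> s)"
          unfolding L_def by (intro mult_mono elim fvalue) auto
        also have "\<dots> = (ennreal (F * \<omega>0) + ennreal (F * D0) * \<delta> s) * ennreal 1"
          using F0 nn b(1,3) by (simp add: defs ennreal_mult distrib_left mult.assoc)
        finally show ?case .
      qed
    qed (use F0 nn in auto)
    also have "\<dots> = ennreal F * (osc r g + sup_norm g * L2_norm \<nu> \<delta>)"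
      using F0 nn b(1,3) L2_norm_one[OF assms(2)] by (simp add: defs ennreal_mult distrib_left mult.assoc)
    finally show ?thesis .
  qed
  define W where "W s = energy (\<lambda>x. \<kappa> s x * \<rho> s x) g (\<lambda>x. u s x - lam s x)" for s
  let ?n = "sqrt CARD('n)"
  have iii: "ennreal \<bar>\<integral>s. f s * W s \<partial>\<nu>\<bar> \<le>
      ennreal ?n * ennreal F * (grad_osc r g + grad_sup_norm g * L2_norm \<nu> \<delta>) * ennreal (sqrt (\<integral>s. E s \<partial>\<nu>))"
  proof -
    \<comment> \<open>Here the weight is the root of the fibre energy; its L^2 norm is the root of
      the total energy.\<close>
    have "ennreal \<bar>\<integral>s. f s * W s \<partial>\<nu>\<bar> \<le>
        (ennreal (F * (?n * \<omega>1)) + ennreal (F * (?n * D1)) * L2_norm \<nu> \<delta>) * L2_norm \<nu> (\<lambda>s. ennreal (sqrt (E s)))"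
    proof (rule abs_integral_le_L2_norms[OF assms(2)])
      show "AE s in \<nu>. ennreal \<bar>f s * W s\<bar> \<le>
          (ennreal (F * (?n * \<omega>1)) + ennreal (F * (?n * D1)) * \<delta> s) * ennreal (sqrt (E s))"
        using fF
      proof eventually_elim
        case (elim s)
        have "ennreal \<bar>f s * W s\<bar> = ennreal \<bar>f s\<bar> * ennreal \<bar>W s\<bar>" by (simp add: abs_mult ennreal_mult)
        also have "\<dots> \<le> ennreal F * ((ennreal (?n * \<omega>1) + ennreal (?n * D1) * \<delta> s) * ennreal (sqrt (E s)))"
          unfolding W_def defs by (intro mult_mono elim gradient) auto
        also have "\<dots> = (ennreal (F * (?n * \<omega>1)) + ennreal (F * (?n * D1)) * \<delta> s) * ennreal (sqrt (E s))"
          using F0 nn by (simp add: ennreal_mult'[of F] distrib_left distrib_right mult.assoc)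
        finally show ?case .
      qed
    qed (use F0 nn E0 in auto)
    also have "L2_norm \<nu> (\<lambda>s. ennreal (sqrt (E s))) = ennreal (sqrt (\<integral>s. E s \<partial>\<nu>))"
    proof -
      have "(ennreal (sqrt (E s)))\<^sup>2 = ennreal (E s)" for s using E0 by (simp add: ennreal_power)
      then have "L2_norm \<nu> (\<lambda>s. ennreal (sqrt (E s))) = ennreal_sqrt (ennreal (\<integral>s. E s \<partial>\<nu>))"
        using Ei E0 by (simp add: L2_norm_def nn_integral_eq_integral E_def)
      then show ?thesis using E0 by (simp add: ennreal_sqrt_ennreal integral_nonneg_AE)
    qed
    also have "(ennreal (F * (?n * \<omega>1)) + ennreal (F * (?n * D1)) * L2_norm \<nu> \<delta>) * ennreal (sqrt (\<integral>s. E s \<partial>\<nu>)) =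
        ennreal ?n * ennreal F * (grad_osc r g + grad_sup_norm g * L2_norm \<nu> \<delta>) * ennreal (sqrt (\<integral>s. E s \<partial>\<nu>))"
      using F0 nn b(5,7) by (simp add: defs ennreal_mult distrib_left distrib_right ac_simps)
    finally show ?thesis .
  qed
  have Wl: "0 \<le> energy (\<lambda>x. \<kappa> s x * \<rho> s x) (lam s) (lam s)" for s
    unfolding energy_def using assms(5,12) by (intro sum_nonneg integral_nonneg_AE) auto
  have iv: "ennreal (\<integral>s. energy (\<lambda>x. \<kappa> s x * \<rho> s x) (lam s) (lam s) \<partial>\<nu>)
      \<le> Linf_norm \<nu> (\<lambda>s. C_const r (\<kappa> s) (\<rho> s)) * ennreal (\<integral>s. E s \<partial>\<nu>)"
    by (rule ennreal_integral_le) (use Ei E0 Wl en in \<open>auto simp: E_def\<close>)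
  show ?thesis
  proof (intro bexI[of _ lam] conjI)
    show "lam \<in> tent_space \<nu> r" using exp by (auto simp: tent_space_def)
    show "\<exists>c. tent_expansion \<nu> r lam c \<and> (\<forall>\<alpha>\<in>grid r. \<forall>s. \<bar>c \<alpha> s\<bar> \<le> 1)"
      using exp c1 by blast
  qed (use ii iii iv in \<open>simp_all add: inner F W_def E_def \<delta>_def[abs_def]\<close>)
qed

end
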